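(* Let $G$ be a non-compact, locally compact, second countable group which has the Haagerup property. Then there exists a $C_0$-dynamical system $(\Omega,\mathcal B,\mu,G)$ such that $L^\infty(\Omega)$ has a $G$-invariant mean. More precisely: (1) the measure $\mu$ is $\sigma$-finite, $G$-invariant and the Hilbert space $L^2(\Omega,\mu)$ is separable; (2) for all measurable sets $A,B\in\mathcal B$ such that $0\le\mu(A),\mu(B)<\infty$, we have $$\lim_{g\to\infty}\mu(gA\cap B)=0;$$ in other words, $\pi_\Omega$ is a $C_0$-representation; (3) there exists a sequence of unit vectors $(\xi_n)\subset L^2(\Omega,\mu)$ such that $\xi_n\ge 0$ for every $n$, and for every (non-empty) compact set $K\subset G$, one has $$\lim_{n\to\infty}\inf_{g\in K}\langle\pi_\Omega(g)\xi_n|\xi_n\rangle=1;$$ in other words, the dynamical system $(\Omega,\mathcal B,\mu,G)$ has an invariant mean.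
   Context: A locally compact second countable group $G$ has the Haagerup property if there exists a sequence $(\varphi_n)_{n\ge1}$ of normalized ($\varphi_n(e)=1$) continuous positive definite functions on $G$ such that $\varphi_n\to1$ uniformly on compact subsets of $G$ and each $\varphi_n\in C_0(G)$, i.e. $\varphi_n$ vanishes at infinity. Let $(\Omega,\mathcal B,\mu)$ be a measure space on which $G$ acts by Borel (measurable) automorphisms which preserve $\mu$. The dynamical system $(\Omega,\mathcal B,\mu,G)$ is a $C_0$-dynamical system if for all $A,B\in\mathcal B$ with $0\le\mu(A),\mu(B)<\infty$ one has $\lim_{g\to\infty}\mu(gA\cap B)=0$. Here $g\to\infty$ means that $g$ leaves every compact subset of $G$. $\pi_\Omega$ denotes the permutation representation of $G$ on $L^2(\Omega,\mu)$: $(\pi_\Omega(g)\xi)(\omega)=\xi(g^{-1}\omega)$. A unitary representation of $G$ is a $C_0$-representation if all its coefficient functions $g\mapsto\langle\pi(g)\xi|\eta\rangle$ belong to $C_0(G)$. A $G$-invariant mean on $L^\infty(\Omega)$ is a positive linear functional $M$ on $L^\infty(\Omega,\mu)$ with $M(1)=1$ which is invariant under the induced action of $G$. *)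

theory Defs
  imports "HOL-Analysis.Analysis"
begin

text \<open>
  Groups are written additively, following the library class of topological groups:
  \<open>group_add\<close> does not assume commutativity, \<open>0\<close> is the neutral element and \<open>- g\<close> the inverse.
\<close>

section \<open>Functions on a group vanishing at infinity\<close>

text \<open>The filter of ``g leaves every compact set''. It is \<open>bot\<close> iff the whole space is compact.\<close>

definition cocompact :: "'a::topological_space filter" where
  "cocompact = (INF K\<in>{K. compact K}. principal (- K))"

lemma eventually_cocompact:
  "eventually P (cocompact :: 'a::topological_space filter) \<longleftrightarrow>
     (\<exists>K. compact K \<and> (\<forall>x. x \<notin> K \<longrightarrow> P x))"
proof -
  have "eventually P (cocompact :: 'a filter) \<longleftrightarrow>
      (\<exists>K\<in>{K. compact K}. eventually P (principal (- K)))"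
    unfolding cocompact_def
  proof (rule eventually_INF_base)
    show "{K :: 'a set. compact K} \<noteq> {}"
      using compact_empty by blast
    fix K L :: "'a set"
    assume "K \<in> {K. compact K}" "L \<in> {K. compact K}"
    then show "\<exists>x\<in>{K. compact K}.
        principal (- x) \<le> inf (principal (- K)) (principal (- L))"
      by (intro bexI[of _ "K \<union> L"]) (auto simp: compact_Un)
  qed
  then show ?thesis
    by (auto simp: eventually_principal)
qed

definition C0_function :: "('a::topological_space \<Rightarrow> complex) \<Rightarrow> bool" where
  "C0_function f \<longleftrightarrow> continuous_on UNIV f \<and> (f \<longlongrightarrow> 0) cocompact"

section \<open>The Haagerup property\<close>

definition positive_definite :: "('g::group_add \<Rightarrow> complex) \<Rightarrow> bool" where
  "positive_definite \<phi> \<longleftrightarrow>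
     (\<forall>(n::nat) (g :: nat \<Rightarrow> 'g) (c :: nat \<Rightarrow> complex).
        (\<Sum>i<n. \<Sum>j<n. c i * cnj (c j) * \<phi> (- g j + g i)) \<in> \<real>\<^sub>\<ge>\<^sub>0)"

definition haagerup_property :: "'g::topological_group_add itself \<Rightarrow> bool" where
  "haagerup_property (_ :: 'g itself) \<longleftrightarrow>
     (\<exists>\<phi> :: nat \<Rightarrow> 'g \<Rightarrow> complex.
        (\<forall>n. \<phi> n 0 = 1 \<and> positive_definite (\<phi> n) \<and> C0_function (\<phi> n)) \<and>
        (\<forall>K. compact K \<longrightarrow> uniform_limit K \<phi> (\<lambda>_. 1) sequentially))"

section \<open>Dynamical systems\<close>

text \<open>
  Each \<open>a g\<close> is invertible on \<open>space M\<close>, with measurable inverse \<open>a (- g)\<close>, by the group law.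
  The values of \<open>a g\<close> outside \<open>space M\<close> play no role.
\<close>

definition dynamical_system :: "'w measure \<Rightarrow> ('g::group_add \<Rightarrow> 'w \<Rightarrow> 'w) \<Rightarrow> bool" where
  "dynamical_system M a \<longleftrightarrow>
     (\<forall>g. a g \<in> measurable M M) \<and>
     (\<forall>\<omega>\<in>space M. a 0 \<omega> = \<omega>) \<and>
     (\<forall>g h. \<forall>\<omega>\<in>space M. a (g + h) \<omega> = a g (a h \<omega>)) \<and>
     (\<forall>g. distr M M (a g) = M)"

definition C0_dynamical_system ::
    "'w measure \<Rightarrow> ('g::topological_group_add \<Rightarrow> 'w \<Rightarrow> 'w) \<Rightarrow> bool" where
  "C0_dynamical_system M a \<longleftrightarrow>
     dynamical_system M a \<and>
     (\<forall>A\<in>sets M. \<forall>B\<in>sets M. emeasure M A < \<infinity> \<longrightarrow> emeasure M B < \<infinity> \<longrightarrow>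
        ((\<lambda>g. measure M (a g ` A \<inter> B)) \<longlongrightarrow> 0) cocompact)"

section \<open>The Hilbert space of square integrable functions\<close>

text \<open>
  Elements of $L^2$ are represented by complex functions; two functions represent the same element
  iff they agree almost everywhere.
\<close>

definition L2 :: "'w measure \<Rightarrow> ('w \<Rightarrow> complex) set" where
  "L2 M = {f \<in> borel_measurable M. integrable M (\<lambda>\<omega>. (cmod (f \<omega>))\<^sup>2)}"

definition L2_inner :: "'w measure \<Rightarrow> ('w \<Rightarrow> complex) \<Rightarrow> ('w \<Rightarrow> complex) \<Rightarrow> complex" where
  "L2_inner M f h = (LINT \<omega>|M. f \<omega> * cnj (h \<omega>))"

definition L2_norm :: "'w measure \<Rightarrow> ('w \<Rightarrow> complex) \<Rightarrow> real" where
  "L2_norm M f = sqrt (LINT \<omega>|M. (cmod (f \<omega>))\<^sup>2)"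

definition separable_L2 :: "'w measure \<Rightarrow> bool" where
  "separable_L2 M \<longleftrightarrow>
     (\<exists>D. countable D \<and> D \<subseteq> L2 M \<and>
        (\<forall>f\<in>L2 M. \<forall>\<epsilon>>0. \<exists>d\<in>D. L2_norm M (\<lambda>\<omega>. f \<omega> - d \<omega>) < \<epsilon>))"

section \<open>Unitary representations on square integrable functions\<close>

definition unitary_representation_L2 ::
    "'w measure \<Rightarrow> ('g::topological_group_add \<Rightarrow> ('w \<Rightarrow> complex) \<Rightarrow> ('w \<Rightarrow> complex)) \<Rightarrow> bool" where
  "unitary_representation_L2 M \<pi> \<longleftrightarrow>
     (\<forall>g. \<forall>f\<in>L2 M. \<pi> g f \<in> L2 M) \<and>
     (\<forall>g. \<forall>f\<in>L2 M. \<forall>h\<in>L2 M. \<forall>c d. AE \<omega> in M.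
        \<pi> g (\<lambda>\<omega>. c * f \<omega> + d * h \<omega>) \<omega> = c * \<pi> g f \<omega> + d * \<pi> g h \<omega>) \<and>
     (\<forall>g. \<forall>f\<in>L2 M. \<forall>h\<in>L2 M. L2_inner M (\<pi> g f) (\<pi> g h) = L2_inner M f h) \<and>
     (\<forall>f\<in>L2 M. AE \<omega> in M. \<pi> 0 f \<omega> = f \<omega>) \<and>
     (\<forall>g h. \<forall>f\<in>L2 M. AE \<omega> in M. \<pi> (g + h) f \<omega> = \<pi> g (\<pi> h f) \<omega>) \<and>
     (\<forall>f\<in>L2 M. \<forall>g. ((\<lambda>h. L2_norm M (\<lambda>\<omega>. \<pi> h f \<omega> - \<pi> g f \<omega>)) \<longlongrightarrow> 0) (at g))"

definition C0_representation_L2 ::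
    "'w measure \<Rightarrow> ('g::topological_group_add \<Rightarrow> ('w \<Rightarrow> complex) \<Rightarrow> ('w \<Rightarrow> complex)) \<Rightarrow> bool" where
  "C0_representation_L2 M \<pi> \<longleftrightarrow>
     unitary_representation_L2 M \<pi> \<and>
     (\<forall>f\<in>L2 M. \<forall>h\<in>L2 M. C0_function (\<lambda>g. L2_inner M (\<pi> g f) h))"

definition permutation_rep ::
    "('g::group_add \<Rightarrow> 'w \<Rightarrow> 'w) \<Rightarrow> 'g \<Rightarrow> ('w \<Rightarrow> complex) \<Rightarrow> ('w \<Rightarrow> complex)" where
  "permutation_rep a g f = (\<lambda>\<omega>. f (a (- g) \<omega>))"

section \<open>Invariant means\<close>

definition Linfinity :: "'w measure \<Rightarrow> ('w \<Rightarrow> complex) set" where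
  "Linfinity M = {f \<in> borel_measurable M. \<exists>C. AE \<omega> in M. cmod (f \<omega>) \<le> C}"

text \<open>
  The first clause makes the functional well defined on classes of functions modulo null sets.
  The action induced on $L^\infty$ is given by the same formula as the one on $L^2$.
\<close>

definition invariant_mean ::
    "'w measure \<Rightarrow> ('g::group_add \<Rightarrow> 'w \<Rightarrow> 'w) \<Rightarrow> (('w \<Rightarrow> complex) \<Rightarrow> complex) \<Rightarrow> bool" where
  "invariant_mean M a m \<longleftrightarrow>
     (\<forall>f\<in>Linfinity M. \<forall>h\<in>Linfinity M. (AE \<omega> in M. f \<omega> = h \<omega>) \<longrightarrow> m f = m h) \<and>
     (\<forall>f\<in>Linfinity M. \<forall>h\<in>Linfinity M. \<forall>c d. m (\<lambda>\<omega>. c * f \<omega> + d * h \<omega>) = c * m f + d * m h) \<and>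
     (\<forall>f\<in>Linfinity M. (AE \<omega> in M. f \<omega> \<in> \<real>\<^sub>\<ge>\<^sub>0) \<longrightarrow> m f \<in> \<real>\<^sub>\<ge>\<^sub>0) \<and>
     m (\<lambda>_. 1) = 1 \<and>
     (\<forall>g. \<forall>f\<in>Linfinity M. m (permutation_rep a g f) = m f)"

end

theory Submission
  imports Defs "HOL-Probability.Probability"
begin

text \<open>
  The dynamical system is the space of paths of one Gaussian process with stationary increments,
  started from Lebesgue measure on the real line.

  Write \<open>\<phi> n\<close> for the positive definite functions given by the Haagerup property. Along a
  sufficiently fast subsequence the sum \<open>\<psi>\<close> of the functions \<open>1 - Re (\<phi> n)\<close> converges locally
  uniformly to a continuous, conditionally negative definite function with \<open>\<psi> 0 = 0\<close> that tends
  to infinity at infinity (\<open>proper_conditionally_negative_function\<close>). By Schoenberg's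
  observation \<open>(\<psi> g + \<psi> h - \<psi> (- h + g)) / 2\<close> is a positive semidefinite kernel, hence the
  covariance of a centred Gaussian process \<open>b\<close> on the group (\<open>gaussian_process_exists\<close>);
  its increment \<open>b g - b h\<close> has variance \<open>\<psi> (- h + g)\<close>. The measure is the law of
  the path \<open>\<lambda>g. s + b g\<close>, where \<open>s\<close> is independent of \<open>b\<close> and distributed by Lebesgue
  measure, and the group acts by translating the index. The measure is invariant (\<open>distr_shift\<close>):
  a translation replaces \<open>b\<close> by its increments from another point, which have the same law, and
  moves \<open>s\<close> by an amount depending on \<open>b\<close> only, which Lebesgue measure does not notice.

  Let \<open>X g = s + b g\<close>. Everything else rests on two estimates. First, if \<open>X g\<close> and \<open>X h\<close> are
  both bounded by \<open>R\<close>, then \<open>b g - b h\<close> is bounded by \<open>2 * R\<close>; such paths have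
  measure of order \<open>R\<^sup>2 / sqrt (\<psi> (- h + g))\<close> (\<open>emeasure_bounded_pair\<close>). As \<open>\<psi>\<close> is proper,
  the coefficients of the permutation representation vanish at infinity. Second, the paths with
  \<open>X g\<close> in an interval and \<open>X h\<close> outside have measure at most the mean of \<open>\<bar>b g - b h\<bar>\<close>, thus at
  most \<open>sqrt (\<psi> (- h + g))\<close>, however long the interval is (\<open>emeasure_interval_leave\<close>).
  Hence the slabs where \<open>X 0\<close> lies between \<open>0\<close> and \<open>n\<close>, which have measure \<open>n\<close>, are asymptotically
  invariant, uniformly on compact sets. Their normalised indicators are the required unit vectors, and
  a cluster point of the averages over them is an invariant mean. Since \<open>\<psi>\<close> is
  continuous with \<open>\<psi> 0 = 0\<close>, the second estimate also gives the strong continuity of the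
  representation and the separability of the Hilbert space.

  The estimates concern cylinder sets; they are transported to all square integrable functions by
  the density argument \<open>L2_induct\<close>.
\<close>

section \<open>Uniqueness of laws with given characteristic functions\<close>


text \<open>
  The weights are densities up to a common normalisation, so this is the uniqueness theorem for
  characteristic functions on the line, applied to the laws of \<open>X\<close> and \<open>Y\<close> under these
  densities. The lower bound \<open>1\<close> keeps the normalising constant away from \<open>0\<close>.
\<close>

lemma weighted_char_unique:
  fixes X :: "'a \<Rightarrow> real" and Y :: "'b \<Rightarrow> real" and u :: "'a \<Rightarrow> real" and v :: "'b \<Rightarrow> real"
  assumes "prob_space M" "prob_space N"
    and [measurable]: "X \<in> borel_measurable M" "u \<in> borel_measurable M"
      "Y \<in> borel_measurable N" "v \<in> borel_measurable N" "B \<in> sets borel"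
    and u: "\<And>x. 1 \<le> u x \<and> u x \<le> C" and v: "\<And>x. 1 \<le> v x \<and> v x \<le> C"
    and eq: "\<And>s. (CLINT x|M. u x * iexp (s * X x)) = (CLINT x|N. v x * iexp (s * Y x))"
  shows "(LINT x|M. u x * indicator B (X x)) = (LINT x|N. v x * indicator B (Y x))"
proof -
  interpret M: prob_space M by fact
  interpret N: prob_space N by fact
  define c where "c = (LINT x|M. u x)"
  have iu: "integrable M u" by (rule M.integrable_const_bound[of _ C]) (use u in \<open>auto intro!: AE_I2 simp: abs_of_pos[OF less_le_trans[OF zero_less_one]]\<close>)
  have iv: "integrable N v" by (rule N.integrable_const_bound[of _ C]) (use v in \<open>auto intro!: AE_I2 simp: abs_of_pos[OF less_le_trans[OF zero_less_one]]\<close>)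
  have c': "c = (LINT x|N. v x)"
  proof -
    have "complex_of_real c = complex_of_real (LINT x|N. v x)"
      using eq[of 0] by (simp add: c_def)
    then show ?thesis by (simp only: of_real_eq_iff)
  qed
  have c: "1 \<le> c"
    unfolding c_def using integral_mono[OF _ iu, of "\<lambda>_. 1"] u by (simp add: M.prob_space)
  define M1 where "M1 = distr (density M (\<lambda>x. ennreal (u x / c))) borel X"
  define N1 where "N1 = distr (density N (\<lambda>x. ennreal (v x / c))) borel Y"
  have uc: "0 \<le> u x / c" for x using u[of x] c by auto
  have vc: "0 \<le> v x / c" for x using v[of x] c by auto
  have "emeasure (density M (\<lambda>x. ennreal (u x / c))) (space M) = (\<integral>\<^sup>+x. ennreal (u x / c) \<partial>M)"
    by (subst emeasure_density) (auto intro!: nn_integral_cong)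
  also have "\<dots> = ennreal (LINT x|M. u x / c)"
    by (rule nn_integral_eq_integral) (use iu uc in auto)
  also have "\<dots> = 1" using c by (simp add: c_def[symmetric])
  finally have pM: "prob_space (density M (\<lambda>x. ennreal (u x / c)))" by (intro prob_spaceI) simp
  have "emeasure (density N (\<lambda>x. ennreal (v x / c))) (space N) = (\<integral>\<^sup>+x. ennreal (v x / c) \<partial>N)"
    by (subst emeasure_density) (auto intro!: nn_integral_cong)
  also have "\<dots> = ennreal (LINT x|N. v x / c)"
    by (rule nn_integral_eq_integral) (use iv vc in auto)
  also have "\<dots> = 1" using c by (simp add: c'[symmetric])
  finally have pN: "prob_space (density N (\<lambda>x. ennreal (v x / c)))" by (intro prob_spaceI) simp
  have M1: "real_distribution M1" unfolding M1_def
    by (intro prob_space.real_distribution_distr pM) auto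
  have N1: "real_distribution N1" unfolding N1_def
    by (intro prob_space.real_distribution_distr pN) auto
  have chM: "char M1 s = (CLINT x|M. u x * iexp (s * X x)) / c" for s
  proof -
    have "char M1 s = (CLINT x|M. (u x / c) *\<^sub>R iexp (s * X x))"
      unfolding char_def M1_def
      by (subst integral_distr, simp, simp, subst integral_density) (use uc in auto)
    also have "\<dots> = (CLINT x|M. (u x * iexp (s * X x)) / c)"
      by (simp add: scaleR_conv_of_real)
    finally show ?thesis by simp
  qed
  have chN: "char N1 s = (CLINT x|N. v x * iexp (s * Y x)) / c" for s
  proof -
    have "char N1 s = (CLINT x|N. (v x / c) *\<^sub>R iexp (s * Y x))"
      unfolding char_def N1_def
      by (subst integral_distr, simp, simp, subst integral_density) (use vc in auto)
    also have "\<dots> = (CLINT x|N. (v x * iexp (s * Y x)) / c)"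
      by (simp add: scaleR_conv_of_real)
    finally show ?thesis by simp
  qed
  have "M1 = N1" by (intro Levy_uniqueness M1 N1 ext) (simp only: chM chN eq)
  then have "(LINT x|M1. indicator B x :: real) = (LINT x|N1. indicator B x)" by simp
  also have "(LINT x|M1. indicator B x :: real) = (LINT x|M. (u x / c) *\<^sub>R indicator B (X x))"
    unfolding M1_def by (subst integral_distr, simp, simp, subst integral_density) (use uc in auto)
  also have "(LINT x|N1. indicator B x :: real) = (LINT x|N. (v x / c) *\<^sub>R indicator B (Y x))"
    unfolding N1_def by (subst integral_distr, simp, simp, subst integral_density) (use vc in auto)
  finally show ?thesis using c by simp
qed

text \<open>
  Complex weights reduce to positive ones: if \<open>f\<close> is bounded by \<open>1\<close>, then \<open>2 + Re f\<close> and
  \<open>2 + Im f\<close> take values between \<open>1\<close> and \<open>3\<close>, and both are linear combinations of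
  \<open>1\<close>, \<open>f\<close> and \<open>cnj f\<close>. The transform of \<open>cnj f\<close> is the conjugate of the transform of
  \<open>f\<close> at \<open>- s\<close>.
\<close>

lemma complex_weighted_char_unique:
  fixes X :: "'a \<Rightarrow> real" and Y :: "'b \<Rightarrow> real" and f :: "'a \<Rightarrow> complex" and g :: "'b \<Rightarrow> complex"
  assumes pM: "prob_space M" and pN: "prob_space N"
    and [measurable]: "X \<in> borel_measurable M" "f \<in> borel_measurable M"
      "Y \<in> borel_measurable N" "g \<in> borel_measurable N" "B \<in> sets borel"
    and f: "\<And>x. cmod (f x) \<le> 1" and g: "\<And>x. cmod (g x) \<le> 1"
    and eq0: "\<And>s. (CLINT x|M. iexp (s * X x)) = (CLINT x|N. iexp (s * Y x))"
    and eq: "\<And>s. (CLINT x|M. f x * iexp (s * X x)) = (CLINT x|N. g x * iexp (s * Y x))"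
  shows "(CLINT x|M. f x * indicator B (X x)) = (CLINT x|N. g x * indicator B (Y x))"
proof -
  interpret M: prob_space M by fact
  interpret N: prob_space N by fact
  have iM: "integrable M (\<lambda>x. iexp (s * X x))" for s by (rule M.integrable_const_bound[of _ 1]) auto
  have iN: "integrable N (\<lambda>x. iexp (s * Y x))" for s by (rule N.integrable_const_bound[of _ 1]) auto
  have ifM: "integrable M (\<lambda>x. f x * iexp (s * X x))" for s
    by (rule M.integrable_const_bound[of _ 1]) (use f in \<open>auto simp: norm_mult\<close>)
  have igN: "integrable N (\<lambda>x. g x * iexp (s * Y x))" for s
    by (rule N.integrable_const_bound[of _ 1]) (use g in \<open>auto simp: norm_mult\<close>)
  have cf: "cnj (f x * iexp (- s * X x)) = cnj (f x) * iexp (s * X x)" for s x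
    by (simp add: exp_cnj)
  have cg: "cnj (g x * iexp (- s * Y x)) = cnj (g x) * iexp (s * Y x)" for s x
    by (simp add: exp_cnj)
  have icM: "integrable M (\<lambda>x. cnj (f x) * iexp (s * X x))" for s
    using integrable_cnj[OF ifM[of "-s"]] unfolding cf .
  have icN: "integrable N (\<lambda>x. cnj (g x) * iexp (s * Y x))" for s
    using integrable_cnj[OF igN[of "-s"]] unfolding cg .
  have eqc: "(CLINT x|M. cnj (f x) * iexp (s * X x)) = (CLINT x|N. cnj (g x) * iexp (s * Y x))" for s
    using arg_cong[OF eq[of "-s"], of cnj] unfolding Bochner_Integration.integral_cnj[symmetric] cf cg .
  have linM: "(CLINT x|M. 2 * iexp (s * X x) + a * (f x * iexp (s * X x)) + b * (cnj (f x) * iexp (s * X x))) =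
      2 * (CLINT x|M. iexp (s * X x)) + a * (CLINT x|M. f x * iexp (s * X x)) + b * (CLINT x|M. cnj (f x) * iexp (s * X x))" for s a b
    using iM[of s] ifM[of s] icM[of s] by simp
  have linN: "(CLINT x|N. 2 * iexp (s * Y x) + a * (g x * iexp (s * Y x)) + b * (cnj (g x) * iexp (s * Y x))) =
      2 * (CLINT x|N. iexp (s * Y x)) + a * (CLINT x|N. g x * iexp (s * Y x)) + b * (CLINT x|N. cnj (g x) * iexp (s * Y x))" for s a b
    using iN[of s] igN[of s] icN[of s] by simp
  have bR: "1 \<le> 2 + Re z \<and> 2 + Re z \<le> 3" "1 \<le> 2 + Im z \<and> 2 + Im z \<le> 3" if "cmod z \<le> 1" for z
    using abs_Re_le_cmod[of z] abs_Im_le_cmod[of z] that by (auto simp: abs_le_iff)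
  have R: "(LINT x|M. (2 + Re (f x)) * indicator B (X x)) = (LINT x|N. (2 + Re (g x)) * indicator B (Y x))"
  proof (rule weighted_char_unique[OF pM pN, where C = 3])
    fix s
    have "(CLINT x|M. (2 + Re (f x)) * iexp (s * X x)) =
      (CLINT x|M. 2 * iexp (s * X x) + (1/2) * (f x * iexp (s * X x)) + (1/2) * (cnj (f x) * iexp (s * X x)))"
      by (rule Bochner_Integration.integral_cong) (auto simp: complex_eq_iff field_simps)
    also have "\<dots> = (CLINT x|N. 2 * iexp (s * Y x) + (1/2) * (g x * iexp (s * Y x)) + (1/2) * (cnj (g x) * iexp (s * Y x)))"
      unfolding linM linN eq0 eq eqc ..
    also have "\<dots> = (CLINT x|N. (2 + Re (g x)) * iexp (s * Y x))"
      by (rule Bochner_Integration.integral_cong) (auto simp: complex_eq_iff field_simps)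
    finally show "(CLINT x|M. (2 + Re (f x)) * iexp (s * X x)) = (CLINT x|N. (2 + Re (g x)) * iexp (s * Y x))" .
  qed (use bR f g in auto)
  have I: "(LINT x|M. (2 + Im (f x)) * indicator B (X x)) = (LINT x|N. (2 + Im (g x)) * indicator B (Y x))"
  proof (rule weighted_char_unique[OF pM pN, where C = 3])
    fix s
    have "(CLINT x|M. (2 + Im (f x)) * iexp (s * X x)) =
      (CLINT x|M. 2 * iexp (s * X x) + (-\<i>/2) * (f x * iexp (s * X x)) + (\<i>/2) * (cnj (f x) * iexp (s * X x)))"
      by (rule Bochner_Integration.integral_cong) (auto simp: complex_eq_iff field_simps)
    also have "\<dots> = (CLINT x|N. 2 * iexp (s * Y x) + (-\<i>/2) * (g x * iexp (s * Y x)) + (\<i>/2) * (cnj (g x) * iexp (s * Y x)))"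
      unfolding linM linN eq0 eq eqc ..
    also have "\<dots> = (CLINT x|N. (2 + Im (g x)) * iexp (s * Y x))"
      by (rule Bochner_Integration.integral_cong) (auto simp: complex_eq_iff field_simps)
    finally show "(CLINT x|M. (2 + Im (f x)) * iexp (s * X x)) = (CLINT x|N. (2 + Im (g x)) * iexp (s * Y x))" .
  qed (use bR f g in auto)
  have O: "(LINT x|M. 1 * indicator B (X x)) = (LINT x|N. 1 * indicator B (Y x) :: real)"
    by (rule weighted_char_unique[OF pM pN, where C = 1]) (use eq0 in simp_all)
  have bdd: "integrable M (\<lambda>x. h x * indicator B (X x) :: real)"
    if "h \<in> borel_measurable M" "\<And>x. \<bar>h x\<bar> \<le> 1" for h
    by (rule M.integrable_const_bound[of _ 1]) (use that in \<open>auto simp: indicator_def\<close>)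
  have bdd': "integrable N (\<lambda>x. h x * indicator B (Y x) :: real)"
    if "h \<in> borel_measurable N" "\<And>x. \<bar>h x\<bar> \<le> 1" for h
    by (rule N.integrable_const_bound[of _ 1]) (use that in \<open>auto simp: indicator_def\<close>)
  have ab: "\<bar>Re (f x)\<bar> \<le> 1" "\<bar>Im (f x)\<bar> \<le> 1" for x
    using order_trans[OF abs_Re_le_cmod f] order_trans[OF abs_Im_le_cmod f] by auto
  have ab': "\<bar>Re (g x)\<bar> \<le> 1" "\<bar>Im (g x)\<bar> \<le> 1" for x
    using order_trans[OF abs_Re_le_cmod g] order_trans[OF abs_Im_le_cmod g] by auto
  have R': "(LINT x|M. Re (f x) * indicator B (X x)) = (LINT x|N. Re (g x) * indicator B (Y x))"
    using R O bdd[of "\<lambda>_. 1"] bdd'[of "\<lambda>_. 1"] bdd[of "\<lambda>x. Re (f x)"] bdd'[of "\<lambda>x. Re (g x)"] ab ab'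
    by (simp add: distrib_right)
  have I': "(LINT x|M. Im (f x) * indicator B (X x)) = (LINT x|N. Im (g x) * indicator B (Y x))"
    using I O bdd[of "\<lambda>_. 1"] bdd'[of "\<lambda>_. 1"] bdd[of "\<lambda>x. Im (f x)"] bdd'[of "\<lambda>x. Im (g x)"] ab ab'
    by (simp add: distrib_right)
  have J: "integrable M (\<lambda>x. f x * indicator B (X x))"
    by (rule M.integrable_const_bound[of _ 1]) (use f in \<open>auto simp: norm_mult indicator_def\<close>)
  have J': "integrable N (\<lambda>x. g x * indicator B (Y x))"
    by (rule N.integrable_const_bound[of _ 1]) (use g in \<open>auto simp: norm_mult indicator_def\<close>)
  have i: "Re (z * indicator B y) = Re z * indicator B y" "Im (z * indicator B y) = Im z * indicator B y" for z and y :: real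
    by (auto simp: indicator_def)
  show ?thesis
  proof (rule complex_eqI)
    show "Re (CLINT x|M. f x * indicator B (X x)) = Re (CLINT x|N. g x * indicator B (Y x))"
      unfolding integral_Re[OF J, symmetric] integral_Re[OF J', symmetric] i by (rule R')
    show "Im (CLINT x|M. f x * indicator B (X x)) = Im (CLINT x|N. g x * indicator B (Y x))"
      unfolding integral_Im[OF J, symmetric] integral_Im[OF J', symmetric] i by (rule I')
  qed
qed

text \<open>
  Uniqueness in many dimensions follows from the one on the line by treating the coordinates one at
  a time. In \<open>E (\<Prod>a\<in>A. indicator (B a) (x a)) * exp (\<i> * (\<Sum>j\<in>J. t j * x j))\<close> a
  further exponential factor in the coordinate \<open>a\<close> is exchanged for an indicator by the previous
  lemma, where all other factors together serve as the complex weight. At the end only indicators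
  are left, that is, the measures of boxes.
\<close>

lemma char_unique_PiM:
  fixes M N :: "('i \<Rightarrow> real) measure"
  assumes pM: "prob_space M" and pN: "prob_space N"
    and sM[measurable_cong]: "sets M = sets (PiM I (\<lambda>_. borel))" and sN[measurable_cong]: "sets N = sets (PiM I (\<lambda>_. borel))"
    and eq: "\<And>J t. finite J \<Longrightarrow> J \<subseteq> I \<Longrightarrow>
      (CLINT x|M. iexp (\<Sum>j\<in>J. t j * x j)) = (CLINT x|N. iexp (\<Sum>j\<in>J. t j * x j))"
  shows "M = N"
proof (rule measure_eqI_PiM_infinite[OF sM sN])
  interpret M: prob_space M by fact
  interpret N: prob_space N by fact
  show "finite_measure M" by (rule M.finite_measure_axioms)
  have coord[measurable]: "(\<lambda>x. x j) \<in> borel_measurable M" "(\<lambda>x. x j) \<in> borel_measurable N" if "j \<in> I" for j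
    using that by measurable
  have box: "(CLINT x|M. (\<Prod>a\<in>A. indicator (B a) (x a)) * iexp (\<Sum>j\<in>J. t j * x j)) =
       (CLINT x|N. (\<Prod>a\<in>A. indicator (B a) (x a)) * iexp (\<Sum>j\<in>J. t j * x j))"
    if "finite A" "A \<subseteq> I" "finite J" "J \<subseteq> I" "\<And>a. a \<in> A \<Longrightarrow> B a \<in> sets borel" for A J B and t :: "'i \<Rightarrow> real"
    using that
  proof (induction A arbitrary: J t)
    case empty
    then show ?case using eq[of J t] by simp
  next
    case (insert a A)
    define f :: "('i \<Rightarrow> real) \<Rightarrow> complex" where "f x = (\<Prod>a\<in>A. indicator (B a) (x a)) * iexp (\<Sum>j\<in>J. t j * x j)" for x
    have [measurable]: "a \<in> I" "B a \<in> sets borel" using insert by auto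
    have fM[measurable]: "f \<in> borel_measurable M" "f \<in> borel_measurable N"
      unfolding f_def using insert.prems by (auto intro!: borel_measurable_times borel_measurable_prod
        measurable_compose[OF coord(1) borel_measurable_indicator] measurable_compose[OF coord(2) borel_measurable_indicator]
         borel_measurable_sum measurable_compose[OF _ borel_measurable_exp])
    have "cmod (\<Prod>a\<in>A. indicator (B a) (x a)) \<le> 1" for x :: "'i \<Rightarrow> real"
      unfolding prod_norm[symmetric] by (intro prod_le_1) (auto simp: indicator_def)
    then have f1: "cmod (f x) \<le> 1" for x by (simp add: f_def norm_mult)
    have "(CLINT x|M. f x * indicator (B a) (x a)) = (CLINT x|N. f x * indicator (B a) (x a))"
    proof (rule complex_weighted_char_unique[OF pM pN])
      fix s
      show "(CLINT x|M. iexp (s * x a)) = (CLINT x|N. iexp (s * x a))"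
        using eq[of "{a}" "\<lambda>_. s"] insert.prems by simp
      \<comment> \<open>The frequency \<open>s\<close> in the coordinate \<open>a\<close> is added to the one that \<open>t\<close> may already have there.\<close>
      define t' where "t' j = (if j \<in> J then t j else 0) + (if j = a then s else 0)" for j
      have "(\<Sum>j\<in>insert a J. t' j * x j) = (\<Sum>j\<in>J. t j * x j) + s * x a" for x :: "'i \<Rightarrow> real"
      proof -
        have "(\<Sum>j\<in>insert a J. t' j * x j) = (\<Sum>j\<in>insert a J. (if j \<in> J then t j * x j else 0)) + (\<Sum>j\<in>insert a J. (if j = a then s * x j else 0))"
          unfolding sum.distrib[symmetric] by (rule sum.cong) (auto simp: t'_def distrib_right)
        also have "(\<Sum>j\<in>insert a J. (if j \<in> J then t j * x j else 0)) = (\<Sum>j\<in>J. t j * x j)"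
          using insert.prems(2) by (intro sum.mono_neutral_cong_right) auto
        also have "(\<Sum>j\<in>insert a J. (if j = a then s * x j else 0)) = s * x a"
          using insert.prems(2) by (subst sum.delta) auto
        finally show ?thesis .
      qed
      then have *: "f x * iexp (s * x a) = (\<Prod>a\<in>A. indicator (B a) (x a)) * iexp (\<Sum>j\<in>insert a J. t' j * x j)" for x
        by (simp add: f_def exp_add distrib_left)
      show "(CLINT x|M. f x * iexp (s * x a)) = (CLINT x|N. f x * iexp (s * x a))"
        unfolding * using insert.prems by (intro insert.IH) auto
    qed (use f1 in auto)
    then show ?case
      using insert.hyps by (simp add: f_def mult_ac)
  qed
  fix A :: "'i \<Rightarrow> real set" and J assume J: "finite J" "J \<subseteq> I" and A: "\<And>i. i \<in> J \<Longrightarrow> A i \<in> sets borel"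
  let ?E = "prod_emb I (\<lambda>_. borel) J (Pi\<^sub>E J A)"
  have E: "?E \<in> sets (PiM I (\<lambda>_. borel))" using J A by (intro sets_PiM_I) auto
  have "(\<Prod>a\<in>J. indicator (A a) (x a)) = (indicator ?E x :: complex)" if "x \<in> space (PiM I (\<lambda>_. borel))" for x
  proof -
    have "x \<in> ?E \<longleftrightarrow> (\<forall>a\<in>J. x a \<in> A a)"
      using that J by (auto simp: prod_emb_def space_PiM PiE_iff extensional_def)
    moreover have "(\<Prod>a\<in>J. indicator (A a) (x a)) = (if \<forall>a\<in>J. x a \<in> A a then 1 else 0 :: complex)"
      using J by (auto simp: indicator_def)
    ultimately show ?thesis by (simp add: indicator_def)
  qed
  note ind = this
  have "(CLINT x|M. indicator ?E x) = (CLINT x|M. (\<Prod>a\<in>J. indicator (A a) (x a)) * iexp (\<Sum>j\<in>{}. 0 * x j))"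
    by (rule Bochner_Integration.integral_cong) (auto simp: ind sets_eq_imp_space_eq[OF sM])
  also have "\<dots> = (CLINT x|N. (\<Prod>a\<in>J. indicator (A a) (x a)) * iexp (\<Sum>j\<in>{}. 0 * x j))"
    using J A by (intro box) auto
  also have "\<dots> = (CLINT x|N. indicator ?E x)"
    by (rule Bochner_Integration.integral_cong) (auto simp: ind sets_eq_imp_space_eq[OF sN])
  finally have "complex_of_real (LINT x|M. indicator ?E x) = complex_of_real (LINT x|N. indicator ?E x)"
    unfolding integral_complex_of_real[symmetric] of_real_indicator .
  then have "measure M ?E = measure N ?E"
    unfolding of_real_eq_iff using E sM sN by simp
  then show "emeasure M ?E = emeasure N ?E"
    by (simp add: M.emeasure_eq_measure N.emeasure_eq_measure)
qed

section \<open>Gaussian processes with a given covariance\<close>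


definition pos_semidef :: "('i \<Rightarrow> 'i \<Rightarrow> real) \<Rightarrow> bool" where
  "pos_semidef K \<longleftrightarrow> (\<forall>i j. K i j = K j i) \<and>
     (\<forall>J t. finite J \<longrightarrow> 0 \<le> (\<Sum>i\<in>J. \<Sum>j\<in>J. t i * t j * K i j))"

lemma pos_semidef_sym: "pos_semidef K \<Longrightarrow> K i j = K j i"
  by (auto simp: pos_semidef_def)

lemma pos_semidef_sum_nonneg:
  "pos_semidef K \<Longrightarrow> finite J \<Longrightarrow> 0 \<le> (\<Sum>i\<in>J. \<Sum>j\<in>J. t i * t j * K i j)"
  by (auto simp: pos_semidef_def)

text \<open>
  The quadratic form at the vector \<open>t\<close> perturbed by \<open>s\<close> in the coordinate \<open>a\<close>, which may
  or may not belong to \<open>J\<close>. Suitable choices of \<open>s\<close> give the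
  consequences of positivity that follow.
\<close>

lemma pos_semidef_add_point:
  fixes K :: "'i \<Rightarrow> 'i \<Rightarrow> real"
  assumes K: "pos_semidef K" and J: "finite J"
  shows "0 \<le> (\<Sum>i\<in>J. \<Sum>j\<in>J. t i * t j * K i j) + 2 * s * (\<Sum>i\<in>J. t i * K i a) + s\<^sup>2 * K a a"
proof -
  define T where "T i = (if i \<in> J then t i else 0)" for i
  define S where "S i = (if i = a then s else 0)" for i
  let ?A = "insert a J"
  have fin: "finite ?A" using J by simp
  have T: "(\<Sum>i\<in>?A. T i * f i) = (\<Sum>i\<in>J. t i * f i)" for f
    unfolding T_def using J by (intro sum.mono_neutral_cong_right) auto
  have S: "(\<Sum>i\<in>?A. S i * f i) = s * f a" for f
  proof -
    have "(\<Sum>i\<in>?A. S i * f i) = (\<Sum>i\<in>?A. if i = a then s * f i else 0)"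
      by (rule sum.cong) (auto simp: S_def)
    also have "\<dots> = s * f a" using fin by (subst sum.delta) auto
    finally show ?thesis .
  qed
  have "0 \<le> (\<Sum>i\<in>?A. \<Sum>j\<in>?A. (T i + S i) * (T j + S j) * K i j)"
    by (rule pos_semidef_sum_nonneg[OF K fin])
  also have "\<dots> = (\<Sum>i\<in>?A. (T i + S i) * (\<Sum>j\<in>?A. (T j + S j) * K i j))"
    by (simp add: sum_distrib_left mult_ac)
  also have "\<dots> = (\<Sum>i\<in>?A. (T i + S i) * ((\<Sum>j\<in>J. t j * K i j) + s * K i a))"
    by (simp only: distrib_right sum.distrib T S)
  also have "\<dots> = (\<Sum>i\<in>J. t i * ((\<Sum>j\<in>J. t j * K i j) + s * K i a)) + s * ((\<Sum>j\<in>J. t j * K a j) + s * K a a)"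
    by (simp only: distrib_right sum.distrib T S)
  also have "(\<Sum>j\<in>J. t j * K a j) = (\<Sum>j\<in>J. t j * K j a)"
    by (simp only: pos_semidef_sym[OF K, of a])
  finally show ?thesis
    by (simp add: distrib_left sum.distrib sum_distrib_left mult_ac power2_eq_square)
qed

lemma pos_semidef_diag_nonneg: "pos_semidef K \<Longrightarrow> 0 \<le> K a a"
  using pos_semidef_add_point[of K "{}" _ 1 a] by simp

lemma pos_semidef_diag_zero:
  assumes K: "pos_semidef K" and a: "K a a = 0"
  shows "K i a = 0"
proof (rule ccontr)
  \<comment> \<open>With \<open>K a a = 0\<close> the form is affine in \<open>s\<close>; the chosen \<open>s\<close> gives it the value \<open>- 1\<close>.\<close>
  assume "K i a \<noteq> 0"
  then show False
    using pos_semidef_add_point[OF K, of "{i}" "\<lambda>_. 1" "- (K i i + 1) / (2 * K i a)" a] a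
    by (simp add: field_simps)
qed

text \<open>
  For \<open>K a a \<noteq> 0\<close> the minimum over \<open>s\<close> of the form in \<open>pos_semidef_add_point\<close> is
  attained at \<open>- L / K a a\<close>, where \<open>L = (\<Sum>i\<in>J. t i * K i a)\<close>, and is the form of the Schur complement. If
  \<open>K a a = 0\<close>, division by zero makes the correction term vanish and leaves \<open>K\<close> unchanged.
\<close>

lemma pos_semidef_schur_complement:
  fixes K :: "'i \<Rightarrow> 'i \<Rightarrow> real"
  assumes K: "pos_semidef K"
  shows "pos_semidef (\<lambda>i j. K i j - K i a * K j a / K a a)"
  unfolding pos_semidef_def
proof safe
  show "K i j - K i a * K j a / K a a = K j i - K j a * K i a / K a a" for i j
    using pos_semidef_sym[OF K, of i j] by (simp add: mult_ac)
  fix J :: "'i set" and t :: "'i \<Rightarrow> real" assume J: "finite J"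
  define L where "L = (\<Sum>i\<in>J. t i * K i a)"
  have LL: "(\<Sum>i\<in>J. \<Sum>j\<in>J. t i * t j * (K i a * K j a / K a a)) = L\<^sup>2 / K a a"
    unfolding L_def power2_eq_square sum_product sum_divide_distrib by (simp add: mult_ac)
  have "0 \<le> (\<Sum>i\<in>J. \<Sum>j\<in>J. t i * t j * K i j) + 2 * (- L / K a a) * L + (- L / K a a)\<^sup>2 * K a a"
    unfolding L_def by (rule pos_semidef_add_point[OF K J])
  also have "\<dots> = (\<Sum>i\<in>J. \<Sum>j\<in>J. t i * t j * K i j) - L\<^sup>2 / K a a"
    by (cases "K a a = 0") (auto simp: field_simps power2_eq_square)
  also have "\<dots> = (\<Sum>i\<in>J. \<Sum>j\<in>J. t i * t j * (K i j - K i a * K j a / K a a))"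
    unfolding LL[symmetric] by (simp add: right_diff_distrib sum_subtractf)
  finally show "0 \<le> (\<Sum>i\<in>J. \<Sum>j\<in>J. t i * t j * (K i j - K i a * K j a / K a a))" .
qed

text \<open>
  Cholesky's decomposition, one coordinate at a time. Write \<open>K = K' + u u\<^sup>T\<close> with the Schur
  complement \<open>K'\<close> at \<open>a\<close>. Since \<open>K'\<close> vanishes in the row and column of \<open>a\<close>, it lives
  on the smaller index set; a Gaussian vector with covariance \<open>K'\<close>, put to \<open>0\<close> at \<open>a\<close>,
  plus \<open>u\<close> times an independent standard normal variable has covariance \<open>K\<close>.
\<close>

lemma finite_gaussian_exists:
  fixes K :: "'i \<Rightarrow> 'i \<Rightarrow> real"
  assumes "finite J" "pos_semidef K"
  shows "\<exists>P. prob_space P \<and> sets P = sets (PiM J (\<lambda>_. borel :: real measure)) \<and>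
    (\<forall>t. (CLINT x|P. iexp (\<Sum>j\<in>J. t j * x j)) =
      of_real (exp (- (\<Sum>i\<in>J. \<Sum>j\<in>J. t i * t j * K i j) / 2)))"
  using assms
proof (induction J arbitrary: K)
  case empty
  have "prob_space (PiM ({} :: 'i set) (\<lambda>_. borel :: real measure))"
    by (intro prob_spaceI) (simp add: PiM_empty)
  then show ?case
    by (intro exI[of _ "PiM {} (\<lambda>_. borel)"]) (simp add: prob_space.prob_space del: space_PiM_empty)
next
  case (insert a J)
  define K' where "K' i j = K i j - K i a * K j a / K a a" for i j
  define u where "u i = K i a / sqrt (K a a)" for i
  have K: "pos_semidef K" by (rule insert.prems)
  have sq: "sqrt (K a a) * sqrt (K a a) = K a a" using pos_semidef_diag_nonneg[OF K, of a] by simp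
  have uu: "u i * u j = K i a * K j a / K a a" for i j
    using sq by (simp add: u_def)
  have K'_a: "K' i a = 0" "K' a i = 0" for i
    using pos_semidef_diag_zero[OF K, of a] pos_semidef_sym[OF K, of a i]
    by (auto simp: K'_def)
  obtain P where P: "prob_space P" and sP[measurable_cong]: "sets P = sets (PiM J (\<lambda>_. borel :: real measure))"
    and cP: "\<And>t. (CLINT x|P. iexp (\<Sum>j\<in>J. t j * x j)) = of_real (exp (- (\<Sum>i\<in>J. \<Sum>j\<in>J. t i * t j * K' i j) / 2))"
    using insert.IH[OF pos_semidef_schur_complement[OF K, of a]] unfolding K'_def by blast
  let ?N = "std_normal_distribution"
  interpret N: real_distribution ?N by (rule real_dist_normal_dist)
  interpret P: prob_space P by (rule P)
  interpret PN: pair_prob_space P ?N ..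
  define \<Phi> where "\<Phi> = (\<lambda>(x, z). \<lambda>i\<in>insert a J. (if i = a then 0 else x i) + u i * z :: real)"
  have \<Phi>[measurable]: "\<Phi> \<in> measurable (P \<Otimes>\<^sub>M ?N) (PiM (insert a J) (\<lambda>_. borel))"
    unfolding \<Phi>_def case_prod_beta
  proof (rule measurable_restrict)
    fix i assume "i \<in> insert a J"
    then consider "i = a" | "i \<noteq> a" "i \<in> J" by auto
    then show "(\<lambda>x. (if i = a then 0 else fst x i) + u i * snd x) \<in> borel_measurable (P \<Otimes>\<^sub>M ?N)"
      by cases (auto intro!: borel_measurable_add measurable_compose[OF measurable_fst measurable_component_singleton[of i]]
        simp: measurable_cong_sets[OF sP refl])
  qed
  show ?case
  proof (intro exI conjI allI)
    show "prob_space (distr (P \<Otimes>\<^sub>M ?N) (PiM (insert a J) (\<lambda>_. borel)) \<Phi>)"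
      by (rule PN.prob_space_distr) measurable
    fix t
    define U where "U = (\<Sum>i\<in>insert a J. t i * u i)"
    have lin: "(\<Sum>j\<in>insert a J. t j * \<Phi> (x, z) j) = (\<Sum>j\<in>J. t j * x j) + U * z" for x z
    proof -
      have "(\<Sum>j\<in>insert a J. t j * \<Phi> (x, z) j) = (\<Sum>j\<in>insert a J. t j * (if j = a then 0 else x j)) + U * z"
        by (simp add: \<Phi>_def U_def distrib_left sum.distrib sum_distrib_left mult_ac del: sum.insert)
      also have "(\<Sum>j\<in>insert a J. t j * (if j = a then 0 else x j)) = (\<Sum>j\<in>J. t j * x j)"
        using insert.hyps by (intro sum.mono_neutral_cong_right) auto
      finally show ?thesis .
    qed
    have quad: "(\<Sum>i\<in>insert a J. \<Sum>j\<in>insert a J. t i * t j * K i j) = (\<Sum>i\<in>J. \<Sum>j\<in>J. t i * t j * K' i j) + U\<^sup>2"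
    proof -
      have "U\<^sup>2 = (\<Sum>i\<in>insert a J. \<Sum>j\<in>insert a J. t i * t j * (u i * u j))"
        unfolding U_def power2_eq_square sum_product by (simp add: mult_ac del: sum.insert)
      moreover have "(\<Sum>i\<in>J. \<Sum>j\<in>J. t i * t j * K' i j) = (\<Sum>i\<in>insert a J. \<Sum>j\<in>insert a J. t i * t j * K' i j)"
        using insert.hyps by (simp add: K'_a)
      ultimately show ?thesis
        unfolding uu K'_def by (simp add: right_diff_distrib sum_subtractf del: sum.insert)
    qed
    have m[measurable]: "(\<lambda>x. \<Sum>j\<in>J. t j * x j) \<in> borel_measurable P"
      by measurable
    have cN: "(CLINT z|?N. iexp (U * z)) = of_real (exp (- U\<^sup>2 / 2))"
      using char_std_normal_distribution unfolding char_def by metis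
    have int: "integrable (P \<Otimes>\<^sub>M ?N) (\<lambda>(x, z). iexp ((\<Sum>j\<in>J. t j * x j) + U * z))"
      by (rule PN.integrable_const_bound[of _ 1]) auto
    have "(CLINT x|distr (P \<Otimes>\<^sub>M ?N) (PiM (insert a J) (\<lambda>_. borel)) \<Phi>. iexp (\<Sum>j\<in>insert a J. t j * x j)) =
      (CLINT y|P \<Otimes>\<^sub>M ?N. iexp (\<Sum>j\<in>insert a J. t j * \<Phi> y j))"
      by (rule integral_distr) measurable
    also have "\<dots> = (CLINT y|P \<Otimes>\<^sub>M ?N. (case y of (x, z) \<Rightarrow> iexp ((\<Sum>j\<in>J. t j * x j) + U * z)))"
      by (rule Bochner_Integration.integral_cong) (auto simp only: lin split: prod.split)
    also have "\<dots> = (CLINT x|P. CLINT z|?N. iexp ((\<Sum>j\<in>J. t j * x j) + U * z))"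
      using PN.integral_fst'[OF int] by simp
    also have "\<dots> = (CLINT x|P. iexp (\<Sum>j\<in>J. t j * x j)) * of_real (exp (- U\<^sup>2 / 2))"
      using cN by (simp add: distrib_left exp_add)
    also have "\<dots> = of_real (exp (- (\<Sum>i\<in>J. \<Sum>j\<in>J. t i * t j * K' i j) / 2) * exp (- U\<^sup>2 / 2))"
      unfolding cP by simp
    also have "exp (- (\<Sum>i\<in>J. \<Sum>j\<in>J. t i * t j * K' i j) / 2) * exp (- U\<^sup>2 / 2) =
      exp (- (\<Sum>i\<in>insert a J. \<Sum>j\<in>insert a J. t i * t j * K i j) / 2)"
      unfolding quad exp_add[symmetric] by (simp add: field_simps)
    finally show "(CLINT x|distr (P \<Otimes>\<^sub>M ?N) (PiM (insert a J) (\<lambda>_. borel)) \<Phi>. iexp (\<Sum>j\<in>insert a J. t j * x j)) =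
      of_real (exp (- (\<Sum>i\<in>insert a J. \<Sum>j\<in>insert a J. t i * t j * K i j) / 2))" .
  qed simp
qed

lemma sum_extend_zero:
  fixes f :: "'i \<Rightarrow> real"
  assumes "finite H" "L \<subseteq> H"
  shows "(\<Sum>j\<in>H. (if j \<in> L then t j else 0) * f j) = (\<Sum>j\<in>L. t j * f j)"
  using assms by (intro sum.mono_neutral_cong_right) auto

text \<open>
  Kolmogorov's extension theorem. The finite-dimensional Gaussian laws are consistent because a
  marginal has the characteristic function of the Gaussian law on the smaller index set, and
  characteristic functions determine laws.
\<close>

theorem gaussian_process_exists:
  fixes K :: "'i \<Rightarrow> 'i \<Rightarrow> real"
  assumes K: "pos_semidef K"
  obtains P where "prob_space P" "sets P = sets (PiM UNIV (\<lambda>_. borel :: real measure))"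
    "\<And>J t. finite J \<Longrightarrow> (CLINT x|P. iexp (\<Sum>j\<in>J. t j * x j)) =
      of_real (exp (- (\<Sum>i\<in>J. \<Sum>j\<in>J. t i * t j * K i j) / 2))"
proof -
  define Q where "Q J P \<longleftrightarrow> prob_space P \<and> sets P = sets (PiM J (\<lambda>_. borel :: real measure)) \<and>
    (\<forall>t. (CLINT x|P. iexp (\<Sum>j\<in>J. t j * x j)) =
      of_real (exp (- (\<Sum>i\<in>J. \<Sum>j\<in>J. t i * t j * K i j) / 2)))" for J :: "'i set" and P
  define P where "P J = (SOME P. Q J P)" for J
  have Q: "Q J (P J)" if "finite J" for J
    unfolding P_def by (rule someI_ex) (use finite_gaussian_exists[OF that K] in \<open>simp add: Q_def\<close>)
  have P: "prob_space (P J)"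
    and sP: "sets (P J) = sets (PiM J (\<lambda>_. borel :: real measure))"
    and cP: "(CLINT x|P J. iexp (\<Sum>j\<in>J. t j * x j)) =
      of_real (exp (- (\<Sum>i\<in>J. \<Sum>j\<in>J. t i * t j * K i j) / 2))" if "finite J" for J t
    using Q[OF that] by (auto simp: Q_def)
  have cP': "(CLINT x|P H. iexp (\<Sum>j\<in>L. t j * x j)) =
      of_real (exp (- (\<Sum>i\<in>L. \<Sum>j\<in>L. t i * t j * K i j) / 2))" if "finite H" "L \<subseteq> H" for H L t
  proof -
    let ?t = "\<lambda>j. if j \<in> L then t j else 0"
    have "(\<Sum>i\<in>H. \<Sum>j\<in>H. ?t i * ?t j * K i j) = (\<Sum>i\<in>H. ?t i * (\<Sum>j\<in>H. ?t j * K i j))"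
      by (simp add: sum_distrib_left mult_ac)
    also have "\<dots> = (\<Sum>i\<in>L. t i * (\<Sum>j\<in>L. t j * K i j))"
      unfolding sum_extend_zero[OF that] ..
    finally have "(\<Sum>i\<in>H. \<Sum>j\<in>H. ?t i * ?t j * K i j) = (\<Sum>i\<in>L. \<Sum>j\<in>L. t i * t j * K i j)"
      by (simp add: sum_distrib_left mult_ac)
    with cP[OF that(1), of ?t] show ?thesis
      unfolding sum_extend_zero[OF that] by simp
  qed
  interpret polish_projective UNIV P
  proof (intro polish_projective.intro projective_family.intro)
    fix J H :: "'i set" assume JH: "J \<subseteq> H" "finite H"
    then have J: "finite J" by (rule finite_subset)
    note [measurable_cong] = sP[OF JH(2)]
    have R[measurable]: "(\<lambda>f. restrict f J) \<in> measurable (P H) (PiM J (\<lambda>_. borel))"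
      using measurable_restrict_subset[OF JH(1), of "\<lambda>_. borel"] by (simp add: measurable_cong_sets[OF sP[OF JH(2)] refl])
    show "P J = distr (P H) (PiM J (\<lambda>_. borel)) (\<lambda>f. restrict f J)"
    proof (rule char_unique_PiM)
      show "prob_space (distr (P H) (PiM J (\<lambda>_. borel)) (\<lambda>f. restrict f J))"
        using P[OF JH(2)] by (rule prob_space.prob_space_distr) measurable
      fix L and t :: "'i \<Rightarrow> real" assume L: "finite L" "L \<subseteq> J"
      have [measurable]: "(\<lambda>x. \<Sum>j\<in>L. t j * x j) \<in> borel_measurable (PiM J (\<lambda>_. borel))"
        using L by (intro borel_measurable_sum borel_measurable_times measurable_component_singleton) auto
      have "(CLINT x|distr (P H) (PiM J (\<lambda>_. borel)) (\<lambda>f. restrict f J). iexp (\<Sum>j\<in>L. t j * x j)) =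
         (CLINT x|P H. iexp (\<Sum>j\<in>L. t j * restrict x J j))"
        by (intro integral_distr R) measurable
      also have "\<dots> = (CLINT x|P H. iexp (\<Sum>j\<in>L. t j * x j))"
        using L by (intro Bochner_Integration.integral_cong refl arg_cong[where f = iexp] sum.cong) auto
      also have "\<dots> = of_real (exp (- (\<Sum>i\<in>L. \<Sum>j\<in>L. t i * t j * K i j) / 2))"
        by (rule cP'[OF JH(2) order_trans[OF L(2) JH(1)]])
      also have "\<dots> = (CLINT x|P J. iexp (\<Sum>j\<in>L. t j * x j))"
        by (rule cP'[OF J L(2), symmetric])
      finally show "(CLINT x|P J. iexp (\<Sum>j\<in>L. t j * x j)) =
        (CLINT x|distr (P H) (PiM J (\<lambda>_. borel)) (\<lambda>f. restrict f J). iexp (\<Sum>j\<in>L. t j * x j))" ..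
    qed (simp_all only: P[OF J] sP[OF J] sets_distr)
  qed (rule P)
  have sl[measurable_cong]: "sets lim = sets (PiM UNIV (\<lambda>_. borel :: real measure))" by simp
  show ?thesis
  proof
    show "prob_space lim" by (rule P.prob_space_axioms)
    show "sets lim = sets (PiM UNIV (\<lambda>_. borel :: real measure))" by (rule sl)
    fix J :: "'i set" and t :: "'i \<Rightarrow> real" assume J: "finite J"
    have R[measurable]: "(\<lambda>f. restrict f J) \<in> measurable lim (PiM J (\<lambda>_. borel))"
      using measurable_restrict_subset[of J UNIV "\<lambda>_. borel"] by (simp add: measurable_cong_sets[OF sl refl])
    have "distr lim (PiM J (\<lambda>_. borel)) (\<lambda>f. restrict f J) = P J"
    proof (rule measure_eqI)
      fix A assume "A \<in> sets (distr lim (PiM J (\<lambda>_. borel)) (\<lambda>f. restrict f J))"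
      then have A: "A \<in> sets (PiM J (\<lambda>_. borel))" by simp
      show "emeasure (distr lim (PiM J (\<lambda>_. borel)) (\<lambda>f. restrict f J)) A = emeasure (P J) A"
        using emeasure_lim_emb[OF _ J A] A by (subst emeasure_distr) (auto simp: prod_emb_def space_PiM vimage_def Int_def)
    qed (simp add: sP[OF J])
    then have "of_real (exp (- (\<Sum>i\<in>J. \<Sum>j\<in>J. t i * t j * K i j) / 2)) =
      (CLINT x|distr lim (PiM J (\<lambda>_. borel)) (\<lambda>f. restrict f J). iexp (\<Sum>j\<in>J. t j * x j))"
      using cP[OF J] by simp
    also have "\<dots> = (CLINT x|lim. iexp (\<Sum>j\<in>J. t j * restrict x J j))"
      by (intro integral_distr R) measurable
    also have "\<dots> = (CLINT x|lim. iexp (\<Sum>j\<in>J. t j * x j))"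
      by (intro Bochner_Integration.integral_cong refl arg_cong[where f = iexp] sum.cong) auto
    finally show "(CLINT x|lim. iexp (\<Sum>j\<in>J. t j * x j)) = of_real (exp (- (\<Sum>i\<in>J. \<Sum>j\<in>J. t i * t j * K i j) / 2))" ..
  qed
qed

section \<open>A proper conditionally negative definite function\<close>


text \<open>
  Local compactness gives a cover by open sets lying in compact sets, and second countability makes it
  countable. The open sets \<open>U n\<close> witness that every point is interior to some \<open>C n\<close>.
\<close>

lemma compact_exhaustion:
  assumes lc: "locally_compact_space (euclidean :: 'g::second_countable_topology topology)"
  obtains C U :: "nat \<Rightarrow> 'g::second_countable_topology set"
  where "\<And>n. compact (C n)" "\<And>n. open (U n)" "\<And>n. U n \<subseteq> C n" "incseq C" "(\<Union>n. U n) = UNIV"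
proof -
  let ?F = "{V :: 'g set. open V \<and> (\<exists>K. compact K \<and> V \<subseteq> K)}"
  obtain F where F: "F \<subseteq> ?F" "countable F" "\<Union>F = \<Union>?F"
    by (rule Lindelof[of ?F]) auto
  have "\<Union>?F = UNIV"
    using lc by (fastforce simp: locally_compact_space_def)
  with F have FU: "\<Union>F = UNIV" by simp
  then have ne: "F \<noteq> {}" by auto
  define V where "V = from_nat_into F"
  have rV: "range V = F" unfolding V_def by (rule range_from_nat_into[OF ne F(2)])
  have "\<exists>K. compact K \<and> V n \<subseteq> K" for n using rV F(1) by blast
  then obtain K where K: "\<And>n. compact (K n)" "\<And>n. V n \<subseteq> K n" by metis
  show ?thesis
  proof
    show "compact (\<Union>i\<le>n. K i)" for n using K by auto
    show "open (V n)" for n using rV F(1) by blast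
    show "V n \<subseteq> (\<Union>i\<le>n. K i)" for n using K by auto
    show "incseq (\<lambda>n. \<Union>i\<le>n. K i)" by (auto simp: incseq_def intro: order_trans)
    show "(\<Union>n. V n) = UNIV" using rV FU by simp
  qed
qed

text \<open>
  If \<open>\<psi> (- h + g)\<close> is a squared distance between points attached to \<open>g\<close> and \<open>h\<close>, this is
  their inner product with the point of \<open>0\<close> taken as origin. A function is called conditionally
  negative definite here if this kernel is positive semidefinite.
\<close>

definition schoenberg_kernel :: "('g::group_add \<Rightarrow> real) \<Rightarrow> 'g \<Rightarrow> 'g \<Rightarrow> real" where
  "schoenberg_kernel \<psi> g h = (\<psi> g + \<psi> h - \<psi> (- h + g)) / 2"

lemma positive_definiteD:
  "positive_definite \<phi> \<Longrightarrow> (\<Sum>i<n. \<Sum>j<n. c i * cnj (c j) * \<phi> (- g j + g i)) \<in> \<real>\<^sub>\<ge>\<^sub>0"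
  for n :: nat
  by (simp add: positive_definite_def)

lemma positive_definite_Re_uminus:
  assumes "positive_definite \<phi>"
  shows "Re (\<phi> (- g)) = Re (\<phi> g)"
proof -
  define G where "G i = (if i = (0::nat) then 0 else g)" for i
  \<comment> \<open>For the points \<open>0\<close>, \<open>g\<close> and the coefficients \<open>1\<close>, \<open>\<i>\<close> the sum is real only if the real parts agree.\<close>
  define c where "c i = (if i = (0::nat) then 1 else \<i>)" for i
  have "(\<Sum>i<2. \<Sum>j<2. d i * cnj (d j) * \<phi> (- G j + G i)) \<in> \<real>\<^sub>\<ge>\<^sub>0" for d
    by (rule positive_definiteD[OF assms])
  from this[of c] this[of "\<lambda>i. if i = 0 then 1 else 0"] show ?thesis
    by (simp add: eval_nat_numeral complex_nonneg_Reals_iff G_def c_def)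
qed

lemma positive_definite_imp_pos_semidef:
  assumes \<phi>: "positive_definite \<phi>"
  shows "pos_semidef (\<lambda>g h. Re (\<phi> (- h + g)))"
  unfolding pos_semidef_def
proof safe
  fix g h :: 'a
  have "- (- h + g) = - g + h" by (simp add: minus_add)
  then show "Re (\<phi> (- h + g)) = Re (\<phi> (- g + h))"
    using positive_definite_Re_uminus[OF \<phi>, of "- h + g"] by simp
next
  fix J :: "'a set" and t :: "'a \<Rightarrow> real" assume "finite J"
  then obtain e where e: "bij_betw e {..<card J} J"
    using ex_bij_betw_nat_finite[of J] by (auto simp: atLeast0LessThan)
  have "(\<Sum>i<card J. \<Sum>j<card J. of_real (t (e i)) * cnj (of_real (t (e j))) * \<phi> (- e j + e i)) \<in> \<real>\<^sub>\<ge>\<^sub>0"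
    by (rule positive_definiteD[OF \<phi>])
  then have "0 \<le> (\<Sum>i<card J. \<Sum>j<card J. t (e i) * t (e j) * Re (\<phi> (- e j + e i)))"
    by (simp add: complex_nonneg_Reals_iff)
  also have "\<dots> = (\<Sum>i\<in>J. \<Sum>j\<in>J. t i * t j * Re (\<phi> (- j + i)))"
    by (simp add: sum.reindex_bij_betw[OF e, symmetric])
  finally show "0 \<le> (\<Sum>i\<in>J. \<Sum>j\<in>J. t i * t j * Re (\<phi> (- j + i)))" .
qed

lemma positive_definite_Re_le_1:
  assumes \<phi>: "positive_definite \<phi>" "\<phi> 0 = 1"
  shows "Re (\<phi> g) \<le> 1"
  using pos_semidef_add_point[OF positive_definite_imp_pos_semidef[OF \<phi>(1)], of "{g}" "\<lambda>_. 1" "- 1" 0] \<phi>(2)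
  by simp

text \<open>
  The form of the kernel at \<open>t\<close> is half the form of \<open>Re (\<phi> (- h + g))\<close> at \<open>t\<close> balanced by
  the weight \<open>- (\<Sum>i\<in>J. t i)\<close> at the point \<open>0\<close>.
\<close>

lemma pos_semidef_schoenberg_kernel:
  assumes \<phi>: "positive_definite \<phi>" "\<phi> 0 = 1"
  shows "pos_semidef (schoenberg_kernel (\<lambda>g. 1 - Re (\<phi> g)))"
  unfolding pos_semidef_def
proof safe
  note K = positive_definite_imp_pos_semidef[OF \<phi>(1)]
  show "schoenberg_kernel (\<lambda>g. 1 - Re (\<phi> g)) i j = schoenberg_kernel (\<lambda>g. 1 - Re (\<phi> g)) j i" for i j
    using pos_semidef_sym[OF K, of i j] by (simp add: schoenberg_kernel_def)
  fix J :: "'a set" and t :: "'a \<Rightarrow> real" assume J: "finite J"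
  define S where "S = (\<Sum>i\<in>J. t i)"
  define R where "R = (\<Sum>i\<in>J. t i * Re (\<phi> i))"
  have "(\<Sum>i\<in>J. \<Sum>j\<in>J. t i * t j * schoenberg_kernel (\<lambda>g. 1 - Re (\<phi> g)) i j) =
    (\<Sum>i\<in>J. \<Sum>j\<in>J. (t i * t j - t i * Re (\<phi> i) * t j - t i * (t j * Re (\<phi> j)) + t i * t j * Re (\<phi> (- j + i))) / 2)"
    by (intro sum.cong refl) (simp add: schoenberg_kernel_def field_simps)
  also have "\<dots> = (S * S - R * S - S * R + (\<Sum>i\<in>J. \<Sum>j\<in>J. t i * t j * Re (\<phi> (- j + i)))) / 2"
    unfolding sum_divide_distrib[symmetric] sum.distrib sum_subtractf S_def R_def sum_product ..
  also have "\<dots> \<ge> 0"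
    using pos_semidef_add_point[OF K J, of t "- S" 0] \<phi>(2)
    by (simp add: S_def[symmetric] R_def[symmetric] power2_eq_square algebra_simps)
  finally show "0 \<le> (\<Sum>i\<in>J. \<Sum>j\<in>J. t i * t j * schoenberg_kernel (\<lambda>g. 1 - Re (\<phi> g)) i j)" .
qed

lemma pos_semidef_suminf:
  assumes K: "\<And>n::nat. pos_semidef (K n)" and S: "\<And>i j. (\<lambda>n. K n i j) sums L i j"
  shows "pos_semidef L"
  unfolding pos_semidef_def
proof safe
  show "L i j = L j i" for i j
    using sums_unique2[OF S[of i j], of "L j i"] S[of j i] pos_semidef_sym[OF K, of _ i j] by simp
  fix J :: "'a set" and t :: "'a \<Rightarrow> real" assume J: "finite J"
  have "(\<lambda>n. \<Sum>i\<in>J. \<Sum>j\<in>J. t i * t j * K n i j) sums (\<Sum>i\<in>J. \<Sum>j\<in>J. t i * t j * L i j)"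
    by (intro sums_sum sums_mult S)
  then show "0 \<le> (\<Sum>i\<in>J. \<Sum>j\<in>J. t i * t j * L i j)"
    by (rule sums_le[rotated, OF sums_zero]) (intro pos_semidef_sum_nonneg K J)
qed

text \<open>
  Choose \<open>k n\<close> such that \<open>\<phi> (k n)\<close> is within \<open>(1/2) ^ n\<close> of \<open>1\<close> on the \<open>n\<close>-th compact set
  of an exhaustion and sum the functions \<open>1 - Re (\<phi> (k n))\<close>. The series converges uniformly on
  each compact set of the exhaustion, so continuity survives. All terms are nonnegative, and the
  first \<open>N\<close> of them are at least \<open>1/2\<close> outside a compact set, so the sum tends to infinity.
\<close>

theorem proper_conditionally_negative_function:
  assumes lc: "locally_compact_space
      (euclidean :: 'g::{topological_group_add, t2_space, second_countable_topology} topology)"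
    and H: "haagerup_property TYPE('g::{topological_group_add, t2_space, second_countable_topology})"
  obtains \<psi> :: "'g::{topological_group_add, t2_space, second_countable_topology} \<Rightarrow> real" where "pos_semidef (schoenberg_kernel \<psi>)" "\<psi> 0 = 0"
    "continuous_on UNIV \<psi>" "filterlim \<psi> at_top cocompact"
proof -
  obtain \<phi> :: "nat \<Rightarrow> 'g \<Rightarrow> complex" where \<phi>: "\<And>n. \<phi> n 0 = 1" "\<And>n. positive_definite (\<phi> n)"
    and C0: "\<And>n. C0_function (\<phi> n)"
    and lim: "\<And>K. compact K \<Longrightarrow> uniform_limit K \<phi> (\<lambda>_. 1) sequentially"
    using H unfolding haagerup_property_def by blast
  obtain C U :: "nat \<Rightarrow> 'g set" where C: "\<And>n. compact (C n)" "\<And>n. open (U n)" "\<And>n. U n \<subseteq> C n" "incseq C" "(\<Union>n. U n) = UNIV"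
    using compact_exhaustion[OF lc] by blast
  have "\<exists>k. \<forall>g\<in>C n. dist (\<phi> k g) 1 < (1/2) ^ n" for n
    using uniform_limitD[OF lim[OF C(1)[of n]], of "(1/2) ^ n"] by (auto simp: eventually_sequentially)
  then obtain k where k: "\<And>n g. g \<in> C n \<Longrightarrow> dist (\<phi> (k n) g) 1 < (1/2) ^ n" by metis
  define f where "f n g = 1 - Re (\<phi> (k n) g)" for n g
  have f0: "0 \<le> f n g" for n g
    using positive_definite_Re_le_1[OF \<phi>(2) \<phi>(1)] by (simp add: f_def)
  have f_le: "norm (f n g) \<le> (1/2) ^ n" if "g \<in> C m" "m \<le> n" for n m g
  proof -
    have "g \<in> C n" using that C(4) by (auto simp: incseq_def)
    have "norm (f n g) = \<bar>Re (\<phi> (k n) g - 1)\<bar>" by (simp add: f_def abs_minus_commute)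
    also have "\<dots> \<le> dist (\<phi> (k n) g) 1" unfolding dist_norm by (rule abs_Re_le_cmod)
    finally show ?thesis using k[OF \<open>g \<in> C n\<close>] by simp
  qed
  have geo: "summable (\<lambda>n. (1/2::real) ^ n)" by (rule summable_geometric) simp
  have summ: "summable (\<lambda>n. f n g)" for g
  proof -
    obtain m where "g \<in> C m" using C(3,5) by blast
    then show ?thesis using f_le by (intro summable_comparison_test[OF _ geo]) blast
  qed
  define \<psi> where "\<psi> g = (\<Sum>n. f n g)" for g
  have sums: "(\<lambda>n. f n g) sums \<psi> g" for g unfolding \<psi>_def using summ by (rule summable_sums)
  show ?thesis
  proof
    show "pos_semidef (schoenberg_kernel \<psi>)"
    proof (rule pos_semidef_suminf)
      show "pos_semidef (schoenberg_kernel (f n))" for n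
        using pos_semidef_schoenberg_kernel[OF \<phi>(2) \<phi>(1)] unfolding f_def .
      show "(\<lambda>n. schoenberg_kernel (f n) i j) sums schoenberg_kernel \<psi> i j" for i j
        unfolding schoenberg_kernel_def by (intro sums_divide sums_add sums_diff sums)
    qed
    show "\<psi> 0 = 0" by (simp add: \<psi>_def f_def \<phi>)
    have "continuous_on (U m) \<psi>" for m
    proof (rule uniform_limit_theorem)
      show "uniform_limit (U m) (\<lambda>n g. \<Sum>i<n. f i g) \<psi> sequentially"
        unfolding \<psi>_def
      proof (rule Weierstrass_m_test_ev[OF _ geo])
        show "\<forall>\<^sub>F n in sequentially. \<forall>x\<in>U m. norm (f n x) \<le> (1/2) ^ n"
          using f_le C(3)[of m] unfolding eventually_sequentially by blast
      qed
      have "continuous_on (U m) (f n)" for n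
        using C0[of "k n"] unfolding f_def C0_function_def
        by (auto intro!: continuous_intros intro: continuous_on_subset)
      then show "\<forall>\<^sub>F n in sequentially. continuous_on (U m) (\<lambda>g. \<Sum>i<n. f i g)"
        by (auto intro!: always_eventually continuous_on_sum)
    qed simp
    then show "continuous_on UNIV \<psi>"
      using continuous_on_open_UN[of UNIV U \<psi>] C(2,5) by auto
    show "filterlim \<psi> at_top cocompact"
      unfolding filterlim_at_top
    proof
      fix Z :: real
      obtain N :: nat where N: "2 * Z \<le> real N" using real_arch_simple by blast
      have "\<forall>\<^sub>F g in cocompact. \<forall>n\<in>{..<N}. cmod (\<phi> (k n) g) < 1/2"
      proof (intro eventually_ball_finite ballI)
        show "\<forall>\<^sub>F g in cocompact. cmod (\<phi> (k n) g) < 1/2" for n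
          using C0[of "k n"] tendstoD[of "\<phi> (k n)" 0 cocompact "1/2"] unfolding C0_function_def by simp
      qed simp
      then show "\<forall>\<^sub>F g in cocompact. Z \<le> \<psi> g"
      proof eventually_elim
        case (elim g)
        have "1/2 \<le> f n g" if "n < N" for n
          using elim that complex_Re_le_cmod[of "\<phi> (k n) g"] by (force simp: f_def)
        then have "(\<Sum>n<N. 1/2) \<le> (\<Sum>n<N. f n g)" by (intro sum_mono) auto
        also have "\<dots> \<le> \<psi> g"
          unfolding \<psi>_def by (intro sum_le_suminf summ) (use f0 in auto)
        finally show ?case using N by simp
      qed
    qed
  qed
qed

section \<open>Gaussian processes with stationary increments\<close>


lemma sum_over_fibres:
  fixes f :: "'a \<Rightarrow> real"
  assumes "finite A"
  shows "(\<Sum>g\<in>p ` A. (\<Sum>i\<in>{i\<in>A. p i = g}. c i) * f g) = (\<Sum>i\<in>A. c i * f (p i))"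
proof -
  have "(\<Sum>g\<in>p ` A. (\<Sum>i\<in>{i\<in>A. p i = g}. c i) * f g) = (\<Sum>g\<in>p ` A. \<Sum>i\<in>{i\<in>A. p i = g}. c i * f (p i))"
    by (intro sum.cong refl) (auto simp: sum_distrib_right intro: sum.cong)
  also have "\<dots> = (\<Sum>i\<in>A. c i * f (p i))"
    by (rule sum.image_gen[OF assms, symmetric])
  finally show ?thesis .
qed

text \<open>
  A centred Gaussian process indexed by the group whose covariance is the Schoenberg kernel of
  \<open>\<psi>\<close>. Its increments are stationary: the variance of \<open>x g - x h\<close> is \<open>\<psi> (- h + g)\<close>.
\<close>

locale gaussian_increments = prob_space P for P :: "('g::group_add \<Rightarrow> real) measure" +
  fixes \<psi> :: "'g \<Rightarrow> real"
  assumes sets_P[measurable_cong]: "sets P = sets (PiM UNIV (\<lambda>_. borel))"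
    and pos_semidef_K: "pos_semidef (schoenberg_kernel \<psi>)"
    and \<psi>_0: "\<psi> 0 = 0"
    and char_P: "finite J \<Longrightarrow> (CLINT x|P. iexp (\<Sum>j\<in>J. t j * x j)) =
      of_real (exp (- (\<Sum>i\<in>J. \<Sum>j\<in>J. t i * t j * schoenberg_kernel \<psi> i j) / 2))"
begin

abbreviation "cov \<equiv> schoenberg_kernel \<psi>"

lemma \<psi>_uminus: "\<psi> (- g) = \<psi> g"
  using pos_semidef_sym[OF pos_semidef_K, of g 0] by (simp add: schoenberg_kernel_def)

lemma \<psi>_nonneg: "0 \<le> \<psi> g"
  using pos_semidef_diag_nonneg[OF pos_semidef_K, of g] by (simp add: schoenberg_kernel_def \<psi>_0)

lemma space_P: "space P = UNIV"
  using sets_eq_imp_space_eq[OF sets_P] by (simp add: space_PiM)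

lemma coord_measurable: "(\<lambda>x. x g) \<in> borel_measurable P"
  using measurable_component_singleton[of g UNIV "\<lambda>_. borel :: real measure"]
  by (simp add: measurable_cong_sets[OF sets_P refl])

lemma increment_measurable: "(\<lambda>x. x g - x h) \<in> borel_measurable P"
  by (intro borel_measurable_diff coord_measurable)

text \<open>
  The same formula for sums over an auxiliary index set whose points may be sent to the same group
  element; equal points are collected first. This allows increments to be handled without
  distinguishing whether the points involved coincide.
\<close>

lemma char_linear_combination:
  assumes A: "finite A"
  shows "(CLINT x|P. iexp (\<Sum>i\<in>A. c i * x (p i))) =
    of_real (exp (- (\<Sum>i\<in>A. \<Sum>j\<in>A. c i * c j * cov (p i) (p j)) / 2))"
proof -
  define t where "t g = (\<Sum>i\<in>{i\<in>A. p i = g}. c i)" for g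
  have t: "(\<Sum>g\<in>p ` A. t g * f g) = (\<Sum>i\<in>A. c i * f (p i))" for f
    unfolding t_def by (rule sum_over_fibres[OF A])
  have "(\<Sum>g\<in>p ` A. \<Sum>h\<in>p ` A. t g * t h * cov g h) = (\<Sum>g\<in>p ` A. t g * (\<Sum>h\<in>p ` A. t h * cov g h))"
    by (simp add: sum_distrib_left mult_ac)
  also have "\<dots> = (\<Sum>i\<in>A. c i * (\<Sum>j\<in>A. c j * cov (p i) (p j)))"
    unfolding t ..
  finally have "(\<Sum>g\<in>p ` A. \<Sum>h\<in>p ` A. t g * t h * cov g h) = (\<Sum>i\<in>A. \<Sum>j\<in>A. c i * c j * cov (p i) (p j))"
    by (simp add: sum_distrib_left mult_ac)
  then show ?thesis
    using char_P[of "p ` A" t] A unfolding t by simp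
qed

lemma distr_increment:
  "distr P borel (\<lambda>x. x g - x h) = distr std_normal_distribution borel (\<lambda>z. sqrt (\<psi> (- h + g)) * z)"
proof (rule Levy_uniqueness)
  interpret N: real_distribution std_normal_distribution by (rule real_dist_normal_dist)
  show "real_distribution (distr P borel (\<lambda>x. x g - x h))"
    by (rule real_distribution_distr[OF increment_measurable])
  show "real_distribution (distr std_normal_distribution borel (\<lambda>z. sqrt (\<psi> (- h + g)) * z))"
    by (rule N.real_distribution_distr) simp
  show "char (distr P borel (\<lambda>x. x g - x h)) =
    char (distr std_normal_distribution borel (\<lambda>z. sqrt (\<psi> (- h + g)) * z))"
  proof
    fix t :: real
    let ?c = "\<lambda>b. if b then t else - t" and ?p = "\<lambda>b. if b then g else h"
    have lin: "t * (x g - x h) = (\<Sum>b\<in>UNIV. ?c b * x (?p b))" for x :: "'g \<Rightarrow> real"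
      by (simp add: UNIV_bool right_diff_distrib)
    have "char (distr P borel (\<lambda>x. x g - x h)) t = (CLINT x|P. iexp (t * (x g - x h)))"
      unfolding char_def by (rule integral_distr[OF increment_measurable]) simp
    also have "\<dots> = (CLINT x|P. iexp (\<Sum>b\<in>UNIV. ?c b * x (?p b)))"
      unfolding lin ..
    also have "\<dots> = of_real (exp (- (\<Sum>b\<in>UNIV. \<Sum>b'\<in>UNIV. ?c b * ?c b' * cov (?p b) (?p b')) / 2))"
      by (rule char_linear_combination) simp
    also have "(\<Sum>b\<in>UNIV. \<Sum>b'\<in>UNIV. ?c b * ?c b' * cov (?p b) (?p b')) =
        t\<^sup>2 * (cov g g + cov h h - cov g h - cov h g)"
      by (simp add: UNIV_bool power2_eq_square algebra_simps)
    also have "cov g g + cov h h - cov g h - cov h g = \<psi> (- h + g)"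
      using pos_semidef_sym[OF pos_semidef_K, of g h] by (simp add: schoenberg_kernel_def \<psi>_0 field_simps)
    also have "t\<^sup>2 * \<psi> (- h + g) = (t * sqrt (\<psi> (- h + g)))\<^sup>2"
      using \<psi>_nonneg[of "- h + g"] by (simp add: power_mult_distrib)
    also have "complex_of_real (exp (- (t * sqrt (\<psi> (- h + g)))\<^sup>2 / 2)) = char std_normal_distribution (t * sqrt (\<psi> (- h + g)))"
      by (simp add: char_std_normal_distribution)
    also have "\<dots> = char (distr std_normal_distribution borel (\<lambda>z. sqrt (\<psi> (- h + g)) * z)) t"
    proof -
      have "char (distr std_normal_distribution borel (\<lambda>z. sqrt (\<psi> (- h + g)) * z)) t =
          (CLINT z|std_normal_distribution. iexp (t * (sqrt (\<psi> (- h + g)) * z)))"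
        unfolding char_def by (rule integral_distr) simp_all
      then show ?thesis by (simp only: char_def mult.assoc)
    qed
    finally show "char (distr P borel (\<lambda>x. x g - x h)) t = char (distr std_normal_distribution borel (\<lambda>z. sqrt (\<psi> (- h + g)) * z)) t" .
  qed
qed

text \<open>
  Stationarity of the increments, for the whole process at once. The process of increments from the
  point \<open>- h\<close> has the covariance \<open>\<psi>\<close> prescribes for the process itself, because
  \<open>- (- h + k) + (- h + g) = - k + g\<close>.
\<close>

lemma distr_shifted_increments:
  "distr P (PiM UNIV (\<lambda>_. borel)) (\<lambda>x g. x (- h + g) - x (- h)) = P"
proof (rule char_unique_PiM)
  have m[measurable]: "(\<lambda>x g. x (- h + g) - x (- h)) \<in> measurable P (PiM UNIV (\<lambda>_. borel))"
    by (rule measurable_PiM_single') (auto simp: space_PiM intro!: borel_measurable_diff coord_measurable)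
  show "prob_space (distr P (PiM UNIV (\<lambda>_. borel)) (\<lambda>x g. x (- h + g) - x (- h)))"
    by (rule prob_space_distr) measurable
  fix J :: "'g set" and t :: "'g \<Rightarrow> real" assume J: "finite J"
  \<comment> \<open>\<open>None\<close> stands for the base point \<open>- h\<close>, which carries minus the sum of all weights.\<close>
  define A where "A = insert None (Some ` J)"
  define c where "c = case_option (- (\<Sum>g\<in>J. t g)) t"
  define p where "p = case_option (- h) (\<lambda>g. - h + g)"
  have sumA: "(\<Sum>i\<in>A. c i * f i) = (\<Sum>g\<in>J. t g * (f (Some g) - f None))" for f :: "'g option \<Rightarrow> real"
    unfolding A_def c_def using J
    by (subst sum.insert) (auto simp: sum.reindex right_diff_distrib sum_subtractf sum_distrib_right)
  have "(CLINT x|distr P (PiM UNIV (\<lambda>_. borel)) (\<lambda>x g. x (- h + g) - x (- h)). iexp (\<Sum>j\<in>J. t j * x j)) =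
    (CLINT x|P. iexp (\<Sum>j\<in>J. t j * (x (- h + j) - x (- h))))"
    by (rule integral_distr) measurable
  also have "\<dots> = (CLINT x|P. iexp (\<Sum>i\<in>A. c i * x (p i)))"
    unfolding sumA by (simp add: p_def)
  also have "\<dots> = of_real (exp (- (\<Sum>i\<in>A. \<Sum>j\<in>A. c i * c j * cov (p i) (p j)) / 2))"
    using J by (intro char_linear_combination) (simp add: A_def)
  also have "(\<Sum>i\<in>A. \<Sum>j\<in>A. c i * c j * cov (p i) (p j)) = (\<Sum>i\<in>A. c i * (\<Sum>j\<in>A. c j * cov (p i) (p j)))"
    by (simp add: sum_distrib_left mult_ac)
  also have "\<dots> = (\<Sum>g\<in>J. t g * ((\<Sum>k\<in>J. t k * (cov (- h + g) (- h + k) - cov (- h + g) (- h))) -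
      (\<Sum>k\<in>J. t k * (cov (- h) (- h + k) - cov (- h) (- h)))))"
    unfolding sumA by (simp add: p_def)
  also have "\<dots> = (\<Sum>g\<in>J. t g * (\<Sum>k\<in>J. t k * cov g k))"
  proof -
    have "cov (- h + g) (- h + k) - cov (- h + g) (- h) - (cov (- h) (- h + k) - cov (- h) (- h)) = cov g k" for g k
    proof -
      have "- (- h + k) + (- h + g) = - k + g" "- (- h) + (- h + g) = g" "- (- h + k) + - h = - k"
        by (simp_all add: minus_add add.assoc)
      then show ?thesis
        using \<psi>_uminus[of k] by (simp add: schoenberg_kernel_def \<psi>_0 field_simps)
    qed
    then show ?thesis by (simp only: sum_subtractf[symmetric] right_diff_distrib[symmetric])
  qed
  also have "of_real (exp (- \<dots> / 2)) = (CLINT x|P. iexp (\<Sum>j\<in>J. t j * x j))"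
    using char_P[OF J, of t] by (simp add: sum_distrib_left mult_ac)
  finally show "(CLINT x|distr P (PiM UNIV (\<lambda>_. borel)) (\<lambda>x g. x (- h + g) - x (- h)). iexp (\<Sum>j\<in>J. t j * x j)) =
    (CLINT x|P. iexp (\<Sum>j\<in>J. t j * x j))" .
qed (use prob_space_axioms sets_P in simp_all)

lemma nn_integral_abs_increment: "(\<integral>\<^sup>+x. ennreal \<bar>x g - x h\<bar> \<partial>P) \<le> ennreal (sqrt (\<psi> (- h + g)))"
proof -
  let ?\<sigma> = "sqrt (\<psi> (- h + g))"
  have \<sigma>: "0 \<le> ?\<sigma>" using \<psi>_nonneg by simp
  have "(\<integral>\<^sup>+x. ennreal \<bar>x g - x h\<bar> \<partial>P) = (\<integral>\<^sup>+y. ennreal \<bar>y\<bar> \<partial>distr P borel (\<lambda>x. x g - x h))"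
    by (subst nn_integral_distr[OF increment_measurable]) simp_all
  also have "\<dots> = (\<integral>\<^sup>+z. ennreal \<bar>?\<sigma> * z\<bar> \<partial>std_normal_distribution)"
    unfolding distr_increment by (subst nn_integral_distr) auto
  also have "\<dots> = (\<integral>\<^sup>+z. ennreal ?\<sigma> * ennreal \<bar>z\<bar> \<partial>std_normal_distribution)"
    using \<sigma> by (simp add: abs_mult ennreal_mult)
  also have "\<dots> = ennreal ?\<sigma> * (\<integral>\<^sup>+z. ennreal \<bar>z\<bar> \<partial>std_normal_distribution)"
    by (rule nn_integral_cmult) simp
  also have "(\<integral>\<^sup>+z. ennreal \<bar>z\<bar> \<partial>std_normal_distribution) = ennreal (LINT z|std_normal_distribution. \<bar>z\<bar>)"
    using integrable_std_normal_distribution_moment[of 1] by (intro nn_integral_eq_integral) auto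
  also have "(LINT z|std_normal_distribution. \<bar>z\<bar>) = sqrt (2 / pi)"
    using std_normal_distribution_odd_moments_abs[of 0] by simp
  also have "ennreal ?\<sigma> * ennreal (sqrt (2 / pi)) \<le> ennreal ?\<sigma> * ennreal 1"
    using pi_gt3 by (intro mult_left_mono ennreal_leI) auto
  finally show ?thesis by simp
qed

text \<open>
  The standard normal density is at most \<open>1\<close>, so an interval has at most its length as
  probability.
\<close>

lemma emeasure_small_increment:
  assumes R: "0 \<le> R" and pos: "0 < \<psi> (- h + g)"
  shows "emeasure P {x \<in> space P. \<bar>x g - x h\<bar> \<le> R} \<le> ennreal (2 * R / sqrt (\<psi> (- h + g)))"
proof -
  let ?\<sigma> = "sqrt (\<psi> (- h + g))"
  have \<sigma>: "0 < ?\<sigma>" using pos by simp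
  have "emeasure P {x \<in> space P. \<bar>x g - x h\<bar> \<le> R} = emeasure (distr P borel (\<lambda>x. x g - x h)) {y. \<bar>y\<bar> \<le> R}"
    by (subst emeasure_distr[OF increment_measurable]) (auto intro!: arg_cong[where f = "emeasure P"])
  also have "\<dots> = emeasure std_normal_distribution {z. \<bar>?\<sigma> * z\<bar> \<le> R}"
    unfolding distr_increment by (subst emeasure_distr) (auto intro!: arg_cong[where f = "emeasure _"])
  also have "{z. \<bar>?\<sigma> * z\<bar> \<le> R} = {- (R / ?\<sigma>)..R / ?\<sigma>}"
    using \<sigma> by (auto simp: abs_le_iff field_simps)
  also have "emeasure std_normal_distribution {- (R / ?\<sigma>)..R / ?\<sigma>} =
      (\<integral>\<^sup>+z. ennreal (std_normal_density z) * indicator {- (R / ?\<sigma>)..R / ?\<sigma>} z \<partial>lborel)"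
    by (rule emeasure_density) auto
  also have "\<dots> \<le> (\<integral>\<^sup>+z. indicator {- (R / ?\<sigma>)..R / ?\<sigma>} z \<partial>lborel)"
  proof (rule nn_integral_mono)
    fix z :: real
    have "1 \<le> sqrt (2 * pi)" using pi_gt3 by (intro real_le_rsqrt) auto
    then have "std_normal_density z \<le> 1 * 1"
      unfolding std_normal_density_def by (intro mult_mono) auto
    then show "ennreal (std_normal_density z) * indicator {- (R / ?\<sigma>)..R / ?\<sigma>} z \<le> indicator {- (R / ?\<sigma>)..R / ?\<sigma>} z"
      by (auto simp: indicator_def ennreal_le_1)
  qed
  also have "\<dots> = ennreal (2 * R / ?\<sigma>)" using \<sigma> R by (simp add: field_simps)
  finally show ?thesis .
qed

end

section \<open>Paths started from Lebesgue measure\<close>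


text \<open>
  Points are sequences of functions on the group, but the \<open>\<sigma>\<close>-algebra sees only the entry with
  number \<open>0\<close>; a single function is represented by the constant sequence.
\<close>

definition path_space :: "(nat \<Rightarrow> 'g \<Rightarrow> real) measure" where
  "path_space = vimage_algebra UNIV (\<lambda>x. x 0) (PiM UNIV (\<lambda>_. borel))"

lemma space_path_space[simp]: "space path_space = UNIV"
  by (simp add: path_space_def)

lemma measurable_path_space:
  assumes "\<And>g. (\<lambda>\<omega>. f \<omega> 0 g) \<in> borel_measurable L"
  shows "f \<in> measurable L path_space"
  unfolding path_space_def
proof (rule measurable_vimage_algebra2)
  show "(\<lambda>x. f x 0) \<in> measurable L (PiM UNIV (\<lambda>_. borel))"
    by (rule measurable_PiM_single') (use assms in \<open>auto simp: space_PiM\<close>)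
qed simp

lemma coordinate_path_space: "(\<lambda>x. x 0 g) \<in> borel_measurable path_space"
  unfolding path_space_def
  by (rule measurable_compose[OF measurable_vimage_algebra1 measurable_component_singleton])
     (auto simp: space_PiM)

lemma emeasure_lborel_translate:
  fixes T :: "real set"
  assumes "T \<in> sets lborel"
  shows "emeasure lborel {s. c + s \<in> T} = emeasure lborel T"
proof -
  have "emeasure lborel T = emeasure (distr lborel borel ((+) c)) T"
    by (simp add: lborel_distr_plus)
  also have "\<dots> = emeasure lborel {s. c + s \<in> T}"
    using assms by (subst emeasure_distr) (auto intro!: arg_cong[where f = "emeasure lborel"])
  finally show ?thesis ..
qed

context gaussian_increments
begin

definition path :: "real \<times> ('g \<Rightarrow> real) \<Rightarrow> nat \<Rightarrow> 'g \<Rightarrow> real" where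
  "path = (\<lambda>(s, b) n g. s + b g)"

text \<open>
  The starting value \<open>s\<close> has Lebesgue measure as its law, whence the measure is infinite, and it is
  independent of the Gaussian process.
\<close>

definition path_measure :: "(nat \<Rightarrow> 'g \<Rightarrow> real) measure" where
  "path_measure = distr (lborel \<Otimes>\<^sub>M P) path_space path"

definition shift :: "'g \<Rightarrow> (nat \<Rightarrow> 'g \<Rightarrow> real) \<Rightarrow> nat \<Rightarrow> 'g \<Rightarrow> real" where
  "shift h x n g = x n (- h + g)"

sublocale pair: pair_sigma_finite lborel P ..

lemma sets_path_measure: "sets path_measure = sets path_space"
  by (simp add: path_measure_def)

lemma space_path_measure: "space path_measure = UNIV"
  by (simp add: path_measure_def)

lemma coordinate_path_measure[measurable]: "(\<lambda>x. x 0 g) \<in> borel_measurable path_measure"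
  using coordinate_path_space by (simp add: measurable_cong_sets[OF sets_path_measure refl])

lemma path_measurable: "path \<in> measurable (lborel \<Otimes>\<^sub>M P) path_space"
proof (rule measurable_path_space)
  fix g
  have "(\<lambda>\<omega>. fst \<omega> + snd \<omega> g) \<in> borel_measurable (lborel \<Otimes>\<^sub>M P)"
    by (intro borel_measurable_add measurable_compose[OF measurable_snd coord_measurable]) simp
  then show "(\<lambda>\<omega>. path \<omega> 0 g) \<in> borel_measurable (lborel \<Otimes>\<^sub>M P)"
    by (simp add: path_def case_prod_beta)
qed

lemma
  assumes S: "S \<in> sets path_space"
  shows emeasure_path_measure: "emeasure path_measure S = (\<integral>\<^sup>+b. emeasure lborel {s. path (s, b) \<in> S} \<partial>P)"
    and path_section_measurable: "(\<lambda>b. emeasure lborel {s. path (s, b) \<in> S}) \<in> borel_measurable P"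
    and path_section_sets: "{s. path (s, b) \<in> S} \<in> sets lborel"
proof -
  let ?A = "path -` S \<inter> space (lborel \<Otimes>\<^sub>M P)"
  have A: "?A \<in> sets (lborel \<Otimes>\<^sub>M P)"
    using measurable_sets[OF path_measurable S] .
  have sec: "(\<lambda>s. (s, b)) -` ?A = {s. path (s, b) \<in> S}" for b
    by (auto simp: space_pair_measure space_P)
  show "emeasure path_measure S = (\<integral>\<^sup>+b. emeasure lborel {s. path (s, b) \<in> S} \<partial>P)"
    unfolding path_measure_def emeasure_distr[OF path_measurable S]
      pair.emeasure_pair_measure_alt2[OF A] sec ..
  show "(\<lambda>b. emeasure lborel {s. path (s, b) \<in> S}) \<in> borel_measurable P"
    using pair.measurable_emeasure_Pair2[OF A] unfolding sec .
  show "{s. path (s, b) \<in> S} \<in> sets lborel"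
    using sets_Pair2[OF A, of b] unfolding sec .
qed

lemma shift_measurable: "shift h \<in> measurable path_measure path_measure"
  unfolding measurable_cong_sets[OF refl sets_path_measure]
  by (rule measurable_path_space) (simp add: shift_def coordinate_path_measure)

text \<open>
  Translating the index turns \<open>s + b\<close> into \<open>(s + b (- h)) + (increments of b from - h)\<close>. For
  fixed \<open>b\<close> the first summand still has Lebesgue measure as its law, and the increments have the
  law of \<open>b\<close>.
\<close>

theorem distr_shift: "distr path_measure path_measure (shift h) = path_measure"
proof (rule measure_eqI)
  fix S assume "S \<in> sets (distr path_measure path_measure (shift h))"
  then have S: "S \<in> sets path_space" by (simp add: sets_path_measure)
  let ?incr = "\<lambda>b g. b (- h + g) - b (- h)"
  have incr: "?incr \<in> measurable P P"
    unfolding measurable_cong_sets[OF refl sets_P]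
    by (rule measurable_PiM_single') (auto simp: space_PiM intro!: increment_measurable)
  have P_incr: "distr P P ?incr = P"
    using distr_shifted_increments[of h] by (subst distr_cong[OF refl sets_P refl])
  have T: "shift h -` S \<in> sets path_space"
    using measurable_sets[OF shift_measurable, of S h] S by (simp add: sets_path_measure space_path_measure)
  have "emeasure (distr path_measure path_measure (shift h)) S = emeasure path_measure (shift h -` S)"
    using S by (subst emeasure_distr[OF shift_measurable]) (auto simp: sets_path_measure space_path_measure)
  also have "\<dots> = (\<integral>\<^sup>+b. emeasure lborel {s. path (s, b) \<in> shift h -` S} \<partial>P)"
    by (rule emeasure_path_measure[OF T])
  also have "\<dots> = (\<integral>\<^sup>+b. emeasure lborel {s. path (s, ?incr b) \<in> S} \<partial>P)"
  proof (rule nn_integral_cong)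
    fix b
    have "shift h (path (s, b)) = path (b (- h) + s, ?incr b)" for s
      by (simp add: fun_eq_iff shift_def path_def)
    then have "{s. path (s, b) \<in> shift h -` S} = {s. b (- h) + s \<in> {s. path (s, ?incr b) \<in> S}}"
      by simp
    then show "emeasure lborel {s. path (s, b) \<in> shift h -` S} = emeasure lborel {s. path (s, ?incr b) \<in> S}"
      by (simp only: emeasure_lborel_translate[OF path_section_sets[OF S]])
  qed
  also have "\<dots> = (\<integral>\<^sup>+b. emeasure lborel {s. path (s, b) \<in> S} \<partial>distr P P ?incr)"
    using path_section_measurable[OF S] by (subst nn_integral_distr[OF incr]) simp_all
  also have "\<dots> = emeasure path_measure S"
    unfolding P_incr emeasure_path_measure[OF S] ..
  finally show "emeasure (distr path_measure path_measure (shift h)) S = emeasure path_measure S" .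
qed simp

lemma interval_sets: "{x. p \<le> x 0 g \<and> x 0 g \<le> q} \<in> sets path_space"
proof -
  have "(\<lambda>x. x 0 g) -` {p..q} \<inter> space path_space \<in> sets path_space"
    by (rule measurable_sets[OF coordinate_path_space]) simp
  moreover have "(\<lambda>x. x 0 g) -` {p..q} \<inter> space path_space = {x. p \<le> x 0 g \<and> x 0 g \<le> q}" by auto
  ultimately show ?thesis by simp
qed

lemma emeasure_interval:
  assumes "p \<le> q"
  shows "emeasure path_measure {x. p \<le> x 0 g \<and> x 0 g \<le> q} = ennreal (q - p)"
proof -
  have "{s. path (s, b) \<in> {x. p \<le> x 0 g \<and> x 0 g \<le> q}} = {p - b g..q - b g}" for b
    by (auto simp: path_def)
  then show ?thesis
    using assms by (simp add: emeasure_path_measure[OF interval_sets] emeasure_space_1)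
qed

text \<open>
  For fixed \<open>b\<close> the set of starting values is an interval of length \<open>q - p\<close> minus its translate by
  \<open>b g - b h\<close>, hence of measure at most \<open>\<bar>b g - b h\<bar>\<close>. The bound does not depend on the
  length of the interval; this is what makes long intervals almost invariant.
\<close>

lemma emeasure_interval_leave:
  "emeasure path_measure {x. (p \<le> x 0 g \<and> x 0 g \<le> q) \<and> \<not> (p \<le> x 0 h \<and> x 0 h \<le> q)} \<le> ennreal (sqrt (\<psi> (- h + g)))"
proof -
  let ?S = "{x :: nat \<Rightarrow> 'g \<Rightarrow> real. (p \<le> x 0 g \<and> x 0 g \<le> q) \<and> \<not> (p \<le> x 0 h \<and> x 0 h \<le> q)}"
  have eq: "?S = {x. p \<le> x 0 g \<and> x 0 g \<le> q} - {x. p \<le> x 0 h \<and> x 0 h \<le> q}" by auto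
  have S: "?S \<in> sets path_space" unfolding eq by (intro sets.Diff interval_sets)
  have "emeasure path_measure ?S \<le> (\<integral>\<^sup>+b. ennreal \<bar>b g - b h\<bar> \<partial>P)"
    unfolding emeasure_path_measure[OF S]
  proof (rule nn_integral_mono)
    fix b
    show "emeasure lborel {s. path (s, b) \<in> ?S} \<le> ennreal \<bar>b g - b h\<bar>"
    proof (cases "b h \<le> b g")
      case True
      have "emeasure lborel {s. path (s, b) \<in> ?S} \<le> emeasure lborel {p - b g..p - b h}"
        by (rule emeasure_mono) (use True in \<open>auto simp: path_def\<close>)
      then show ?thesis using True by simp
    next
      case False
      have "emeasure lborel {s. path (s, b) \<in> ?S} \<le> emeasure lborel {q - b h..q - b g}"
        by (rule emeasure_mono) (use False in \<open>auto simp: path_def\<close>)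
      then show ?thesis using False by simp
    qed
  qed
  then show ?thesis using nn_integral_abs_increment[of g h] by (rule order_trans)
qed

text \<open>
  If both coordinates are bounded by \<open>R\<close>, then the increment is bounded by \<open>2 * R\<close>, which is
  unlikely when its variance is large; for each such \<open>b\<close> the starting values fill at most an
  interval of length \<open>2 * R\<close>.
\<close>

lemma emeasure_bounded_pair:
  assumes R: "0 \<le> R" and pos: "0 < \<psi> (- h + g)"
  shows "emeasure path_measure {x. (- R \<le> x 0 g \<and> x 0 g \<le> R) \<and> (- R \<le> x 0 h \<and> x 0 h \<le> R)} \<le> ennreal (8 * R\<^sup>2 / sqrt (\<psi> (- h + g)))"
proof -
  let ?S = "{x :: nat \<Rightarrow> 'g \<Rightarrow> real. (- R \<le> x 0 g \<and> x 0 g \<le> R) \<and> (- R \<le> x 0 h \<and> x 0 h \<le> R)}"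
  have eq: "?S = {x. - R \<le> x 0 g \<and> x 0 g \<le> R} \<inter> {x. - R \<le> x 0 h \<and> x 0 h \<le> R}" by auto
  have S: "?S \<in> sets path_space" unfolding eq by (intro sets.Int interval_sets)
  let ?E = "{b \<in> space P. \<bar>b g - b h\<bar> \<le> 2 * R}"
  have E: "?E \<in> sets P" using increment_measurable[of g h] by measurable
  have "emeasure path_measure ?S \<le> (\<integral>\<^sup>+b. ennreal (2 * R) * indicator ?E b \<partial>P)"
    unfolding emeasure_path_measure[OF S]
  proof (rule nn_integral_mono)
    fix b
    show "emeasure lborel {s. path (s, b) \<in> ?S} \<le> ennreal (2 * R) * indicator ?E b"
    proof (cases "\<bar>b g - b h\<bar> \<le> 2 * R")
      case True
      have "emeasure lborel {s. path (s, b) \<in> ?S} \<le> emeasure lborel {- R - b g..R - b g}"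
        by (rule emeasure_mono) (auto simp: path_def)
      then show ?thesis using True R by (simp add: space_P)
    next
      case False
      then have empty: "{s. path (s, b) \<in> ?S} = {}" by (auto simp: path_def)
      show ?thesis unfolding empty by simp
    qed
  qed
  also have "\<dots> = ennreal (2 * R) * emeasure P ?E"
    using E by (simp add: nn_integral_cmult_indicator)
  also have "\<dots> \<le> ennreal (2 * R) * ennreal (2 * (2 * R) / sqrt (\<psi> (- h + g)))"
    using R by (intro mult_left_mono emeasure_small_increment pos) auto
  also have "\<dots> = ennreal (8 * R\<^sup>2 / sqrt (\<psi> (- h + g)))"
    using R pos by (simp add: ennreal_mult[symmetric] power2_eq_square)
  finally show ?thesis .
qed

end

section \<open>Square integrable functions\<close>


lemma L2_measurable: "f \<in> L2 M \<Longrightarrow> f \<in> borel_measurable M"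
  by (simp add: L2_def)

lemma L2_integrable: "f \<in> L2 M \<Longrightarrow> integrable M (\<lambda>\<omega>. (cmod (f \<omega>))\<^sup>2)"
  by (simp add: L2_def)

lemma cnj_borel_measurable: "cnj \<in> borel_measurable borel"
  by (intro borel_measurable_continuous_onI continuous_intros)

lemma cmod_power2_add_le: "(cmod (x + y))\<^sup>2 \<le> 2 * (cmod x)\<^sup>2 + 2 * (cmod y)\<^sup>2"
proof -
  have "(cmod (x + y))\<^sup>2 \<le> (cmod x + cmod y)\<^sup>2"
    by (intro power_mono norm_triangle_ineq) simp
  also have "\<dots> \<le> 2 * (cmod x)\<^sup>2 + 2 * (cmod y)\<^sup>2"
    using sum_squares_bound[of "cmod x" "cmod y"] by (simp add: power2_sum)
  finally show ?thesis .
qed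

lemma L2_lincomb:
  assumes f: "f \<in> L2 M" and h: "h \<in> L2 M"
  shows "(\<lambda>\<omega>. f \<omega> + c * h \<omega>) \<in> L2 M"
proof -
  have [measurable]: "f \<in> borel_measurable M" "h \<in> borel_measurable M"
    using f h by (auto intro: L2_measurable)
  have "integrable M (\<lambda>\<omega>. (cmod (f \<omega> + c * h \<omega>))\<^sup>2)"
  proof (rule Bochner_Integration.integrable_bound)
    show "integrable M (\<lambda>\<omega>. 2 * (cmod (f \<omega>))\<^sup>2 + 2 * ((cmod c)\<^sup>2 * (cmod (h \<omega>))\<^sup>2))"
      using L2_integrable[OF f] L2_integrable[OF h] by simp
    show "AE \<omega> in M. norm ((cmod (f \<omega> + c * h \<omega>))\<^sup>2) \<le> norm (2 * (cmod (f \<omega>))\<^sup>2 + 2 * ((cmod c)\<^sup>2 * (cmod (h \<omega>))\<^sup>2))"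
    proof (rule AE_I2)
      fix \<omega>
      show "norm ((cmod (f \<omega> + c * h \<omega>))\<^sup>2) \<le> norm (2 * (cmod (f \<omega>))\<^sup>2 + 2 * ((cmod c)\<^sup>2 * (cmod (h \<omega>))\<^sup>2))"
        using cmod_power2_add_le[of "f \<omega>" "c * h \<omega>"] by (simp add: norm_mult power_mult_distrib)
    qed
  qed measurable
  then show ?thesis by (simp add: L2_def)
qed

lemma L2_add: "f \<in> L2 M \<Longrightarrow> h \<in> L2 M \<Longrightarrow> (\<lambda>\<omega>. f \<omega> + h \<omega>) \<in> L2 M"
  using L2_lincomb[of f M h 1] by simp

lemma L2_diff: "f \<in> L2 M \<Longrightarrow> h \<in> L2 M \<Longrightarrow> (\<lambda>\<omega>. f \<omega> - h \<omega>) \<in> L2 M"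
  using L2_lincomb[of f M h "-1"] by simp

lemma L2_zero: "(\<lambda>_. 0) \<in> L2 M"
  by (simp add: L2_def)

lemma L2_scale: "f \<in> L2 M \<Longrightarrow> (\<lambda>\<omega>. c * f \<omega>) \<in> L2 M"
  using L2_lincomb[OF L2_zero, of f M c] by simp

lemma L2_indicator:
  assumes B: "B \<in> sets M" "emeasure M B < \<infinity>"
  shows "indicator B \<in> L2 M"
proof -
  have "(\<lambda>\<omega>. (cmod (indicator B \<omega>))\<^sup>2) = (indicator B :: _ \<Rightarrow> real)"
    by (auto simp: fun_eq_iff indicator_def)
  then show ?thesis using B by (simp add: L2_def)
qed

lemma L2_norm_nonneg: "0 \<le> L2_norm M f"
  by (simp add: L2_norm_def)

lemma L2_norm_power2: "(L2_norm M f)\<^sup>2 = (LINT \<omega>|M. (cmod (f \<omega>))\<^sup>2)"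
  by (simp add: L2_norm_def)

lemma L2_norm_scale: "L2_norm M (\<lambda>\<omega>. c * f \<omega>) = cmod c * L2_norm M f"
  by (simp add: L2_norm_def norm_mult power_mult_distrib real_sqrt_mult)

lemma L2_norm_minus_commute: "L2_norm M (\<lambda>\<omega>. f \<omega> - h \<omega>) = L2_norm M (\<lambda>\<omega>. h \<omega> - f \<omega>)"
  by (simp add: L2_norm_def norm_minus_commute)

lemma L2_inner_integrable:
  assumes f: "f \<in> L2 M" and h: "h \<in> L2 M"
  shows "integrable M (\<lambda>\<omega>. f \<omega> * cnj (h \<omega>))"
proof (rule Bochner_Integration.integrable_bound)
  show "integrable M (\<lambda>\<omega>. (cmod (f \<omega>))\<^sup>2 + (cmod (h \<omega>))\<^sup>2)"
    using L2_integrable[OF f] L2_integrable[OF h] by simp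
  have "cmod (f \<omega>) * cmod (h \<omega>) \<le> (cmod (f \<omega>))\<^sup>2 + (cmod (h \<omega>))\<^sup>2" for \<omega>
    using sum_squares_bound[of "cmod (f \<omega>)" "cmod (h \<omega>)"] mult_nonneg_nonneg[OF norm_ge_zero norm_ge_zero, of "f \<omega>" "h \<omega>"] by linarith
  then show "AE \<omega> in M. norm (f \<omega> * cnj (h \<omega>)) \<le> norm ((cmod (f \<omega>))\<^sup>2 + (cmod (h \<omega>))\<^sup>2)"
    by (simp add: norm_mult)
  show "(\<lambda>\<omega>. f \<omega> * cnj (h \<omega>)) \<in> borel_measurable M"
    using f h by (intro borel_measurable_times measurable_compose[OF _ cnj_borel_measurable] L2_measurable)
qed

lemma L2_Cauchy_Schwarz_abs:
  assumes f: "f \<in> L2 M" and h: "h \<in> L2 M"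
  shows "(LINT \<omega>|M. cmod (f \<omega>) * cmod (h \<omega>)) \<le> L2_norm M f * L2_norm M h"
proof (rule power2_le_imp_le)
  have [measurable]: "f \<in> borel_measurable M" "h \<in> borel_measurable M"
    using f h by (auto intro: L2_measurable)
  have int: "integrable M (\<lambda>\<omega>. cmod (f \<omega>) * cmod (h \<omega>))"
    using integrable_norm[OF L2_inner_integrable[OF f h]] by (simp add: norm_mult)
  have "ennreal ((LINT \<omega>|M. cmod (f \<omega>) * cmod (h \<omega>))\<^sup>2) = (\<integral>\<^sup>+\<omega>. ennreal (cmod (f \<omega>)) * ennreal (cmod (h \<omega>)) \<partial>M)\<^sup>2"
    using nn_integral_eq_integral[OF int]
    by (simp add: ennreal_mult[symmetric] ennreal_power integral_nonneg_AE)
  also have "\<dots> \<le> (\<integral>\<^sup>+\<omega>. (ennreal (cmod (f \<omega>)))\<^sup>2 \<partial>M) * (\<integral>\<^sup>+\<omega>. (ennreal (cmod (h \<omega>)))\<^sup>2 \<partial>M)"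
    by (rule Cauchy_Schwarz_nn_integral) measurable
  also have "\<dots> = ennreal ((L2_norm M f)\<^sup>2) * ennreal ((L2_norm M h)\<^sup>2)"
    using nn_integral_eq_integral[OF L2_integrable[OF f]] nn_integral_eq_integral[OF L2_integrable[OF h]]
    by (simp add: ennreal_power L2_norm_power2)
  finally show "(LINT \<omega>|M. cmod (f \<omega>) * cmod (h \<omega>))\<^sup>2 \<le> (L2_norm M f * L2_norm M h)\<^sup>2"
    by (simp add: ennreal_mult[symmetric] power_mult_distrib)
qed (simp add: L2_norm_nonneg)

lemma L2_Cauchy_Schwarz:
  assumes f: "f \<in> L2 M" and h: "h \<in> L2 M"
  shows "cmod (L2_inner M f h) \<le> L2_norm M f * L2_norm M h"
proof -
  have "cmod (L2_inner M f h) \<le> (LINT \<omega>|M. cmod (f \<omega> * cnj (h \<omega>)))"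
    unfolding L2_inner_def by (rule integral_norm_bound)
  with L2_Cauchy_Schwarz_abs[OF f h] show ?thesis by (simp add: norm_mult)
qed

lemma L2_norm_triangle:
  assumes f: "f \<in> L2 M" and h: "h \<in> L2 M"
  shows "L2_norm M (\<lambda>\<omega>. f \<omega> + h \<omega>) \<le> L2_norm M f + L2_norm M h"
proof (rule power2_le_imp_le)
  have int: "integrable M (\<lambda>\<omega>. cmod (f \<omega>) * cmod (h \<omega>))"
    using integrable_norm[OF L2_inner_integrable[OF f h]] by (simp add: norm_mult)
  have "(L2_norm M (\<lambda>\<omega>. f \<omega> + h \<omega>))\<^sup>2 \<le> (LINT \<omega>|M. (cmod (f \<omega>))\<^sup>2 + 2 * (cmod (f \<omega>) * cmod (h \<omega>)) + (cmod (h \<omega>))\<^sup>2)"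
    unfolding L2_norm_power2
  proof (rule integral_mono)
    show "integrable M (\<lambda>\<omega>. (cmod (f \<omega> + h \<omega>))\<^sup>2)"
      by (rule L2_integrable[OF L2_add[OF f h]])
    show "integrable M (\<lambda>\<omega>. (cmod (f \<omega>))\<^sup>2 + 2 * (cmod (f \<omega>) * cmod (h \<omega>)) + (cmod (h \<omega>))\<^sup>2)"
      using int L2_integrable[OF f] L2_integrable[OF h] by simp
    fix \<omega>
    have "(cmod (f \<omega> + h \<omega>))\<^sup>2 \<le> (cmod (f \<omega>) + cmod (h \<omega>))\<^sup>2"
      by (intro power_mono norm_triangle_ineq) simp
    then show "(cmod (f \<omega> + h \<omega>))\<^sup>2 \<le> (cmod (f \<omega>))\<^sup>2 + 2 * (cmod (f \<omega>) * cmod (h \<omega>)) + (cmod (h \<omega>))\<^sup>2"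
      by (simp add: power2_sum)
  qed
  also have "\<dots> = (L2_norm M f)\<^sup>2 + 2 * (LINT \<omega>|M. cmod (f \<omega>) * cmod (h \<omega>)) + (L2_norm M h)\<^sup>2"
    using int L2_integrable[OF f] L2_integrable[OF h] by (simp add: L2_norm_power2)
  also have "\<dots> \<le> (L2_norm M f + L2_norm M h)\<^sup>2"
    using L2_Cauchy_Schwarz_abs[OF f h] by (simp add: power2_sum)
  finally show "(L2_norm M (\<lambda>\<omega>. f \<omega> + h \<omega>))\<^sup>2 \<le> (L2_norm M f + L2_norm M h)\<^sup>2" .
qed (simp add: L2_norm_nonneg)

lemma L2_norm_triangle_diff:
  assumes "f \<in> L2 M" "h \<in> L2 M" "k \<in> L2 M"
  shows "L2_norm M (\<lambda>\<omega>. f \<omega> - k \<omega>) \<le> L2_norm M (\<lambda>\<omega>. f \<omega> - h \<omega>) + L2_norm M (\<lambda>\<omega>. h \<omega> - k \<omega>)"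
  using L2_norm_triangle[OF L2_diff[OF assms(1,2)] L2_diff[OF assms(2,3)]] by simp

lemma L2_norm_dominated_convergence:
  assumes f: "f \<in> L2 M" and w: "integrable M w"
    and h: "\<And>n. h n \<in> L2 M"
    and lim: "\<And>\<omega>. \<omega> \<in> space M \<Longrightarrow> (\<lambda>n. h n \<omega>) \<longlonglongrightarrow> f \<omega>"
    and bound: "\<And>n \<omega>. \<omega> \<in> space M \<Longrightarrow> (cmod (f \<omega> - h n \<omega>))\<^sup>2 \<le> w \<omega>"
  shows "(\<lambda>n. L2_norm M (\<lambda>\<omega>. f \<omega> - h n \<omega>)) \<longlonglongrightarrow> 0"
proof -
  have [measurable]: "f \<in> borel_measurable M" "\<And>n. h n \<in> borel_measurable M"
    using f h by (auto intro: L2_measurable)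
  have "(\<lambda>n. LINT \<omega>|M. (cmod (f \<omega> - h n \<omega>))\<^sup>2) \<longlonglongrightarrow> (LINT \<omega>|M. 0)"
  proof (rule integral_dominated_convergence[OF _ _ w])
    show "AE \<omega> in M. (\<lambda>n. (cmod (f \<omega> - h n \<omega>))\<^sup>2) \<longlonglongrightarrow> 0"
    proof (rule AE_I2)
      fix \<omega> assume "\<omega> \<in> space M"
      then have "(\<lambda>n. (cmod (f \<omega> - h n \<omega>))\<^sup>2) \<longlonglongrightarrow> (cmod (f \<omega> - f \<omega>))\<^sup>2"
        by (intro tendsto_intros lim)
      then show "(\<lambda>n. (cmod (f \<omega> - h n \<omega>))\<^sup>2) \<longlonglongrightarrow> 0" by simp
    qed
    show "AE \<omega> in M. norm ((cmod (f \<omega> - h n \<omega>))\<^sup>2) \<le> w \<omega>" for n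
      using bound by (intro AE_I2) simp
  qed measurable
  then show ?thesis
    unfolding L2_norm_def using tendsto_real_sqrt by fastforce
qed

text \<open>
  Density of step functions over a generating \<open>\<pi>\<close>-system, as an induction principle: a closed
  linear property of square integrable functions holds for all of them once it holds for the
  indicators of the sets in \<open>G\<close>. The exhausting sequence \<open>A\<close> keeps all sets in the argument of
  finite measure. Dynkin's theorem gives the indicators of \<open>B \<inter> A n\<close> for all measurable
  \<open>B\<close>, linearity gives the simple functions supported in some \<open>A n\<close>, and dominated convergence
  does the rest.
\<close>

lemma L2_induct [consumes 6, case_names base lincomb limit]:
  fixes M :: "'w measure" and P :: "('w \<Rightarrow> complex) \<Rightarrow> bool"
  assumes f: "f \<in> L2 M" and space: "space M = UNIV"
    and Int: "Int_stable G" and gen: "sets M = sigma_sets UNIV G"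
    and fin: "\<And>B. B \<in> G \<Longrightarrow> emeasure M B < \<infinity>"
    and A: "range A \<subseteq> G" "incseq (A :: nat \<Rightarrow> 'w set)" "(\<Union>n. A n) = UNIV"
    and base: "\<And>B. B \<in> G \<Longrightarrow> P (indicator B)"
    and lincomb: "\<And>f h c. f \<in> L2 M \<Longrightarrow> h \<in> L2 M \<Longrightarrow> P f \<Longrightarrow> P h \<Longrightarrow> P (\<lambda>\<omega>. f \<omega> + c * h \<omega>)"
    and limit: "\<And>f. f \<in> L2 M \<Longrightarrow>
      (\<And>\<epsilon>. \<epsilon> > 0 \<Longrightarrow> \<exists>h\<in>L2 M. P h \<and> L2_norm M (\<lambda>\<omega>. f \<omega> - h \<omega>) < \<epsilon>) \<Longrightarrow> P f"
  shows "P f"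
proof -
  have setsI: "B \<in> sets M" if "B \<in> G" for B using that by (simp add: gen)
  have limit_seq: "P f" if f: "f \<in> L2 M" and h: "\<And>n::nat. h n \<in> L2 M" "\<And>n. P (h n)"
    and lim: "(\<lambda>n. L2_norm M (\<lambda>\<omega>. f \<omega> - h n \<omega>)) \<longlonglongrightarrow> 0" for f h
  proof (rule limit[OF f])
    fix \<epsilon> :: real assume "0 < \<epsilon>"
    then have "\<forall>\<^sub>F n in sequentially. L2_norm M (\<lambda>\<omega>. f \<omega> - h n \<omega>) < \<epsilon>"
      using lim by (rule order_tendstoD(2)[rotated])
    then obtain n where "L2_norm M (\<lambda>\<omega>. f \<omega> - h n \<omega>) < \<epsilon>" by (auto simp: eventually_sequentially)
    then show "\<exists>h\<in>L2 M. P h \<and> L2_norm M (\<lambda>\<omega>. f \<omega> - h \<omega>) < \<epsilon>" using h by blast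
  qed
  have A': "A n \<in> G" "A n \<in> sets M" for n using A(1) setsI by auto
  have fin': "emeasure M (B \<inter> A n) < \<infinity>" if "B \<in> sets M" for B n
    using emeasure_mono[of "B \<inter> A n" "A n" M] A'(2)[of n] fin[OF A'(1)[of n]] by (auto intro: le_less_trans)
  have ind: "indicator (B \<inter> A n) \<in> L2 M" if "B \<in> sets M" for B n
    using that fin' A' by (intro L2_indicator) auto
  have ind_A: "indicator (A n) \<in> L2 M" for n using fin A' by (intro L2_indicator) auto
  have P0: "P (\<lambda>_. 0)"
    using lincomb[OF ind_A[of 0] ind_A[of 0] base[OF A'(1)] base[OF A'(1)], of "-1"] by simp
  have Pow: "G \<subseteq> Pow UNIV" by simp
  have sets_case: "P (indicator (B \<inter> A n))" if "B \<in> sets M" for B n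
    using Int Pow that[unfolded gen]
  proof (induction B rule: sigma_sets_induct_disjoint)
    case (basic B)
    then show ?case using Int A'(1)[of n] by (intro base) (auto simp: Int_stable_def)
  next
    case empty
    then show ?case using P0 by (simp add: indicator_def)
  next
    case (compl B)
    then have "B \<in> sets M" by (simp add: gen)
    have "(indicator ((UNIV - B) \<inter> A n) :: 'w \<Rightarrow> complex) = (\<lambda>\<omega>. indicator (A n) \<omega> + (-1) * indicator (B \<inter> A n) \<omega>)"
      by (auto simp: fun_eq_iff indicator_def)
    then show ?case
      using lincomb[OF ind_A[of n] ind[OF \<open>B \<in> sets M\<close>, of n] base[OF A'(1)] compl(2), of "-1"] by simp
  next
    case (union B)
    have B: "B i \<in> sets M" for i using union(2) by (auto simp: gen)
    let ?h = "\<lambda>N. indicator ((\<Union>i<N. B i) \<inter> A n) :: 'w \<Rightarrow> complex"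
    have hL: "?h N \<in> L2 M" for N using B by (intro ind) auto
    \<comment> \<open>Disjointness makes each partial union one indicator plus the next.\<close>
    have Ph: "P (?h N)" for N
    proof (induction N)
      case 0
      then show ?case using P0 by (simp add: indicator_def)
    next
      case (Suc N)
      have "\<omega> \<notin> B N" if "\<omega> \<in> B i" "i < N" for \<omega> i
        using disjoint_family_onD[OF union(1), of i N] that by auto
      then have "?h (Suc N) = (\<lambda>\<omega>. ?h N \<omega> + 1 * indicator (B N \<inter> A n) \<omega>)"
        by (auto simp: fun_eq_iff indicator_def less_Suc_eq)
      then show ?case using lincomb[OF hL ind[OF B] Suc union(3), of 1] by simp
    qed
    have UB: "(\<Union>i. B i) \<in> sets M" using B by auto
    have "(\<lambda>N. L2_norm M (\<lambda>\<omega>. indicator ((\<Union>i. B i) \<inter> A n) \<omega> - ?h N \<omega>)) \<longlonglongrightarrow> 0"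
    proof (rule L2_norm_dominated_convergence)
      show "integrable M (indicator (A n) :: 'w \<Rightarrow> real)"
        using A' fin by (intro integrable_real_indicator) auto
      show "indicator ((\<Union>i. B i) \<inter> A n) \<in> L2 M" by (rule ind[OF UB])
      fix \<omega>
      show "(\<lambda>N. ?h N \<omega>) \<longlonglongrightarrow> indicator ((\<Union>i. B i) \<inter> A n) \<omega>"
      proof (cases "\<exists>i. \<omega> \<in> B i")
        case True
        then obtain i where i: "\<omega> \<in> B i" by blast
        have "\<forall>\<^sub>F N in sequentially. ?h N \<omega> = indicator ((\<Union>i. B i) \<inter> A n) \<omega>"
          using eventually_gt_at_top[of i] by eventually_elim (use i in \<open>auto simp: indicator_def\<close>)
        then show ?thesis by (rule tendsto_eventually)
      next
        case False
        then show ?thesis by (simp add: indicator_def)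
      qed
      show "(cmod (indicator ((\<Union>i. B i) \<inter> A n) \<omega> - ?h N \<omega>))\<^sup>2 \<le> indicator (A n) \<omega>" for N
        by (auto simp: indicator_def)
    qed (rule hL)
    then show ?case by (rule limit_seq[OF ind[OF UB] hL Ph])
  qed
  have [measurable]: "f \<in> borel_measurable M" by (rule L2_measurable[OF f])
  obtain F where F: "\<And>i. simple_function M (F i)" "\<And>x. (\<lambda>i. F i x) \<longlonglongrightarrow> f x" "\<And>i x. cmod (F i x) \<le> 2 * cmod (f x)"
    using borel_measurable_implies_sequence_metric[of f M 0] space by auto
  define h where "h i \<omega> = F i \<omega> * indicator (A i) \<omega>" for i \<omega>
  have h_sum: "h i = (\<lambda>\<omega>. \<Sum>y\<in>range (F i). y * indicator (F i -` {y} \<inter> A i) \<omega>)" for i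
  proof
    fix \<omega>
    have "finite (range (F i))" using simple_functionD(1)[OF F(1)] space by simp
    then have "(\<Sum>y\<in>range (F i). y * indicator (F i -` {y} \<inter> A i) \<omega>) = (\<Sum>y\<in>{F i \<omega>}. y * indicator (F i -` {y} \<inter> A i) \<omega>)"
      by (intro sum.mono_neutral_right) auto
    then show "h i \<omega> = (\<Sum>y\<in>range (F i). y * indicator (F i -` {y} \<inter> A i) \<omega>)"
      by (simp add: h_def indicator_def)
  qed
  have step: "(\<lambda>\<omega>. \<Sum>y\<in>Y. y * indicator (F i -` {y} \<inter> A i) \<omega>) \<in> L2 M \<and> P (\<lambda>\<omega>. \<Sum>y\<in>Y. y * indicator (F i -` {y} \<inter> A i) \<omega>)"
    if "finite Y" for Y i
    using that
  proof induction
    case empty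
    then show ?case using P0 L2_zero by simp
  next
    case (insert y Y)
    have B: "F i -` {y} \<in> sets M" using simple_functionD(2)[OF F(1), of i "{y}"] space by simp
    have eq: "(\<lambda>\<omega>. \<Sum>y\<in>insert y Y. y * indicator (F i -` {y} \<inter> A i) \<omega>) =
        (\<lambda>\<omega>. (\<Sum>y\<in>Y. y * indicator (F i -` {y} \<inter> A i) \<omega>) + y * indicator (F i -` {y} \<inter> A i) \<omega>)"
      by (intro ext) (simp only: sum.insert[OF insert.hyps] add.commute)
    show ?case
      unfolding eq
      by (rule conjI[OF L2_lincomb[OF conjunct1[OF insert.IH] ind[OF B]]
          lincomb[OF conjunct1[OF insert.IH] ind[OF B] conjunct2[OF insert.IH] sets_case[OF B]]])
  qed
  have fin_range: "finite (range (F i))" for i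
    using simple_functionD(1)[OF F(1), of i] space by simp
  have h: "h i \<in> L2 M" "P (h i)" for i
    unfolding h_sum by (rule conjunct1[OF step[OF fin_range]], rule conjunct2[OF step[OF fin_range]])
  have h_le: "cmod (h i \<omega>) \<le> 2 * cmod (f \<omega>)" for i \<omega>
    using F(3)[of i \<omega>] by (auto simp: h_def indicator_def norm_mult)
  show ?thesis
  proof (rule limit_seq[OF f h])
    show "(\<lambda>n. L2_norm M (\<lambda>\<omega>. f \<omega> - h n \<omega>)) \<longlonglongrightarrow> 0"
    proof (rule L2_norm_dominated_convergence[OF f])
      show "integrable M (\<lambda>\<omega>. 9 * (cmod (f \<omega>))\<^sup>2)" using L2_integrable[OF f] by simp
      fix \<omega>
      show "(cmod (f \<omega> - h n \<omega>))\<^sup>2 \<le> 9 * (cmod (f \<omega>))\<^sup>2" for n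
      proof -
        have "cmod (f \<omega> - h n \<omega>) \<le> 3 * cmod (f \<omega>)"
          using norm_triangle_ineq4[of "f \<omega>" "h n \<omega>"] h_le[of n \<omega>] by simp
        then have "(cmod (f \<omega> - h n \<omega>))\<^sup>2 \<le> (3 * cmod (f \<omega>))\<^sup>2" by (intro power_mono) auto
        then show ?thesis by (simp add: power_mult_distrib)
      qed
      obtain m where m: "\<omega> \<in> A m" using A(3) by blast
      have "\<forall>\<^sub>F n in sequentially. F n \<omega> = h n \<omega>"
        using eventually_ge_at_top[of m]
        by eventually_elim (use m A(2) in \<open>auto simp: h_def incseq_def indicator_def\<close>)
      then show "(\<lambda>n. h n \<omega>) \<longlonglongrightarrow> f \<omega>"
        using F(2)[of \<omega>] by (rule Lim_transform_eventually[rotated])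
    qed (rule h)
  qed
qed

section \<open>Cylinder sets\<close>


text \<open>
  Continuity of \<open>\<psi>\<close> is responsible for strong continuity and separability, and properness for the
  vanishing of coefficients at infinity.
\<close>

locale proper_gaussian_increments = gaussian_increments P \<psi>
  for P :: "('g::{topological_group_add, t2_space, second_countable_topology} \<Rightarrow> real) measure" and \<psi> +
  assumes continuous_\<psi>: "continuous_on UNIV \<psi>"
    and proper_\<psi>: "filterlim \<psi> at_top cocompact"
begin

text \<open>
  The constraints are a finite set of triples, so that an intersection of cylinders is given by the
  union of the constraints. Rational bounds generate the same \<open>\<sigma>\<close>-algebra and make the
  constraints over a countable set of group elements countable in number.
\<close>

definition cyl :: "('g \<times> rat \<times> rat) set \<Rightarrow> (nat \<Rightarrow> 'g \<Rightarrow> real) set" where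
  "cyl F = {x. \<forall>(g, p, q)\<in>F. of_rat p \<le> x 0 g \<and> x 0 g \<le> of_rat q}"

text \<open>
  One constraint at least is required: it bounds the measure of the set by the length of an
  interval.
\<close>

definition cylinders :: "(nat \<Rightarrow> 'g \<Rightarrow> real) set set" where
  "cylinders = {cyl F |F. finite F \<and> F \<noteq> {}}"

lemma Int_stable_cylinders: "Int_stable cylinders"
proof (rule Int_stableI)
  fix B C assume "B \<in> cylinders" "C \<in> cylinders"
  then obtain F G where F: "finite F" "F \<noteq> {}" "B = cyl F" and G: "finite G" "C = cyl G"
    unfolding cylinders_def by blast
  have "B \<inter> C = cyl (F \<union> G)" unfolding F(3) G(2) cyl_def by blast
  then show "B \<inter> C \<in> cylinders" unfolding cylinders_def using F(1,2) G(1) by blast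
qed

lemma cyl_sets: "finite F \<Longrightarrow> cyl F \<in> sets path_space"
proof -
  assume F: "finite F"
  have "cyl F = UNIV \<inter> (\<Inter>(g, p, q)\<in>F. {x. of_rat p \<le> x 0 g \<and> x 0 g \<le> of_rat q})"
    by (auto simp: cyl_def)
  also have "\<dots> \<in> sets path_space"
  proof (cases "F = {}")
    case True
    then show ?thesis using sets.top[of path_space] by simp
  next
    case False
    then show ?thesis
      using F sets.top[of path_space]
      by (intro sets.Int sets.finite_INT) (auto intro: interval_sets)
  qed
  finally show ?thesis .
qed

lemma cylinders_sets: "B \<in> cylinders \<Longrightarrow> B \<in> sets path_measure"
  unfolding cylinders_def sets_path_measure using cyl_sets by blast

lemma emeasure_cylinders:
  assumes "B \<in> cylinders"
  shows "emeasure path_measure B < \<infinity>"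
proof -
  obtain F g p q where F: "finite F" "(g, p, q) \<in> F" "B = cyl F"
    using assms unfolding cylinders_def by fast
  have "emeasure path_measure B \<le> emeasure path_measure {x. of_rat p \<le> x 0 g \<and> x 0 g \<le> max (of_rat p) (of_rat q)}"
    using F by (intro emeasure_mono) (auto simp: cyl_def sets_path_measure interval_sets)
  also have "\<dots> < \<infinity>"
    by (subst emeasure_interval) simp_all
  finally show ?thesis .
qed

definition exhaustion :: "nat \<Rightarrow> (nat \<Rightarrow> 'g \<Rightarrow> real) set" where
  "exhaustion n = cyl {(0, - of_nat n, of_nat n)}"

lemma exhaustion_eq: "exhaustion n = {x. - real n \<le> x 0 0 \<and> x 0 0 \<le> real n}"
  by (simp add: exhaustion_def cyl_def of_rat_minus)

lemma exhaustion_cylinders: "exhaustion n \<in> cylinders"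
  unfolding exhaustion_def cylinders_def by blast

lemma incseq_exhaustion: "incseq exhaustion"
  by (fastforce simp: incseq_def exhaustion_eq)

lemma UN_exhaustion: "(\<Union>n. exhaustion n) = UNIV"
proof -
  have "\<exists>n. - real n \<le> y \<and> y \<le> real n" for y
    using real_arch_simple[of "\<bar>y\<bar>"] by (metis abs_le_iff minus_le_iff)
  then show ?thesis by (auto simp: exhaustion_eq)
qed

text \<open>
  For the inclusion from left to right the coordinates have to be measurable for the
  \<open>\<sigma>\<close>-algebra generated by the cylinders; the set where a coordinate exceeds \<open>r\<close> is a
  countable union of cylinders with a single constraint.
\<close>

lemma sets_path_space_cylinders: "sets path_space = sigma_sets UNIV cylinders"
proof
  show "sigma_sets UNIV cylinders \<subseteq> sets path_space"
    using sets.sigma_sets_subset[of cylinders path_space] cylinders_sets by (auto simp: sets_path_measure)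
  let ?N = "sigma UNIV cylinders"
  have sN: "sets ?N = sigma_sets UNIV cylinders" by (rule sets_measure_of) simp
  have "(\<lambda>x. x) \<in> measurable ?N path_space"
  proof (rule measurable_path_space)
    fix g :: 'g
    show "(\<lambda>x. x 0 g) \<in> borel_measurable ?N"
      unfolding borel_measurable_iff_greater
    proof
      fix r :: real
      let ?Q = "{pq :: rat \<times> rat. r < of_rat (fst pq)}"
      have "x \<in> (\<Union>pq\<in>?Q. cyl {(g, fst pq, snd pq)})" if r: "r < x 0 g" for x :: "nat \<Rightarrow> 'g \<Rightarrow> real"
      proof -
        obtain p where p: "r < of_rat p" "of_rat p < x 0 g" using of_rat_dense[OF r] by blast
        obtain q where "x 0 g < of_rat q" using of_rat_dense[of "x 0 g" "x 0 g + 1"] by auto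
        with p show ?thesis by (intro UN_I[of "(p, q)"]) (auto simp: cyl_def)
      qed
      then have eq: "{x \<in> space ?N. r < x 0 g} = (\<Union>pq\<in>?Q. cyl {(g, fst pq, snd pq)})"
        by (auto simp: space_measure_of_conv cyl_def)
      have "cyl {(g, p, q)} \<in> cylinders" for p q
        unfolding cylinders_def by blast
      then have "cyl {(g, p, q)} \<in> sets ?N" for p q
        by (simp add: sN sigma_sets.Basic)
      then show "{x \<in> space ?N. r < x 0 g} \<in> sets ?N"
        unfolding eq by (intro sets.countable_UN') auto
    qed
  qed
  show "sets path_space \<subseteq> sigma_sets UNIV cylinders"
  proof
    fix S assume S: "S \<in> sets (path_space :: (nat \<Rightarrow> 'g \<Rightarrow> real) measure)"
    have "(\<lambda>x. x) -` S \<inter> space ?N \<in> sets ?N"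
      using measurable_sets[OF \<open>(\<lambda>x. x) \<in> measurable ?N path_space\<close> S] .
    then show "S \<in> sigma_sets UNIV cylinders" by (simp add: sN space_measure_of_conv)
  qed
qed

sublocale M: sigma_finite_measure path_measure
proof
  show "\<exists>A. countable A \<and> A \<subseteq> sets path_measure \<and> \<Union> A = space path_measure \<and> (\<forall>a\<in>A. emeasure path_measure a \<noteq> \<infinity>)"
    using exhaustion_cylinders cylinders_sets emeasure_cylinders UN_exhaustion
    by (intro exI[of _ "range exhaustion"]) (auto simp: space_path_measure less_top)
qed

lemma L2_path_induct [consumes 1, case_names base lincomb limit]:
  assumes f: "f \<in> L2 path_measure"
    and base: "\<And>B. B \<in> cylinders \<Longrightarrow> Q (indicator B)"
    and lincomb: "\<And>f h c. f \<in> L2 path_measure \<Longrightarrow> h \<in> L2 path_measure \<Longrightarrow> Q f \<Longrightarrow> Q h \<Longrightarrow>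
      Q (\<lambda>\<omega>. f \<omega> + c * h \<omega>)"
    and limit: "\<And>f. f \<in> L2 path_measure \<Longrightarrow>
      (\<And>\<epsilon>. \<epsilon> > 0 \<Longrightarrow> \<exists>h\<in>L2 path_measure. Q h \<and> L2_norm path_measure (\<lambda>\<omega>. f \<omega> - h \<omega>) < \<epsilon>) \<Longrightarrow> Q f"
  shows "Q f"
proof (rule L2_induct[OF f space_path_measure Int_stable_cylinders _ emeasure_cylinders _ incseq_exhaustion
      UN_exhaustion base lincomb limit])
  show "sets path_measure = sigma_sets UNIV cylinders"
    by (simp add: sets_path_measure sets_path_space_cylinders)
  show "range exhaustion \<subseteq> cylinders" using exhaustion_cylinders by blast
qed

end

section \<open>The permutation representation\<close>


context proper_gaussian_increments
begin

abbreviation "rep \<equiv> permutation_rep shift"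

lemma shift_0: "shift 0 x = x"
  by (simp add: shift_def fun_eq_iff)

lemma shift_add: "shift (g + h) x = shift g (shift h x)"
  by (intro ext) (simp only: shift_def minus_add add.assoc)

lemma shift_minus_cancel: "shift (- g) (shift g x) = x" "shift g (shift (- g) x) = x"
  by (simp_all add: shift_add[symmetric] shift_0)

lemma rep_apply: "rep g f x = f (shift (- g) x)"
  by (simp add: permutation_rep_def)

lemma measurable_rep: "f \<in> borel_measurable path_measure \<Longrightarrow> rep g f \<in> borel_measurable path_measure"
  unfolding permutation_rep_def by (rule measurable_compose[OF shift_measurable])

lemma integral_shift:
  fixes f :: "_ \<Rightarrow> 'b::{banach, second_countable_topology}"
  assumes "f \<in> borel_measurable path_measure"
  shows "(LINT x|path_measure. f (shift h x)) = (LINT x|path_measure. f x)"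
  using integral_distr[OF shift_measurable[of h] assms] by (simp add: distr_shift)

lemma integrable_shift:
  fixes f :: "_ \<Rightarrow> 'b::{banach, second_countable_topology}"
  assumes "integrable path_measure f"
  shows "integrable path_measure (\<lambda>x. f (shift h x))"
  using integrable_distr[OF shift_measurable[of h], of f] assms by (simp add: distr_shift)

lemma rep_L2:
  assumes "f \<in> L2 path_measure"
  shows "rep g f \<in> L2 path_measure"
  using measurable_rep[OF L2_measurable[OF assms]] integrable_shift[OF L2_integrable[OF assms], of "- g"]
  by (simp add: L2_def rep_apply)

lemma rep_inner:
  assumes "f \<in> L2 path_measure" "h \<in> L2 path_measure"
  shows "L2_inner path_measure (rep g f) (rep g h) = L2_inner path_measure f h"
  using integral_shift[of "\<lambda>x. f x * cnj (h x)" "- g"] L2_inner_integrable[OF assms]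
  by (simp add: L2_inner_def rep_apply borel_measurable_integrable)

lemma rep_norm:
  assumes "f \<in> L2 path_measure"
  shows "L2_norm path_measure (rep g f) = L2_norm path_measure f"
  using integral_shift[of "\<lambda>x. (cmod (f x))\<^sup>2" "- g"] L2_integrable[OF assms]
  by (simp add: L2_norm_def rep_apply borel_measurable_integrable)

lemma rep_diff: "rep g (\<lambda>x. f x - h x) = (\<lambda>x. rep g f x - rep g h x)"
  by (simp add: permutation_rep_def)

text \<open>
  Translating both functions by \<open>- h\<close> reduces continuity at any point of the group to continuity
  at \<open>0\<close>.
\<close>

lemma rep_norm_diff:
  assumes f: "f \<in> L2 path_measure"
  shows "L2_norm path_measure (\<lambda>x. rep g f x - rep h f x) = L2_norm path_measure (\<lambda>x. rep (- h + g) f x - f x)"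
proof -
  have L: "(\<lambda>x. rep g f x - rep h f x) \<in> L2 path_measure"
    by (intro L2_diff rep_L2 f)
  have "rep (- h) (\<lambda>x. rep g f x - rep h f x) = (\<lambda>x. rep (- h + g) f x - f x)"
    by (intro ext) (simp only: rep_apply minus_add shift_add minus_minus shift_minus_cancel)
  then show ?thesis using rep_norm[OF L, of "- h"] by simp
qed

definition moved :: "('g \<Rightarrow> 'g) \<Rightarrow> ('g \<times> rat \<times> rat) set \<Rightarrow> ('g \<times> rat \<times> rat) set" where
  "moved \<tau> F = (\<lambda>(g, p, q). (\<tau> g, p, q)) ` F"

lemma moved_cylinders: "finite F \<Longrightarrow> F \<noteq> {} \<Longrightarrow> cyl (moved \<tau> F) \<in> cylinders"
  unfolding cylinders_def moved_def by blast

lemma rep_cyl: "rep h (indicator (cyl F)) = indicator (cyl (moved (\<lambda>g. h + g) F))"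
  by (auto simp: fun_eq_iff rep_apply indicator_def cyl_def moved_def shift_def split: prod.splits)

text \<open>
  A path in one cylinder but not in the other leaves the interval of at least one constraint when the
  group element \<open>g\<close> of this constraint is replaced by \<open>\<tau> g\<close>.
\<close>

lemma emeasure_cyl_moved:
  assumes F: "finite F"
  shows "emeasure path_measure (cyl F - cyl (moved \<tau> F)) \<le> ennreal (\<Sum>x\<in>F. sqrt (\<psi> (- \<tau> (fst x) + fst x)))" (is ?A)
    and "emeasure path_measure (cyl (moved \<tau> F) - cyl F) \<le> ennreal (\<Sum>x\<in>F. sqrt (\<psi> (- \<tau> (fst x) + fst x)))" (is ?B)
proof -
  let ?in = "\<lambda>g (p, q). {x :: nat \<Rightarrow> 'g \<Rightarrow> real. of_rat p \<le> x 0 g \<and> x 0 g \<le> of_rat q}"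
  let ?S = "\<lambda>g h (p, q). {x :: nat \<Rightarrow> 'g \<Rightarrow> real. (of_rat p \<le> x 0 g \<and> x 0 g \<le> of_rat q) \<and> \<not> (of_rat p \<le> x 0 h \<and> x 0 h \<le> of_rat q)}"
  have S_sets: "?S g h pq \<in> sets path_measure" for g h pq
  proof -
    have "?S g h pq = ?in g pq - ?in h pq" by auto
    also have "\<dots> \<in> sets path_measure"
      unfolding sets_path_measure case_prod_beta by (intro sets.Diff interval_sets)
    finally show ?thesis .
  qed
  have S_le: "emeasure path_measure (?S g h pq) \<le> ennreal (sqrt (\<psi> (- h + g)))" for g h pq
    using emeasure_interval_leave by (cases pq) simp
  have "emeasure path_measure (cyl F - cyl (moved \<tau> F)) \<le> emeasure path_measure (\<Union>x\<in>F. ?S (fst x) (\<tau> (fst x)) (snd x))"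
    using F S_sets by (intro emeasure_mono sets.finite_UN) (fastforce simp: cyl_def moved_def)+
  also have "\<dots> \<le> (\<Sum>x\<in>F. emeasure path_measure (?S (fst x) (\<tau> (fst x)) (snd x)))"
    using F S_sets by (intro emeasure_subadditive_finite) auto
  also have "\<dots> \<le> (\<Sum>x\<in>F. ennreal (sqrt (\<psi> (- \<tau> (fst x) + fst x))))"
    by (intro sum_mono S_le)
  also have "\<dots> = ennreal (\<Sum>x\<in>F. sqrt (\<psi> (- \<tau> (fst x) + fst x)))"
    by (rule sum_ennreal) (simp add: \<psi>_nonneg)
  finally show ?A .
  have sym: "\<psi> (- fst x + \<tau> (fst x)) = \<psi> (- \<tau> (fst x) + fst x)" for x :: "'g \<times> rat \<times> rat"
    using \<psi>_uminus[of "- fst x + \<tau> (fst x)"] by (simp add: minus_add)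
  have "emeasure path_measure (cyl (moved \<tau> F) - cyl F) \<le> emeasure path_measure (\<Union>x\<in>F. ?S (\<tau> (fst x)) (fst x) (snd x))"
    using F S_sets by (intro emeasure_mono sets.finite_UN) (fastforce simp: cyl_def moved_def)+
  also have "\<dots> \<le> (\<Sum>x\<in>F. emeasure path_measure (?S (\<tau> (fst x)) (fst x) (snd x)))"
    using F S_sets by (intro emeasure_subadditive_finite) auto
  also have "\<dots> \<le> (\<Sum>x\<in>F. ennreal (sqrt (\<psi> (- fst x + \<tau> (fst x)))))"
    by (intro sum_mono S_le)
  also have "\<dots> = ennreal (\<Sum>x\<in>F. sqrt (\<psi> (- \<tau> (fst x) + fst x)))"
    unfolding sym by (rule sum_ennreal) (simp add: \<psi>_nonneg)
  finally show ?B .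
qed

text \<open>
  This single estimate yields both the strong continuity of the representation, with left
  translations for \<open>\<tau>\<close>, and the separability of the space, where \<open>\<tau>\<close> moves group elements into a
  countable dense set.
\<close>

lemma L2_norm_cyl_moved:
  assumes F: "finite F" "F \<noteq> {}"
  shows "(L2_norm path_measure (\<lambda>x. indicator (cyl (moved \<tau> F)) x - indicator (cyl F) x))\<^sup>2
    \<le> 2 * (\<Sum>x\<in>F. sqrt (\<psi> (- \<tau> (fst x) + fst x)))"
proof -
  let ?A = "cyl (moved \<tau> F)" and ?B = "cyl F" and ?s = "\<Sum>x\<in>F. sqrt (\<psi> (- \<tau> (fst x) + fst x))"
  have s: "0 \<le> ?s" by (intro sum_nonneg) (simp add: \<psi>_nonneg)
  have A: "?A \<in> cylinders" using F by (rule moved_cylinders)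
  have B: "?B \<in> cylinders" using F unfolding cylinders_def by blast
  have int: "integrable path_measure (indicator (C - D) :: _ \<Rightarrow> real)" if "C \<in> cylinders" "D \<in> cylinders" for C D
  proof -
    have "emeasure path_measure (C - D) \<le> emeasure path_measure C"
      using cylinders_sets[OF that(1)] by (intro emeasure_mono) auto
    then show ?thesis
      using cylinders_sets[OF that(1)] cylinders_sets[OF that(2)] emeasure_cylinders[OF that(1)]
      by (intro integrable_real_indicator) (auto intro: le_less_trans)
  qed
  have "(cmod (indicator ?A x - indicator ?B x))\<^sup>2 = indicator (?A - ?B) x + indicator (?B - ?A) x" for x
    by (auto simp: indicator_def)
  then have "(L2_norm path_measure (\<lambda>x. indicator ?A x - indicator ?B x))\<^sup>2 =
      (LINT x|path_measure. indicator (?A - ?B) x + indicator (?B - ?A) x)"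
    by (simp add: L2_norm_power2)
  also have "\<dots> = measure path_measure (?A - ?B) + measure path_measure (?B - ?A)"
    using int[OF A B] int[OF B A] by (simp add: space_path_measure)
  also have "\<dots> \<le> ?s + ?s"
    using emeasure_cyl_moved[OF F(1), of \<tau>] s
    by (intro add_mono) (simp_all add: measure_def enn2real_leI)
  finally show ?thesis by simp
qed

lemma rep_continuous_at_0:
  assumes "f \<in> L2 path_measure"
  shows "((\<lambda>h. L2_norm path_measure (\<lambda>x. rep h f x - f x)) \<longlongrightarrow> 0) (nhds 0)"
  using assms
proof (induction rule: L2_path_induct)
  case (base B)
  then obtain F where F: "finite F" "F \<noteq> {}" "B = cyl F" unfolding cylinders_def by blast
  let ?s = "\<lambda>h. 2 * (\<Sum>x\<in>F. sqrt (\<psi> (- (h + fst x) + fst x)))"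
  have "((\<lambda>h. \<psi> (- (h + g) + g)) \<longlongrightarrow> \<psi> (- (0 + g) + g)) (nhds 0)" for g
  proof -
    have "isCont \<psi> (- (0 + g) + g)"
      using continuous_\<psi> by (simp add: continuous_on_eq_continuous_at)
    moreover have "((\<lambda>h. - (h + g) + g) \<longlongrightarrow> - (0 + g) + g) (nhds 0)"
      by (intro tendsto_intros filterlim_ident)
    ultimately show ?thesis by (rule isCont_tendsto_compose)
  qed
  then have "(?s \<longlongrightarrow> 2 * (\<Sum>x\<in>F. sqrt (\<psi> (- (0 + fst x) + fst x)))) (nhds 0)"
    by (intro tendsto_intros)
  then have s: "((\<lambda>h. sqrt (?s h)) \<longlongrightarrow> sqrt 0) (nhds 0)"
    by (intro tendsto_real_sqrt) (simp add: \<psi>_0)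
  have le: "L2_norm path_measure (\<lambda>x. rep h (indicator B) x - indicator B x) \<le> sqrt (?s h)" for h
    unfolding F(3) rep_cyl by (intro real_le_rsqrt L2_norm_cyl_moved F)
  show ?case
    by (rule tendsto_sandwich[OF _ _ tendsto_const s[simplified]])
       (use le in \<open>auto intro!: always_eventually simp: L2_norm_nonneg\<close>)
next
  case (lincomb f k c)
  let ?n = "\<lambda>f h. L2_norm path_measure (\<lambda>x. rep h f x - f x)"
  have le: "?n (\<lambda>x. f x + c * k x) h \<le> ?n f h + cmod c * ?n k h" for h
  proof -
    have "(\<lambda>x. rep h (\<lambda>x. f x + c * k x) x - (f x + c * k x)) = (\<lambda>x. (rep h f x - f x) + c * (rep h k x - k x))"
      by (simp add: fun_eq_iff rep_apply algebra_simps)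
    then show ?thesis
      using L2_norm_triangle[OF L2_diff[OF rep_L2[OF lincomb(1)] lincomb(1)] L2_scale[OF L2_diff[OF rep_L2[OF lincomb(2)] lincomb(2)]], of h c h]
      by (simp add: L2_norm_scale)
  qed
  have lim: "((\<lambda>h. ?n f h + cmod c * ?n k h) \<longlongrightarrow> 0 + cmod c * 0) (nhds 0)"
    by (intro tendsto_intros lincomb.IH)
  show ?case
    by (rule tendsto_sandwich[OF _ _ tendsto_const lim[simplified]])
       (use le in \<open>auto intro!: always_eventually simp: L2_norm_nonneg\<close>)
next
  case (limit f)
  show ?case
  proof (rule tendstoI)
    fix e :: real assume "0 < e"
    then obtain k where k: "k \<in> L2 path_measure"
      "((\<lambda>h. L2_norm path_measure (\<lambda>x. rep h k x - k x)) \<longlongrightarrow> 0) (nhds 0)"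
      "L2_norm path_measure (\<lambda>x. f x - k x) < e / 3"
      using limit(2)[of "e / 3"] by auto
    have "\<forall>\<^sub>F h in nhds 0. L2_norm path_measure (\<lambda>x. rep h k x - k x) < e / 3"
      using k(2) \<open>0 < e\<close> by (intro order_tendstoD(2)) auto
    then show "\<forall>\<^sub>F h in nhds 0. dist (L2_norm path_measure (\<lambda>x. rep h f x - f x)) 0 < e"
    proof eventually_elim
      case (elim h)
      have "L2_norm path_measure (\<lambda>x. rep h f x - f x) \<le>
        L2_norm path_measure (\<lambda>x. rep h f x - rep h k x) + L2_norm path_measure (\<lambda>x. rep h k x - f x)"
        by (intro L2_norm_triangle_diff rep_L2 limit k)
      moreover have "L2_norm path_measure (\<lambda>x. rep h k x - f x) \<le>
        L2_norm path_measure (\<lambda>x. rep h k x - k x) + L2_norm path_measure (\<lambda>x. k x - f x)"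
        by (intro L2_norm_triangle_diff rep_L2 limit k)
      moreover have "L2_norm path_measure (\<lambda>x. rep h f x - rep h k x) = L2_norm path_measure (\<lambda>x. f x - k x)"
        using rep_norm[OF L2_diff[OF limit(1) k(1)], of h] by (simp add: rep_diff)
      moreover have "L2_norm path_measure (\<lambda>x. k x - f x) = L2_norm path_measure (\<lambda>x. f x - k x)"
        by (rule L2_norm_minus_commute)
      ultimately show ?case using elim k(3) by (simp add: L2_norm_nonneg)
    qed
  qed
qed

lemma rep_continuous:
  assumes f: "f \<in> L2 path_measure"
  shows "((\<lambda>h. L2_norm path_measure (\<lambda>x. rep h f x - rep g f x)) \<longlongrightarrow> 0) (nhds g)"
proof -
  have "filterlim (\<lambda>h. - g + h) (nhds (- g + g)) (nhds g)"
    by (intro tendsto_intros filterlim_ident)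
  then have "filterlim (\<lambda>h. - g + h) (nhds 0) (nhds g)" by simp
  from filterlim_compose[OF rep_continuous_at_0[OF f] this]
  show ?thesis by (simp add: rep_norm_diff[OF f])
qed

theorem unitary_rep: "unitary_representation_L2 path_measure rep"
  unfolding unitary_representation_L2_def
proof (intro conjI ballI allI)
  fix f assume f: "f \<in> L2 path_measure"
  show "rep g f \<in> L2 path_measure" for g by (rule rep_L2[OF f])
  show "AE \<omega> in path_measure. rep 0 f \<omega> = f \<omega>" by (simp add: rep_apply shift_0)
  show "AE \<omega> in path_measure. rep (g + h) f \<omega> = rep g (rep h f) \<omega>" for g h
    by (simp only: rep_apply minus_add shift_add) simp
  show "((\<lambda>h. L2_norm path_measure (\<lambda>\<omega>. rep h f \<omega> - rep g f \<omega>)) \<longlongrightarrow> 0) (at g)" for g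
    by (rule tendsto_mono[OF _ rep_continuous[OF f]]) (simp add: at_within_def)
  fix h assume h: "h \<in> L2 path_measure"
  show "AE \<omega> in path_measure. rep g (\<lambda>\<omega>. c * f \<omega> + d * h \<omega>) \<omega> = c * rep g f \<omega> + d * rep g h \<omega>" for g c d
    by (simp add: rep_apply)
  show "L2_inner path_measure (rep g f) (rep g h) = L2_inner path_measure f h" for g
    by (rule rep_inner[OF f h])
qed

end

section \<open>Coefficients at infinity\<close>


lemma filterlim_translate_cocompact:
  fixes g h :: "'g::{topological_group_add, t2_space}"
  shows "filterlim (\<lambda>k. h + (k + g)) cocompact cocompact"
  unfolding filterlim_iff
proof (intro allI impI)
  fix P :: "'g \<Rightarrow> bool" assume "eventually P cocompact"
  then obtain K where K: "compact K" "\<And>x. x \<notin> K \<Longrightarrow> P x" by (auto simp: eventually_cocompact)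
  have "compact ((\<lambda>k. - h + k + - g) ` K)"
    using K(1) by (intro compact_continuous_image continuous_intros)
  moreover have "P (h + (k + g))" if "k \<notin> (\<lambda>k. - h + k + - g) ` K" for k
  proof (rule K(2))
    show "h + (k + g) \<notin> K"
    proof
      assume "h + (k + g) \<in> K"
      moreover have "k = - h + (h + (k + g)) + - g" by (simp add: add.assoc)
      ultimately show False using that by blast
    qed
  qed
  ultimately show "\<forall>\<^sub>F k in cocompact. P (h + (k + g))"
    unfolding eventually_cocompact by blast
qed

lemma L2_inner_lincomb_left:
  assumes "f \<in> L2 M" "h \<in> L2 M" "k \<in> L2 M"
  shows "L2_inner M (\<lambda>\<omega>. f \<omega> + c * h \<omega>) k = L2_inner M f k + c * L2_inner M h k"
  using L2_inner_integrable[OF assms(1,3)] L2_inner_integrable[OF assms(2,3)]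
  by (simp add: L2_inner_def distrib_right mult.assoc)

lemma L2_inner_lincomb_right:
  assumes "f \<in> L2 M" "h \<in> L2 M" "k \<in> L2 M"
  shows "L2_inner M k (\<lambda>\<omega>. f \<omega> + c * h \<omega>) = L2_inner M k f + cnj c * L2_inner M k h"
proof -
  have "L2_inner M k (\<lambda>\<omega>. f \<omega> + c * h \<omega>) = (LINT \<omega>|M. k \<omega> * cnj (f \<omega>) + cnj c * (k \<omega> * cnj (h \<omega>)))"
    unfolding L2_inner_def by (rule Bochner_Integration.integral_cong) (simp_all add: algebra_simps)
  then show ?thesis
    using L2_inner_integrable[OF assms(3,1)] L2_inner_integrable[OF assms(3,2)] by (simp add: L2_inner_def)
qed

lemma L2_inner_diff_left_le:
  assumes "f \<in> L2 M" "h \<in> L2 M" "k \<in> L2 M"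
  shows "cmod (L2_inner M f k - L2_inner M h k) \<le> L2_norm M (\<lambda>\<omega>. f \<omega> - h \<omega>) * L2_norm M k"
  using L2_Cauchy_Schwarz[OF L2_diff[OF assms(1,2)] assms(3)] L2_inner_lincomb_left[OF assms, of "-1"] by simp

lemma L2_inner_diff_right_le:
  assumes "f \<in> L2 M" "h \<in> L2 M" "k \<in> L2 M"
  shows "cmod (L2_inner M k f - L2_inner M k h) \<le> L2_norm M k * L2_norm M (\<lambda>\<omega>. f \<omega> - h \<omega>)"
  using L2_Cauchy_Schwarz[OF assms(3) L2_diff[OF assms(1,2)]] L2_inner_lincomb_right[OF assms, of "-1"] by simp

lemma tendsto_0_approx:
  fixes f :: "'a \<Rightarrow> complex"
  assumes "\<And>\<epsilon>. \<epsilon> > 0 \<Longrightarrow> \<exists>h. (h \<longlongrightarrow> 0) F \<and> (\<forall>x. cmod (f x - h x) \<le> \<epsilon>)"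
  shows "(f \<longlongrightarrow> 0) F"
proof (rule tendstoI)
  fix e :: real assume e: "0 < e"
  then obtain h where h: "(h \<longlongrightarrow> 0) F" "\<And>x. cmod (f x - h x) \<le> e / 2" using assms[of "e / 2"] by auto
  have "\<forall>\<^sub>F x in F. dist (h x) 0 < e / 2" using tendstoD[OF h(1), of "e / 2"] e by simp
  then show "\<forall>\<^sub>F x in F. dist (f x) 0 < e"
  proof eventually_elim
    case (elim x)
    have "cmod (f x) \<le> cmod (f x - h x) + cmod (h x)" using norm_triangle_ineq[of "f x - h x" "h x"] by simp
    then show ?case using elim h(2)[of x] by simp
  qed
qed

context proper_gaussian_increments
begin

text \<open>
  Pick one constraint from each cylinder. The coefficient is the measure of an intersection in which
  the coordinates at \<open>g + g0\<close> and \<open>h0\<close> are both bounded, and the variance of the increment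
  between them tends to infinity with \<open>g\<close>.
\<close>

lemma cylinders_coefficient_C0:
  assumes B: "B \<in> cylinders" and C: "C \<in> cylinders"
  shows "((\<lambda>g. L2_inner path_measure (rep g (indicator B)) (indicator C)) \<longlongrightarrow> 0) cocompact"
proof -
  obtain F g0 p q where F: "finite F" "(g0, p, q) \<in> F" "B = cyl F"
    using B unfolding cylinders_def by fast
  obtain G h0 r s where G: "finite G" "(h0, r, s) \<in> G" "C = cyl G"
    using C unfolding cylinders_def by fast
  define R :: real where "R = \<bar>of_rat p\<bar> + \<bar>of_rat q\<bar> + \<bar>of_rat r\<bar> + \<bar>of_rat s\<bar>"
  have R: "\<bar>of_rat p\<bar> \<le> R" "\<bar>of_rat q\<bar> \<le> R" "\<bar>of_rat r\<bar> \<le> R" "\<bar>of_rat s\<bar> \<le> R"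
    unfolding R_def by linarith+
  then have R0: "0 \<le> R" by linarith
  let ?bound = "\<lambda>g. 8 * R\<^sup>2 / sqrt (\<psi> (- h0 + (g + g0)))"
  have le: "cmod (L2_inner path_measure (rep g (indicator B)) (indicator C)) \<le> ?bound g"
    if pos: "0 < \<psi> (- h0 + (g + g0))" for g
  proof -
    let ?B = "cyl (moved (\<lambda>k. g + k) F)"
    have B': "?B \<in> sets path_measure" "C \<in> sets path_measure"
      using moved_cylinders F C by (auto intro: cylinders_sets)
    have "L2_inner path_measure (rep g (indicator B)) (indicator C) = (LINT x|path_measure. indicator (?B \<inter> C) x)"
      unfolding L2_inner_def F(3) rep_cyl by (rule Bochner_Integration.integral_cong) (auto simp: indicator_def)
    also have "\<dots> = complex_of_real (measure path_measure (?B \<inter> C))"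
    proof -
      have "(LINT x|path_measure. complex_of_real (indicator (?B \<inter> C) x)) = complex_of_real (LINT x|path_measure. indicator (?B \<inter> C) x)"
        by (rule integral_complex_of_real)
      then show ?thesis using B' by (simp add: of_real_indicator space_path_measure)
    qed
    also have "cmod \<dots> = measure path_measure (?B \<inter> C)" by simp
    also have "\<dots> \<le> ?bound g"
    proof -
      let ?S = "{x. (- R \<le> x 0 (g + g0) \<and> x 0 (g + g0) \<le> R) \<and> (- R \<le> x 0 h0 \<and> x 0 h0 \<le> R)}"
      have S: "?S = {x. - R \<le> x 0 (g + g0) \<and> x 0 (g + g0) \<le> R} \<inter> {x. - R \<le> x 0 h0 \<and> x 0 h0 \<le> R}" by auto
      have "?B \<inter> C \<subseteq> ?S"
      proof
        fix x assume x: "x \<in> ?B \<inter> C"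
        have "(g + g0, p, q) \<in> moved (\<lambda>k. g + k) F"
          unfolding moved_def using F(2) by (rule rev_image_eqI) simp
        then have "of_rat p \<le> x 0 (g + g0) \<and> x 0 (g + g0) \<le> of_rat q"
          using x unfolding cyl_def by blast
        moreover have "of_rat r \<le> x 0 h0 \<and> x 0 h0 \<le> of_rat s"
          using x G(2) unfolding G(3) cyl_def by blast
        ultimately show "x \<in> ?S" unfolding mem_Collect_eq using R by linarith
      qed
      moreover have "?S \<in> sets path_measure"
        unfolding S sets_path_measure by (intro sets.Int interval_sets)
      ultimately have "emeasure path_measure (?B \<inter> C) \<le> emeasure path_measure ?S"
        by (rule emeasure_mono)
      also have "\<dots> \<le> ennreal (?bound g)" by (rule emeasure_bounded_pair[OF R0 pos])
      finally show ?thesis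
        unfolding measure_def by (rule enn2real_leI[rotated]) (simp add: \<psi>_nonneg)
    qed
    finally show ?thesis .
  qed
  have psi: "filterlim (\<lambda>g. \<psi> (- h0 + (g + g0))) at_top cocompact"
    by (rule filterlim_compose[OF proper_\<psi> filterlim_translate_cocompact])
  have "filterlim (\<lambda>g. sqrt (\<psi> (- h0 + (g + g0)))) at_top cocompact"
    by (rule filterlim_compose[OF sqrt_at_top psi])
  then have lim: "(?bound \<longlongrightarrow> 0) cocompact"
    by (intro tendsto_divide_0[OF tendsto_const] filterlim_at_top_imp_at_infinity)
  have "\<forall>\<^sub>F g in cocompact. 0 < \<psi> (- h0 + (g + g0))"
    using psi by (simp add: filterlim_at_top_dense)
  then have "\<forall>\<^sub>F g in cocompact. cmod (L2_inner path_measure (rep g (indicator B)) (indicator C)) \<le> ?bound g"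
    by eventually_elim (rule le)
  then show ?thesis by (rule Lim_null_comparison[OF _ lim])
qed

lemma indicator_cylinders_L2: "B \<in> cylinders \<Longrightarrow> indicator B \<in> L2 path_measure"
  by (intro L2_indicator cylinders_sets emeasure_cylinders)

text \<open>
  The coefficient depends on two vectors, so the density argument is carried out once for each.
\<close>

lemma coefficient_vanishes_cylinder:
  assumes B: "B \<in> cylinders" and k: "k \<in> L2 path_measure"
  shows "((\<lambda>g. L2_inner path_measure (rep g (indicator B)) k) \<longlongrightarrow> 0) cocompact"
  using k
proof (induction rule: L2_path_induct)
  case (base C)
  then show ?case by (rule cylinders_coefficient_C0[OF B])
next
  case (lincomb f h c)
  have "((\<lambda>g. L2_inner path_measure (rep g (indicator B)) f + cnj c * L2_inner path_measure (rep g (indicator B)) h)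
      \<longlongrightarrow> 0 + cnj c * 0) cocompact"
    by (intro tendsto_intros lincomb.IH)
  then show ?case
    by (simp add: L2_inner_lincomb_right[OF lincomb(1,2) rep_L2[OF indicator_cylinders_L2[OF B]]])
next
  case (limit f)
  show ?case
  proof (rule tendsto_0_approx)
    fix \<epsilon> :: real assume \<epsilon>: "0 < \<epsilon>"
    let ?n = "L2_norm path_measure (indicator B)"
    have n: "0 \<le> ?n" by (rule L2_norm_nonneg)
    obtain h where h: "h \<in> L2 path_measure" "((\<lambda>g. L2_inner path_measure (rep g (indicator B)) h) \<longlongrightarrow> 0) cocompact"
      "L2_norm path_measure (\<lambda>x. f x - h x) < \<epsilon> / (?n + 1)"
      using limit(2)[of "\<epsilon> / (?n + 1)"] \<epsilon> n by auto
    have "cmod (L2_inner path_measure (rep g (indicator B)) f - L2_inner path_measure (rep g (indicator B)) h) \<le> \<epsilon>" for g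
    proof -
      have "cmod (L2_inner path_measure (rep g (indicator B)) f - L2_inner path_measure (rep g (indicator B)) h)
          \<le> ?n * L2_norm path_measure (\<lambda>x. f x - h x)"
        using L2_inner_diff_right_le[OF limit(1) h(1) rep_L2[OF indicator_cylinders_L2[OF B]], of g]
        by (simp add: rep_norm[OF indicator_cylinders_L2[OF B]])
      also have "\<dots> \<le> (?n + 1) * (\<epsilon> / (?n + 1))"
        using h(3) n by (intro mult_mono) (auto simp: L2_norm_nonneg)
      finally show ?thesis using n by simp
    qed
    then show "\<exists>h. (h \<longlongrightarrow> 0) cocompact \<and> (\<forall>g. cmod (L2_inner path_measure (rep g (indicator B)) f - h g) \<le> \<epsilon>)"
      using h(2) by blast
  qed
qed

lemma coefficient_vanishes:
  assumes "f \<in> L2 path_measure" and k: "k \<in> L2 path_measure"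
  shows "((\<lambda>g. L2_inner path_measure (rep g f) k) \<longlongrightarrow> 0) cocompact"
  using assms(1)
proof (induction rule: L2_path_induct)
  case (base B)
  then show ?case by (rule coefficient_vanishes_cylinder[OF _ k])
next
  case (lincomb f h c)
  have "((\<lambda>g. L2_inner path_measure (rep g f) k + c * L2_inner path_measure (rep g h) k)
      \<longlongrightarrow> 0 + c * 0) cocompact"
    by (intro tendsto_intros lincomb.IH)
  moreover have "rep g (\<lambda>x. f x + c * h x) = (\<lambda>x. rep g f x + c * rep g h x)" for g
    by (simp add: permutation_rep_def)
  ultimately show ?case
    by (simp add: L2_inner_lincomb_left[OF rep_L2[OF lincomb(1)] rep_L2[OF lincomb(2)] k])
next
  case (limit f)
  show ?case
  proof (rule tendsto_0_approx)
    fix \<epsilon> :: real assume \<epsilon>: "0 < \<epsilon>"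
    let ?n = "L2_norm path_measure k"
    have n: "0 \<le> ?n" by (rule L2_norm_nonneg)
    obtain h where h: "h \<in> L2 path_measure" "((\<lambda>g. L2_inner path_measure (rep g h) k) \<longlongrightarrow> 0) cocompact"
      "L2_norm path_measure (\<lambda>x. f x - h x) < \<epsilon> / (?n + 1)"
      using limit(2)[of "\<epsilon> / (?n + 1)"] \<epsilon> n by auto
    have "cmod (L2_inner path_measure (rep g f) k - L2_inner path_measure (rep g h) k) \<le> \<epsilon>" for g
    proof -
      have "cmod (L2_inner path_measure (rep g f) k - L2_inner path_measure (rep g h) k)
          \<le> L2_norm path_measure (\<lambda>x. f x - h x) * ?n"
        using L2_inner_diff_left_le[OF rep_L2[OF limit(1)] rep_L2[OF h(1)] k, of g g]
        by (simp add: rep_diff[symmetric] rep_norm[OF L2_diff[OF limit(1) h(1)]])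
      also have "\<dots> \<le> (\<epsilon> / (?n + 1)) * (?n + 1)"
        using h(3) n \<epsilon> by (intro mult_mono) (auto simp: L2_norm_nonneg)
      finally show ?thesis using n by simp
    qed
    then show "\<exists>h. (h \<longlongrightarrow> 0) cocompact \<and> (\<forall>g. cmod (L2_inner path_measure (rep g f) k - h g) \<le> \<epsilon>)"
      using h(2) by blast
  qed
qed

lemma coefficient_continuous:
  assumes f: "f \<in> L2 path_measure" and k: "k \<in> L2 path_measure"
  shows "continuous_on UNIV (\<lambda>g. L2_inner path_measure (rep g f) k)"
  unfolding continuous_on_eq_continuous_at[OF open_UNIV] isCont_def
proof
  fix g
  have "((\<lambda>h. L2_norm path_measure (\<lambda>x. rep h f x - rep g f x) * L2_norm path_measure k) \<longlongrightarrow> 0 * L2_norm path_measure k) (at g)"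
    using unitary_rep f unfolding unitary_representation_L2_def by (intro tendsto_intros) blast
  then have lim: "((\<lambda>h. L2_norm path_measure (\<lambda>x. rep h f x - rep g f x) * L2_norm path_measure k) \<longlongrightarrow> 0) (at g)"
    by simp
  have "\<forall>\<^sub>F h in at g. norm (L2_inner path_measure (rep h f) k - L2_inner path_measure (rep g f) k)
      \<le> L2_norm path_measure (\<lambda>x. rep h f x - rep g f x) * L2_norm path_measure k"
    by (intro always_eventually allI L2_inner_diff_left_le rep_L2 f k)
  from Lim_null_comparison[OF this lim]
  show "((\<lambda>h. L2_inner path_measure (rep h f) k) \<longlongrightarrow> L2_inner path_measure (rep g f) k) (at g)"
    by (rule LIM_zero_cancel)
qed

theorem C0_rep: "C0_representation_L2 path_measure rep"
  unfolding C0_representation_L2_def C0_function_def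
  by (intro conjI ballI unitary_rep coefficient_continuous coefficient_vanishes)

lemma dynamical_system_shift: "dynamical_system path_measure shift"
  unfolding dynamical_system_def
  by (intro conjI allI ballI shift_measurable shift_0 shift_add distr_shift)

text \<open>
  The measure of \<open>shift g ` A \<inter> B\<close> is the coefficient of the indicators of \<open>A\<close> and \<open>B\<close>.
\<close>

theorem C0_dynamical_system_shift: "C0_dynamical_system path_measure shift"
  unfolding C0_dynamical_system_def
proof (intro conjI ballI impI dynamical_system_shift)
  fix A B assume A: "A \<in> sets path_measure" "emeasure path_measure A < \<infinity>"
    and B: "B \<in> sets path_measure" "emeasure path_measure B < \<infinity>"
  have "Re (L2_inner path_measure (rep g (indicator A)) (indicator B)) = measure path_measure (shift g ` A \<inter> B)" for g
  proof -
    have mem: "shift (- g) x \<in> A \<longleftrightarrow> x \<in> shift g ` A" for x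
    proof
      assume "shift (- g) x \<in> A"
      then have "shift g (shift (- g) x) \<in> shift g ` A" by (rule imageI)
      then show "x \<in> shift g ` A" by (simp add: shift_minus_cancel)
    qed (auto simp: shift_minus_cancel)
    have sets: "shift g ` A \<in> sets path_measure"
    proof -
      have "shift (- g) -` A \<inter> space path_measure \<in> sets path_measure"
        by (rule measurable_sets[OF shift_measurable A(1)])
      moreover have "shift (- g) -` A \<inter> space path_measure = shift g ` A"
        using mem by (auto simp: space_path_measure)
      ultimately show ?thesis by simp
    qed
    have "L2_inner path_measure (rep g (indicator A)) (indicator B) =
        (LINT x|path_measure. complex_of_real (indicator (shift g ` A \<inter> B) x))"
      unfolding L2_inner_def rep_apply
      by (rule Bochner_Integration.integral_cong) (use mem in \<open>auto simp: indicator_def\<close>)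
    also have "\<dots> = complex_of_real (LINT x|path_measure. indicator (shift g ` A \<inter> B) x)"
      by (rule integral_complex_of_real)
    finally show ?thesis using sets B(1) by (simp add: space_path_measure)
  qed
  moreover have "((\<lambda>g. Re (L2_inner path_measure (rep g (indicator A)) (indicator B))) \<longlongrightarrow> Re 0) cocompact"
    by (intro tendsto_Re coefficient_vanishes L2_indicator A B)
  ultimately show "((\<lambda>g. measure path_measure (shift g ` A \<inter> B)) \<longlongrightarrow> 0) cocompact" by simp
qed

end

section \<open>Separability\<close>


lemma complex_rational_dense:
  assumes "0 < \<epsilon>"
  obtains c' where "Re c' \<in> \<rat>" "Im c' \<in> \<rat>" "cmod (c - c') < \<epsilon>"
proof -
  obtain a where a: "a \<in> \<rat>" "Re c < a" "a < Re c + \<epsilon> / 2"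
    using Rats_dense_in_real[of "Re c" "Re c + \<epsilon> / 2"] assms by auto
  obtain b where b: "b \<in> \<rat>" "Im c < b" "b < Im c + \<epsilon> / 2"
    using Rats_dense_in_real[of "Im c" "Im c + \<epsilon> / 2"] assms by auto
  have "cmod (c - Complex a b) \<le> \<bar>Re c - a\<bar> + \<bar>Im c - b\<bar>"
    using cmod_le[of "c - Complex a b"] by simp
  then show ?thesis using a b by (intro that[of "Complex a b"]) auto
qed

context proper_gaussian_increments
begin

text \<open>
  Step functions are presented by lists, not sets, of weighted cylinders, since a sum of two step
  functions may repeat a summand.
\<close>

definition cyl_step :: "(complex \<times> ('g \<times> rat \<times> rat) set) list \<Rightarrow> (nat \<Rightarrow> 'g \<Rightarrow> real) \<Rightarrow> complex" where
  "cyl_step xs x = (\<Sum>(c, F)\<leftarrow>xs. c * indicator (cyl F) x)"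

definition cyl_step_data :: "'g set \<Rightarrow> (complex \<times> ('g \<times> rat \<times> rat) set) set" where
  "cyl_step_data D = {c. Re c \<in> \<rat> \<and> Im c \<in> \<rat>} \<times> {F. finite F \<and> F \<noteq> {} \<and> fst ` F \<subseteq> D}"

lemma countable_step_data:
  assumes "countable D"
  shows "countable (cyl_step_data D)"
  unfolding cyl_step_data_def
proof (rule countable_SIGMA)
  have "{c. Re c \<in> \<rat> \<and> Im c \<in> \<rat>} \<subseteq> (\<lambda>(a, b). Complex a b) ` (\<rat> \<times> \<rat>)"
  proof
    fix c assume "c \<in> {c. Re c \<in> \<rat> \<and> Im c \<in> \<rat>}"
    then show "c \<in> (\<lambda>(a, b). Complex a b) ` (\<rat> \<times> \<rat>)"
      by (intro image_eqI[of _ _ "(Re c, Im c)"]) auto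
  qed
  moreover have "countable ((\<lambda>(a, b). Complex a b) ` (\<rat> \<times> \<rat>))"
    by (intro countable_image countable_SIGMA countable_rat)
  ultimately show "countable {c. Re c \<in> \<rat> \<and> Im c \<in> \<rat>}" by (rule countable_subset)
  have "countable {F. finite F \<and> F \<subseteq> D \<times> (UNIV :: (rat \<times> rat) set)}"
    using assms by (intro countable_Collect_finite_subset countable_SIGMA) auto
  then show "countable {F :: ('g \<times> rat \<times> rat) set. finite F \<and> F \<noteq> {} \<and> fst ` F \<subseteq> D}"
    by (rule countable_subset[rotated]) force
qed

lemma cyl_step_Cons: "cyl_step ((c, F) # xs) = (\<lambda>x. cyl_step xs x + c * indicator (cyl F) x)"
  by (simp add: cyl_step_def fun_eq_iff)

text \<open>
  Appending and scaling the presentations realises the combination \<open>f + d * h\<close>, which the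
  induction over square integrable functions requires.
\<close>

lemma cyl_step_append_scale: "cyl_step (xs @ map (\<lambda>(c, F). (d * c, F)) ys) = (\<lambda>x. cyl_step xs x + d * cyl_step ys x)"
proof -
  have "cyl_step (map (\<lambda>(c, F). (d * c, F)) ys) x = d * cyl_step ys x" for x
    by (induction ys) (auto simp: cyl_step_def algebra_simps)
  then show ?thesis by (simp add: cyl_step_def fun_eq_iff)
qed

lemma cyl_step_L2: "xs \<in> lists (cyl_step_data D) \<Longrightarrow> cyl_step xs \<in> L2 path_measure"
proof (induction xs)
  case Nil
  then show ?case using L2_zero[of path_measure] by (simp add: cyl_step_def[abs_def])
next
  case (Cons y xs)
  obtain c F where y: "y = (c, F)" by fastforce
  have "cyl F \<in> cylinders"
    using Cons.prems unfolding y cylinders_def cyl_step_data_def by auto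
  then show ?case
    unfolding y cyl_step_Cons using Cons by (intro L2_lincomb indicator_cylinders_L2) auto
qed

lemma cyl_step_dense:
  assumes D: "\<And>U. open U \<Longrightarrow> U \<noteq> {} \<Longrightarrow> \<exists>d\<in>D. d \<in> U"
    and "f \<in> L2 path_measure"
  shows "\<forall>\<epsilon>>0. \<exists>xs\<in>lists (cyl_step_data D). L2_norm path_measure (\<lambda>x. f x - cyl_step xs x) < \<epsilon>"
  using assms(2)
proof (induction rule: L2_path_induct)
  case (base B)
  then obtain F where F: "finite F" "F \<noteq> {}" "B = cyl F" unfolding cylinders_def by blast
  show ?case
  proof (intro allI impI)
    fix \<epsilon> :: real assume \<epsilon>: "0 < \<epsilon>"
    \<comment> \<open>Small enough for \<open>2 * card F * \<eta> < \<epsilon>\<^sup>2\<close>; the added \<open>1\<close> makes the inequality strict.\<close>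
    define \<eta> where "\<eta> = \<epsilon>\<^sup>2 / (2 * real (card F) + 1)"
    have \<eta>: "0 < \<eta>" using \<epsilon> by (simp add: \<eta>_def)
    have "\<exists>t\<in>D. sqrt (\<psi> (- t + g)) < \<eta>" for g
    proof -
      have "continuous_on UNIV (\<lambda>t. sqrt (\<psi> (- t + g)))"
        by (intro continuous_intros continuous_on_compose2[OF continuous_\<psi>]) auto
      then have "open {t. sqrt (\<psi> (- t + g)) < \<eta>}"
        by (intro open_Collect_less continuous_on_const)
      moreover have "g \<in> {t. sqrt (\<psi> (- t + g)) < \<eta>}" using \<eta> by (simp add: \<psi>_0)
      ultimately show ?thesis using D[of "{t. sqrt (\<psi> (- t + g)) < \<eta>}"] by blast
    qed
    then obtain \<tau> where \<tau>: "\<And>g. \<tau> g \<in> D" "\<And>g. sqrt (\<psi> (- \<tau> g + g)) < \<eta>" by metis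
    let ?G = "moved \<tau> F"
    have G: "finite ?G" "?G \<noteq> {}" "fst ` ?G \<subseteq> D"
      using F \<tau>(1) by (auto simp: moved_def)
    have "(L2_norm path_measure (\<lambda>x. indicator (cyl ?G) x - indicator (cyl F) x))\<^sup>2 \<le> 2 * (\<Sum>x\<in>F. sqrt (\<psi> (- \<tau> (fst x) + fst x)))"
      by (rule L2_norm_cyl_moved[OF F(1,2)])
    also have "\<dots> \<le> 2 * (\<Sum>x\<in>F. \<eta>)"
      using \<tau>(2) by (intro mult_left_mono sum_mono) (auto intro: less_imp_le)
    also have "\<dots> < (2 * real (card F) + 1) * \<eta>" using \<eta> by (simp add: algebra_simps)
    also have "\<dots> = \<epsilon>\<^sup>2" by (simp add: \<eta>_def)
    finally have "L2_norm path_measure (\<lambda>x. indicator (cyl ?G) x - indicator (cyl F) x) < \<epsilon>"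
      by (rule power2_less_imp_less) (use \<epsilon> in simp)
    moreover have "cyl_step [(1, ?G)] = indicator (cyl ?G)" by (simp add: cyl_step_def fun_eq_iff)
    moreover have "[(1, ?G)] \<in> lists (cyl_step_data D)" using G by (simp add: cyl_step_data_def)
    ultimately show "\<exists>xs\<in>lists (cyl_step_data D). L2_norm path_measure (\<lambda>x. indicator B x - cyl_step xs x) < \<epsilon>"
      unfolding F(3) by (intro bexI[of _ "[(1, ?G)]"]) (simp_all add: L2_norm_minus_commute)
  qed
next
  case (lincomb f h c)
  show ?case
  proof (intro allI impI)
    fix \<epsilon> :: real assume \<epsilon>: "0 < \<epsilon>"
    let ?n = "L2_norm path_measure"
    have n: "0 \<le> ?n h" by (rule L2_norm_nonneg)
    have third: "\<epsilon> / (3 * (N + 1)) * (N + 1) = \<epsilon> / 3" if "0 \<le> N" for N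
    proof -
      have "N + 1 \<noteq> 0" using that by linarith
      then show ?thesis by (simp only: times_divide_eq_left nonzero_mult_divide_mult_cancel_right not_False_eq_True)
    qed
    obtain xs where xs: "xs \<in> lists (cyl_step_data D)" "?n (\<lambda>x. f x - cyl_step xs x) < \<epsilon> / 3"
      using lincomb(3) \<epsilon> by (meson divide_pos_pos zero_less_numeral)
    \<comment> \<open>The coefficient \<open>c\<close> is replaced by a rational one before \<open>h\<close> is approximated, since the precision needed for \<open>h\<close> depends on it.\<close>
    obtain d where d: "Re d \<in> \<rat>" "Im d \<in> \<rat>" "cmod (c - d) < \<epsilon> / (3 * (?n h + 1))"
      using complex_rational_dense[of "\<epsilon> / (3 * (?n h + 1))" c] \<epsilon> n by auto
    have "0 < \<epsilon> / (3 * (cmod d + 1))" using \<epsilon> by (simp add: add_nonneg_pos)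
    then obtain ys where ys: "ys \<in> lists (cyl_step_data D)" "?n (\<lambda>x. h x - cyl_step ys x) < \<epsilon> / (3 * (cmod d + 1))"
      using lincomb(4) by blast
    let ?zs = "xs @ map (\<lambda>(c, F). (d * c, F)) ys"
    have "(d * e, F) \<in> cyl_step_data D" if "(e, F) \<in> cyl_step_data D" for e F
      using that d(1,2) by (simp add: cyl_step_data_def)
    then have zs: "?zs \<in> lists (cyl_step_data D)"
      using xs(1) ys(1) by (fastforce simp: in_lists_conv_set)
    have "?n (\<lambda>x. f x + c * h x - cyl_step ?zs x) = ?n (\<lambda>x. (f x - cyl_step xs x) + ((c - d) * h x + d * (h x - cyl_step ys x)))"
      unfolding cyl_step_append_scale by (simp add: algebra_simps)
    also have "\<dots> \<le> ?n (\<lambda>x. f x - cyl_step xs x) + ?n (\<lambda>x. (c - d) * h x + d * (h x - cyl_step ys x))"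
      using lincomb(1,2) cyl_step_L2[OF xs(1)] cyl_step_L2[OF ys(1)]
      by (intro L2_norm_triangle L2_diff L2_add L2_scale)
    finally have "?n (\<lambda>x. f x + c * h x - cyl_step ?zs x) \<le>
      ?n (\<lambda>x. f x - cyl_step xs x) + ?n (\<lambda>x. (c - d) * h x + d * (h x - cyl_step ys x))" .
    moreover have "?n (\<lambda>x. (c - d) * h x + d * (h x - cyl_step ys x)) \<le> ?n (\<lambda>x. (c - d) * h x) + ?n (\<lambda>x. d * (h x - cyl_step ys x))"
      using lincomb(2) cyl_step_L2[OF ys(1)]
      by (intro L2_norm_triangle L2_diff L2_scale)
    moreover have "?n (\<lambda>x. (c - d) * h x) \<le> \<epsilon> / 3"
    proof -
      have "?n (\<lambda>x. (c - d) * h x) \<le> \<epsilon> / (3 * (?n h + 1)) * (?n h + 1)"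
        unfolding L2_norm_scale using d(3) n \<epsilon> by (intro mult_mono) auto
      then show ?thesis unfolding third[OF n] .
    qed
    moreover have "?n (\<lambda>x. d * (h x - cyl_step ys x)) \<le> \<epsilon> / 3"
    proof -
      have "?n (\<lambda>x. d * (h x - cyl_step ys x)) \<le> \<epsilon> / (3 * (cmod d + 1)) * (cmod d + 1)"
        unfolding L2_norm_scale mult.commute[of "cmod d"] using ys(2) \<epsilon> by (intro mult_mono) (auto simp: L2_norm_nonneg)
      then show ?thesis unfolding third[OF norm_ge_zero] .
    qed
    ultimately have "?n (\<lambda>x. f x + c * h x - cyl_step ?zs x) < \<epsilon>" using xs(2) by linarith
    then show "\<exists>xs\<in>lists (cyl_step_data D). ?n (\<lambda>x. f x + c * h x - cyl_step xs x) < \<epsilon>"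
      using zs by blast
  qed
next
  case (limit f)
  show ?case
  proof (intro allI impI)
    fix \<epsilon> :: real assume "0 < \<epsilon>"
    then obtain h where h: "h \<in> L2 path_measure"
      "\<forall>\<epsilon>>0. \<exists>xs\<in>lists (cyl_step_data D). L2_norm path_measure (\<lambda>x. h x - cyl_step xs x) < \<epsilon>"
      "L2_norm path_measure (\<lambda>x. f x - h x) < \<epsilon> / 2"
      using limit(2)[of "\<epsilon> / 2"] by auto
    obtain xs where xs: "xs \<in> lists (cyl_step_data D)" "L2_norm path_measure (\<lambda>x. h x - cyl_step xs x) < \<epsilon> / 2"
      using h(2) \<open>0 < \<epsilon>\<close> by (meson half_gt_zero)
    have "L2_norm path_measure (\<lambda>x. f x - cyl_step xs x) < \<epsilon>"
      using L2_norm_triangle_diff[OF limit(1) h(1) cyl_step_L2[OF xs(1)]] h(3) xs(2) by simp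
    then show "\<exists>xs\<in>lists (cyl_step_data D). L2_norm path_measure (\<lambda>x. f x - cyl_step xs x) < \<epsilon>"
      using xs(1) by blast
  qed
qed

theorem separable_path_measure: "separable_L2 path_measure"
proof -
  obtain D :: "'g set" where D: "countable D" "\<And>U. open U \<Longrightarrow> U \<noteq> {} \<Longrightarrow> \<exists>d\<in>D. d \<in> U"
    using countable_dense_setE by blast
  show ?thesis
    unfolding separable_L2_def
  proof (intro exI[of _ "cyl_step ` lists (cyl_step_data D)"] conjI ballI)
    show "countable (cyl_step ` lists (cyl_step_data D))"
      using countable_step_data[OF D(1)] by (intro countable_image countable_lists)
    show "cyl_step ` lists (cyl_step_data D) \<subseteq> L2 path_measure" using cyl_step_L2 by blast
    fix f assume "f \<in> L2 path_measure"
    from cyl_step_dense[OF D(2) this]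
    show "\<forall>\<epsilon>>0. \<exists>d\<in>cyl_step ` lists (cyl_step_data D). L2_norm path_measure (\<lambda>\<omega>. f \<omega> - d \<omega>) < \<epsilon>" by blast
  qed
qed

end

section \<open>Almost invariant vectors and the invariant mean\<close>


text \<open>
  Tychonoff's theorem in place of an ultrafilter: the functionals \<open>T n\<close> lie in a product of discs, so
  they have a cluster point \<open>m\<close>, and a filter finer than \<open>sequentially\<close> along which they converge to
  \<open>m\<close> pointwise.
\<close>

lemma cluster_functional:
  fixes T :: "nat \<Rightarrow> 'f \<Rightarrow> complex"
  assumes bound: "\<And>n f. cmod (T n f) \<le> B f"
  obtains F m where "F \<noteq> bot" "F \<le> sequentially" "\<And>f. ((\<lambda>n. T n f) \<longlongrightarrow> m f) F"
proof -
  let ?C = "\<Pi>\<^sub>E f\<in>UNIV. cball (0 :: complex) (B f)"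
  have "compactin (product_topology (\<lambda>_. euclidean) UNIV) ?C"
    unfolding compactin_PiE by simp
  then have "compact ?C" by (simp add: euclidean_product_topology)
  moreover have "filtermap T sequentially \<noteq> bot" by (simp add: filtermap_bot_iff)
  moreover have "\<forall>\<^sub>F m in filtermap T sequentially. m \<in> ?C"
    using bound by (simp add: eventually_filtermap PiE_iff)
  ultimately obtain m where m: "inf (nhds m) (filtermap T sequentially) \<noteq> bot"
    unfolding compact_filter by blast
  define F where "F = inf (filtercomap T (nhds m)) sequentially"
  show ?thesis
  proof
    show "F \<noteq> bot"
    proof
      assume "F = bot"
      then have "eventually (\<lambda>_. False) (inf (filtercomap T (nhds m)) sequentially)"
        by (simp add: F_def)
      then obtain P Q where P: "eventually P (filtercomap T (nhds m))" and Q: "eventually Q sequentially"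
        and PQ: "\<And>n. P n \<Longrightarrow> Q n \<Longrightarrow> False"
        unfolding eventually_inf by blast
      from P obtain R where R: "eventually R (nhds m)" "\<And>n. R (T n) \<Longrightarrow> P n"
        unfolding eventually_filtercomap by blast
      have "eventually (\<lambda>x. \<not> R x) (filtermap T sequentially)"
        unfolding eventually_filtermap using Q by eventually_elim (use R(2) PQ in blast)
      then have "eventually (\<lambda>_. False) (inf (nhds m) (filtermap T sequentially))"
        unfolding eventually_inf using R(1) by blast
      then show False using m by (simp add: trivial_limit_def)
    qed
    show "F \<le> sequentially" by (simp add: F_def)
    fix f
    have "(T \<longlongrightarrow> m) F"
      unfolding F_def by (rule tendsto_mono[OF inf.cobounded1 filterlim_filtercomap])
    from continuous_on_tendsto_compose[OF continuous_on_product_coordinates[of f] this]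
    show "((\<lambda>n. T n f) \<longlongrightarrow> m f) F" by simp
  qed
qed

lemma norm_integral_le_AE:
  fixes f :: "'w \<Rightarrow> complex"
  assumes f: "integrable M f" and w: "integrable M w" and le: "AE \<omega> in M. norm (f \<omega>) \<le> w \<omega>"
  shows "norm (integral\<^sup>L M f) \<le> integral\<^sup>L M w"
  using integral_norm_bound[of M f] integral_mono_AE[OF integrable_norm[OF f] w le] by linarith

lemma Linfinity_measurable: "f \<in> Linfinity M \<Longrightarrow> f \<in> borel_measurable M"
  by (simp add: Linfinity_def)

lemma Linfinity_lincomb:
  assumes "f \<in> Linfinity M" "h \<in> Linfinity M"
  shows "(\<lambda>\<omega>. c * f \<omega> + d * h \<omega>) \<in> Linfinity M"
proof -
  obtain A B where A: "AE \<omega> in M. cmod (f \<omega>) \<le> A" and B: "AE \<omega> in M. cmod (h \<omega>) \<le> B"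
    using assms by (auto simp: Linfinity_def)
  have "AE \<omega> in M. cmod (c * f \<omega> + d * h \<omega>) \<le> cmod c * A + cmod d * B"
    using A B
  proof eventually_elim
    case (elim \<omega>)
    have "cmod (c * f \<omega> + d * h \<omega>) \<le> cmod c * cmod (f \<omega>) + cmod d * cmod (h \<omega>)"
      using norm_triangle_ineq[of "c * f \<omega>" "d * h \<omega>"] by (simp add: norm_mult)
    also have "\<dots> \<le> cmod c * A + cmod d * B"
      using elim by (intro add_mono mult_left_mono) auto
    finally show ?case .
  qed
  then show ?thesis using assms by (auto simp: Linfinity_def)
qed

context proper_gaussian_increments
begin

text \<open>
  Intervals of length \<open>Suc n\<close>, so that the measure is positive already for \<open>n = 0\<close>.
\<close>

definition slab :: "nat \<Rightarrow> (nat \<Rightarrow> 'g \<Rightarrow> real) set" where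
  "slab n = {x. 0 \<le> x 0 0 \<and> x 0 0 \<le> real (Suc n)}"

lemma slab_sets: "slab n \<in> sets path_measure"
  unfolding slab_def sets_path_measure by (rule interval_sets)

lemma emeasure_slab: "emeasure path_measure (slab n) = ennreal (real (Suc n))"
  unfolding slab_def by (subst emeasure_interval) auto

lemma measure_slab: "measure path_measure (slab n) = real (Suc n)"
  by (simp add: measure_def emeasure_slab)

lemma shifted_slab: "shift g -` slab n = {x. 0 \<le> x 0 (- g) \<and> x 0 (- g) \<le> real (Suc n)}"
  by (auto simp: slab_def shift_def)

lemma shifted_slab_sets: "shift g -` slab n \<in> sets path_measure"
  unfolding shifted_slab sets_path_measure by (rule interval_sets)

lemma emeasure_shifted_slab: "emeasure path_measure (shift g -` slab n) = ennreal (real (Suc n))"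
  unfolding shifted_slab by (subst emeasure_interval) auto

text \<open>
  The slab grows with \<open>n\<close>, while the part of it moved out by \<open>g\<close> has a measure bounded
  independently of \<open>n\<close>: the slabs form a Folner sequence.
\<close>

lemma measure_slab_diff:
  "measure path_measure (slab n - shift g -` slab n) \<le> sqrt (\<psi> g)"
  "measure path_measure (shift g -` slab n - slab n) \<le> sqrt (\<psi> g)"
proof -
  have "slab n - shift g -` slab n = {x. (0 \<le> x 0 0 \<and> x 0 0 \<le> real (Suc n)) \<and> \<not> (0 \<le> x 0 (- g) \<and> x 0 (- g) \<le> real (Suc n))}"
    unfolding shifted_slab by (auto simp: slab_def)
  then have "emeasure path_measure (slab n - shift g -` slab n) \<le> ennreal (sqrt (\<psi> g))"
    using emeasure_interval_leave[of 0 0 "real (Suc n)" "- g"] by simp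
  then show "measure path_measure (slab n - shift g -` slab n) \<le> sqrt (\<psi> g)"
    unfolding measure_def by (rule enn2real_leI[rotated]) (simp add: \<psi>_nonneg)
  have "shift g -` slab n - slab n = {x. (0 \<le> x 0 (- g) \<and> x 0 (- g) \<le> real (Suc n)) \<and> \<not> (0 \<le> x 0 0 \<and> x 0 0 \<le> real (Suc n))}"
    unfolding shifted_slab by (auto simp: slab_def)
  then have "emeasure path_measure (shift g -` slab n - slab n) \<le> ennreal (sqrt (\<psi> g))"
    using emeasure_interval_leave[of 0 "- g" "real (Suc n)" 0] by (simp add: \<psi>_uminus)
  then show "measure path_measure (shift g -` slab n - slab n) \<le> sqrt (\<psi> g)"
    unfolding measure_def by (rule enn2real_leI[rotated]) (simp add: \<psi>_nonneg)
qed

definition \<xi> :: "nat \<Rightarrow> (nat \<Rightarrow> 'g \<Rightarrow> real) \<Rightarrow> complex" where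
  "\<xi> n x = of_real (1 / sqrt (real (Suc n))) * indicator (slab n) x"

lemma \<xi>_L2: "\<xi> n \<in> L2 path_measure"
  unfolding \<xi>_def[abs_def] by (intro L2_scale L2_indicator slab_sets) (simp add: emeasure_slab)

lemma L2_norm_\<xi>: "L2_norm path_measure (\<xi> n) = 1"
proof -
  have "(L2_norm path_measure (indicator (slab n)))\<^sup>2 = (LINT x|path_measure. indicator (slab n) x)"
    unfolding L2_norm_power2 by (rule Bochner_Integration.integral_cong) (auto simp: indicator_def)
  also have "\<dots> = real (Suc n)"
    using slab_sets by (simp add: space_path_measure measure_slab)
  finally have "L2_norm path_measure (indicator (slab n)) = sqrt (real (Suc n))"
    by (metis L2_norm_nonneg real_sqrt_unique)
  then show ?thesis
    unfolding \<xi>_def[abs_def] L2_norm_scale by (simp add: norm_divide)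
qed

lemma \<xi>_nonneg: "\<xi> n x \<in> \<real>\<^sub>\<ge>\<^sub>0"
  by (auto simp: \<xi>_def indicator_def complex_nonneg_Reals_iff)

lemma Re_inner_\<xi>:
  "Re (L2_inner path_measure (rep g (\<xi> n)) (\<xi> n)) = 1 - measure path_measure (slab n - shift (- g) -` slab n) / real (Suc n)"
proof -
  let ?S = "slab n \<inter> shift (- g) -` slab n"
  have fin: "emeasure path_measure (slab n) \<noteq> \<infinity>" by (simp add: emeasure_slab)
  have "L2_inner path_measure (rep g (\<xi> n)) (\<xi> n) = (LINT x|path_measure. complex_of_real (indicator ?S x / real (Suc n)))"
    unfolding L2_inner_def rep_apply
    by (rule Bochner_Integration.integral_cong)
       (auto simp: \<xi>_def indicator_def simp flip: of_real_mult of_real_divide)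
  also have "\<dots> = complex_of_real (LINT x|path_measure. indicator ?S x / real (Suc n))"
    by (rule integral_complex_of_real)
  finally have "Re (L2_inner path_measure (rep g (\<xi> n)) (\<xi> n)) = (LINT x|path_measure. indicator ?S x) / real (Suc n)"
    by simp
  also have "(LINT x|path_measure. indicator ?S x) = measure path_measure ?S"
    using slab_sets shifted_slab_sets by (simp add: space_path_measure)
  also have "\<dots> = real (Suc n) - measure path_measure (slab n - shift (- g) -` slab n)"
  proof -
    have "slab n - shift (- g) -` slab n = slab n - ?S" by blast
    moreover have "measure path_measure (slab n - ?S) = measure path_measure (slab n) - measure path_measure ?S"
      using slab_sets shifted_slab_sets by (intro measure_Diff fin sets.Int) auto
    ultimately show ?thesis by (simp add: measure_slab)
  qed
  finally show ?thesis by (simp add: diff_divide_distrib)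
qed

text \<open>
  By continuity \<open>\<psi>\<close> is bounded on the compact set, so the defect of invariance is there uniformly of
  order \<open>1 / n\<close>.
\<close>

lemma almost_invariant_\<xi>:
  assumes Q: "compact Q" "Q \<noteq> {}"
  shows "(\<lambda>n. INF g\<in>Q. Re (L2_inner path_measure (rep g (\<xi> n)) (\<xi> n))) \<longlonglongrightarrow> 1"
proof -
  let ?c = "\<lambda>n g. Re (L2_inner path_measure (rep g (\<xi> n)) (\<xi> n))"
  have "compact (\<psi> ` Q)"
    using Q(1) continuous_\<psi> by (intro compact_continuous_image) (auto intro: continuous_on_subset)
  then have "bdd_above (\<psi> ` Q)" by (intro bounded_imp_bdd_above compact_imp_bounded)
  then obtain C where C: "\<And>g. g \<in> Q \<Longrightarrow> \<psi> g \<le> C" unfolding bdd_above_def by blast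
  have lower: "1 - sqrt C / real (Suc n) \<le> ?c n g" if "g \<in> Q" for n g
  proof -
    have "measure path_measure (slab n - shift (- g) -` slab n) \<le> sqrt C"
      by (rule order_trans[OF measure_slab_diff(1)[of n "- g", unfolded \<psi>_uminus] real_sqrt_le_mono[OF C[OF that]]])
    then show ?thesis unfolding Re_inner_\<xi> by (intro diff_left_mono divide_right_mono) simp_all
  qed
  have upper: "?c n g \<le> 1" for n g
    unfolding Re_inner_\<xi> by simp
  obtain g0 where g0: "g0 \<in> Q" using Q(2) by blast
  have "(\<lambda>n. 1 - sqrt C / real (Suc n)) \<longlonglongrightarrow> 1 - 0"
    by (intro tendsto_intros LIMSEQ_Suc[OF lim_const_over_n])
  then have lim: "(\<lambda>n. 1 - sqrt C / real (Suc n)) \<longlonglongrightarrow> 1" by simp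
  show ?thesis
  proof (rule tendsto_sandwich[OF _ _ lim tendsto_const])
    show "\<forall>\<^sub>F n in sequentially. 1 - sqrt C / real (Suc n) \<le> (INF g\<in>Q. ?c n g)"
      using Q(2) lower by (intro always_eventually allI cINF_greatest) auto
    show "\<forall>\<^sub>F n in sequentially. (INF g\<in>Q. ?c n g) \<le> 1"
    proof (intro always_eventually allI)
      fix n
      have "bdd_below (?c n ` Q)" using lower by (intro bdd_belowI2) auto
      then show "(INF g\<in>Q. ?c n g) \<le> 1" using g0 upper by (rule cINF_lower2)
    qed
  qed
qed

lemma AE_shift:
  assumes "AE x in path_measure. Q x"
  shows "AE x in path_measure. Q (shift g x)"
  by (rule AE_distrD[OF shift_measurable]) (simp only: distr_shift assms)

lemma rep_Linfinity:
  assumes "f \<in> Linfinity path_measure"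
  shows "rep g f \<in> Linfinity path_measure"
proof -
  obtain C where "AE x in path_measure. cmod (f x) \<le> C" using assms by (auto simp: Linfinity_def)
  from AE_shift[OF this, of "- g"] have "AE x in path_measure. cmod (rep g f x) \<le> C"
    by (simp add: rep_apply)
  then show ?thesis using measurable_rep[OF Linfinity_measurable[OF assms]] by (auto simp: Linfinity_def)
qed

definition slab_mean :: "nat \<Rightarrow> ((nat \<Rightarrow> 'g \<Rightarrow> real) \<Rightarrow> complex) \<Rightarrow> complex" where
  "slab_mean n f = (LINT x|path_measure. f x * indicator (slab n) x) / of_nat (Suc n)"

lemma integrable_times_indicator:
  assumes f: "f \<in> Linfinity path_measure" and S: "S \<in> sets path_measure" "emeasure path_measure S < \<infinity>"
  shows "integrable path_measure (\<lambda>x. f x * indicator S x)"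
proof -
  obtain C where C: "AE x in path_measure. cmod (f x) \<le> C" using f by (auto simp: Linfinity_def)
  have [measurable]: "f \<in> borel_measurable path_measure" "S \<in> sets path_measure"
    using Linfinity_measurable[OF f] S by auto
  show ?thesis
  proof (rule Bochner_Integration.integrable_bound)
    show "integrable path_measure (\<lambda>x. C * indicator S x :: real)"
      using S by (intro integrable_mult_right integrable_real_indicator)
    show "AE x in path_measure. norm (f x * indicator S x) \<le> norm (C * indicator S x :: real)"
      using C by eventually_elim (auto simp: indicator_def)
  qed measurable
qed

lemma cmod_slab_mean_le:
  assumes f: "f \<in> Linfinity path_measure" and C: "AE x in path_measure. cmod (f x) \<le> C"
  shows "cmod (slab_mean n f) \<le> C"
proof -
  have "cmod (LINT x|path_measure. f x * indicator (slab n) x) \<le> (LINT x|path_measure. C * indicator (slab n) x)"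
  proof (rule norm_integral_le_AE)
    show "integrable path_measure (\<lambda>x. f x * indicator (slab n) x)"
      by (intro integrable_times_indicator f slab_sets) (simp add: emeasure_slab)
    show "integrable path_measure (\<lambda>x. C * indicator (slab n) x :: real)"
      by (intro integrable_mult_right integrable_real_indicator slab_sets) (simp add: emeasure_slab)
    show "AE x in path_measure. norm (f x * indicator (slab n) x) \<le> C * indicator (slab n) x"
      using C by eventually_elim (auto simp: indicator_def)
  qed
  also have "\<dots> = C * real (Suc n)"
    using slab_sets by (simp add: space_path_measure measure_slab)
  finally show ?thesis
    by (simp add: slab_mean_def norm_divide divide_le_eq del: of_nat_Suc)
qed

text \<open>
  By invariance of the measure the translation can be moved from the function to the slab.
\<close>

lemma slab_mean_rep_diff:
  assumes f: "f \<in> Linfinity path_measure" and C: "AE x in path_measure. cmod (f x) \<le> C"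
  shows "cmod (slab_mean n (rep g f) - slab_mean n f) \<le> 2 * C * sqrt (\<psi> g) / real (Suc n)"
proof -
  let ?A = "shift g -` slab n" and ?B = "slab n"
  have A: "?A \<in> sets path_measure" "emeasure path_measure ?A < \<infinity>"
    by (auto simp: shifted_slab_sets emeasure_shifted_slab)
  have B: "?B \<in> sets path_measure" "emeasure path_measure ?B < \<infinity>"
    by (auto simp: slab_sets emeasure_slab)
  have D: "S - T \<in> sets path_measure" "emeasure path_measure (S - T) < \<infinity>"
    if "S \<in> sets path_measure" "T \<in> sets path_measure" "emeasure path_measure S < \<infinity>" for S T
    using that emeasure_mono[of "S - T" S path_measure] by (auto intro: le_less_trans)
  have C0: "0 \<le> C"
  proof (rule ccontr)
    assume "\<not> 0 \<le> C"
    then have "AE x in path_measure. False"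
      by (intro eventually_mono[OF C]) (use norm_ge_zero order_trans in blast)
    then have "emeasure path_measure UNIV = 0"
      using ae_filter_eq_bot_iff[of path_measure] by (simp add: trivial_limit_def space_path_measure)
    moreover have "emeasure path_measure (slab 0) \<le> emeasure path_measure UNIV"
      using sets.top[of path_measure] by (intro emeasure_mono) (simp_all add: space_path_measure)
    ultimately show False by (simp add: emeasure_slab)
  qed
  have "(LINT x|path_measure. rep g f x * indicator ?B x) = (LINT x|path_measure. (\<lambda>y. f y * indicator ?A y) (shift (- g) x))"
    by (rule Bochner_Integration.integral_cong) (auto simp: rep_apply indicator_def shift_minus_cancel)
  also have "\<dots> = (LINT x|path_measure. f x * indicator ?A x)"
    using integrable_times_indicator[OF f A] by (intro integral_shift) simp
  finally have "(LINT x|path_measure. rep g f x * indicator ?B x) - (LINT x|path_measure. f x * indicator ?B x) =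
      (LINT x|path_measure. f x * indicator ?A x - f x * indicator ?B x)"
    using integrable_times_indicator[OF f A] integrable_times_indicator[OF f B] by simp
  also have "cmod \<dots> \<le> (LINT x|path_measure. C * (indicator (?A - ?B) x + indicator (?B - ?A) x))"
  proof (rule norm_integral_le_AE)
    show "integrable path_measure (\<lambda>x. f x * indicator ?A x - f x * indicator ?B x)"
      using integrable_times_indicator[OF f A] integrable_times_indicator[OF f B] by simp
    show "integrable path_measure (\<lambda>x. C * (indicator (?A - ?B) x + indicator (?B - ?A) x) :: real)"
      using D A B by (intro integrable_mult_right Bochner_Integration.integrable_add integrable_real_indicator) auto
    show "AE x in path_measure. norm (f x * indicator ?A x - f x * indicator ?B x) \<le> C * (indicator (?A - ?B) x + indicator (?B - ?A) x)"
      using C by eventually_elim (auto simp: indicator_def)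
  qed
  also have "\<dots> = C * (measure path_measure (?A - ?B) + measure path_measure (?B - ?A))"
    using D[OF A(1) B(1) A(2)] D[OF B(1) A(1) B(2)] by (simp add: space_path_measure)
  also have "\<dots> \<le> C * (sqrt (\<psi> g) + sqrt (\<psi> g))"
    by (intro mult_left_mono add_mono C0 measure_slab_diff)
  finally have "cmod ((LINT x|path_measure. rep g f x * indicator ?B x) - (LINT x|path_measure. f x * indicator ?B x)) / real (Suc n)
      \<le> 2 * C * sqrt (\<psi> g) / real (Suc n)"
    by (intro divide_right_mono) auto
  then show ?thesis
    unfolding slab_mean_def diff_divide_distrib[symmetric] norm_divide by (simp del: of_nat_Suc)
qed

text \<open>
  The mean is a cluster point of the averages over the slabs. Linearity, positivity and normalisation
  hold for each average and pass to the limit; invariance appears in the limit by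
  \<open>slab_mean_rep_diff\<close>.
\<close>

theorem invariant_mean_exists: "\<exists>m. invariant_mean path_measure shift m"
proof -
  \<comment> \<open>The value \<open>0\<close> outside \<open>Linfinity\<close> makes every evaluation of the averages bounded in \<open>n\<close>.\<close>
  define T where "T n f = (if f \<in> Linfinity path_measure then slab_mean n f else 0)" for n f
  have "\<exists>B. \<forall>n. cmod (T n f) \<le> B" for f
  proof (cases "f \<in> Linfinity path_measure")
    case True
    then obtain C where "AE x in path_measure. cmod (f x) \<le> C" by (auto simp: Linfinity_def)
    then show ?thesis using cmod_slab_mean_le[OF True] True by (auto simp: T_def)
  qed (auto simp: T_def)
  then obtain B where B: "\<And>n f. cmod (T n f) \<le> B f" by metis
  obtain F m where F: "F \<noteq> bot" "F \<le> sequentially" and lim: "\<And>f. ((\<lambda>n. T n f) \<longlongrightarrow> m f) F"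
    using cluster_functional[of T B, OF B] by blast
  let ?L = "Linfinity path_measure"
  have uniq: "m f = a" if "((\<lambda>n. T n f) \<longlongrightarrow> a) F" for f a
    using tendsto_unique[OF F(1) lim that] .
  show ?thesis
  proof (intro exI[of _ m])
    show "invariant_mean path_measure shift m"
      unfolding invariant_mean_def
    proof (intro conjI ballI allI impI)
      fix f h assume f: "f \<in> ?L" and h: "h \<in> ?L" and eq: "AE x in path_measure. f x = h x"
      have "T n f = T n h" for n
      proof -
        have "(LINT x|path_measure. f x * indicator (slab n) x) = (LINT x|path_measure. h x * indicator (slab n) x)"
        proof (rule integral_cong_AE)
          show "AE x in path_measure. f x * indicator (slab n) x = h x * indicator (slab n) x"
            using eq by (rule eventually_mono) simp
        qed (intro borel_measurable_times borel_measurable_indicator slab_sets Linfinity_measurable f h)+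
        then show ?thesis using f h by (simp add: T_def slab_mean_def)
      qed
      then show "m f = m h" using uniq[of f "m h"] lim[of h] by simp
    next
      fix f h c d assume f: "f \<in> ?L" and h: "h \<in> ?L"
      have "T n (\<lambda>x. c * f x + d * h x) = c * T n f + d * T n h" for n
      proof -
        have fin: "emeasure path_measure (slab n) < \<infinity>" by (simp add: emeasure_slab)
        have "(LINT x|path_measure. (c * f x + d * h x) * indicator (slab n) x) =
            (LINT x|path_measure. c * (f x * indicator (slab n) x) + d * (h x * indicator (slab n) x))"
          by (rule Bochner_Integration.integral_cong) (auto simp: algebra_simps)
        also have "\<dots> = c * (LINT x|path_measure. f x * indicator (slab n) x) + d * (LINT x|path_measure. h x * indicator (slab n) x)"
          using integrable_times_indicator[OF f slab_sets fin] integrable_times_indicator[OF h slab_sets fin] by simp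
        finally show ?thesis
          using f h Linfinity_lincomb[OF f h, of c d] by (simp add: T_def slab_mean_def add_divide_distrib del: of_nat_Suc)
      qed
      then show "m (\<lambda>x. c * f x + d * h x) = c * m f + d * m h"
        by (intro uniq) (auto intro!: tendsto_intros lim)
    next
      fix f assume f: "f \<in> ?L" and pos: "AE x in path_measure. f x \<in> \<real>\<^sub>\<ge>\<^sub>0"
      have "T n f \<in> \<real>\<^sub>\<ge>\<^sub>0" for n
      proof -
        have "AE x in path_measure. f x * indicator (slab n) x = complex_of_real (Re (f x) * indicator (slab n) x)"
          using pos by eventually_elim (auto simp: indicator_def complex_nonneg_Reals_iff complex_eq_iff)
        then have "(LINT x|path_measure. f x * indicator (slab n) x) = (LINT x|path_measure. complex_of_real (Re (f x) * indicator (slab n) x))"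
          using Linfinity_measurable[OF f] slab_sets[of n] by (intro integral_cong_AE) auto
        also have "\<dots> = complex_of_real (LINT x|path_measure. Re (f x) * indicator (slab n) x)"
          by (rule integral_complex_of_real)
        finally have "T n f = complex_of_real ((LINT x|path_measure. Re (f x) * indicator (slab n) x) / real (Suc n))"
          using f by (simp add: T_def slab_mean_def)
        moreover have "0 \<le> (LINT x|path_measure. Re (f x) * indicator (slab n) x)"
          using pos by (intro integral_nonneg_AE) (auto simp: complex_nonneg_Reals_iff elim!: eventually_mono)
        ultimately show ?thesis by (simp add: complex_nonneg_Reals_iff)
      qed
      then show "m f \<in> \<real>\<^sub>\<ge>\<^sub>0"
        by (intro Lim_in_closed_set[OF closed_nonneg_Reals_complex _ F(1) lim]) simp
    next
      have "(\<lambda>_. 1) \<in> ?L" by (auto simp: Linfinity_def intro!: exI[of _ 1])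
      then have "T n (\<lambda>_. 1) = 1" for n
        using slab_sets[of n] integral_complex_of_real[of path_measure "indicator (slab n)"]
        by (simp add: T_def slab_mean_def of_real_indicator space_path_measure measure_slab del: of_nat_Suc)
      then show "m (\<lambda>_. 1) = 1" by (intro uniq) simp
    next
      fix g f assume f: "f \<in> ?L"
      obtain C where C: "AE x in path_measure. cmod (f x) \<le> C" using f by (auto simp: Linfinity_def)
      have bound: "(\<lambda>n. 2 * C * sqrt (\<psi> g) / real (Suc n)) \<longlonglongrightarrow> 0"
        by (rule LIMSEQ_Suc[OF lim_const_over_n])
      have "cmod (T n (rep g f) - T n f) \<le> 2 * C * sqrt (\<psi> g) / real (Suc n)" for n
        using slab_mean_rep_diff[OF f C] f rep_Linfinity[OF f, of g] unfolding T_def by presburger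
      then have "(\<lambda>n. T n (rep g f) - T n f) \<longlonglongrightarrow> 0"
        by (intro Lim_null_comparison[OF _ bound] always_eventually allI)
      then have "((\<lambda>n. (T n (rep g f) - T n f) + T n f) \<longlongrightarrow> 0 + m f) F"
        by (intro tendsto_add lim tendsto_mono[OF F(2)])
      then show "m (rep g f) = m f" by (intro uniq) simp
    qed
  qed
qed

end

section \<open>The dynamical system of a group with the Haagerup property\<close>


theorem theorem1p5:
  assumes "locally_compact_space
      (euclidean :: 'g::{topological_group_add, t2_space, second_countable_topology} topology)"
    and "\<not> compact (UNIV :: 'g set)"
    and "haagerup_property TYPE('g)"
  shows "\<exists>(M :: (nat \<Rightarrow> 'g \<Rightarrow> real) measure) (a :: 'g \<Rightarrow> (nat \<Rightarrow> 'g \<Rightarrow> real) \<Rightarrow> (nat \<Rightarrow> 'g \<Rightarrow> real)).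
      C0_dynamical_system M a \<and>
      sigma_finite_measure M \<and> (\<forall>g. distr M M (a g) = M) \<and> separable_L2 M \<and>
      (\<forall>A\<in>sets M. \<forall>B\<in>sets M. emeasure M A < \<infinity> \<longrightarrow> emeasure M B < \<infinity> \<longrightarrow>
         ((\<lambda>g. measure M (a g ` A \<inter> B)) \<longlongrightarrow> 0) cocompact) \<and>
      C0_representation_L2 M (permutation_rep a) \<and>
      (\<exists>\<xi> :: nat \<Rightarrow> (nat \<Rightarrow> 'g \<Rightarrow> real) \<Rightarrow> complex.
         (\<forall>n. \<xi> n \<in> L2 M \<and> L2_norm M (\<xi> n) = 1 \<and> (AE \<omega> in M. \<xi> n \<omega> \<in> \<real>\<^sub>\<ge>\<^sub>0)) \<and>
         (\<forall>K. compact K \<longrightarrow> K \<noteq> {} \<longrightarrow>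
            (\<lambda>n. INF g\<in>K. Re (L2_inner M (permutation_rep a g (\<xi> n)) (\<xi> n))) \<longlonglongrightarrow> 1)) \<and>
      (\<exists>m. invariant_mean M a m)"
proof -
  obtain \<psi> :: "'g \<Rightarrow> real" where \<psi>: "pos_semidef (schoenberg_kernel \<psi>)" "\<psi> 0 = 0"
    "continuous_on UNIV \<psi>" "filterlim \<psi> at_top cocompact"
    by (rule proper_conditionally_negative_function[OF assms(1,3)])
  obtain P where P: "prob_space P" "sets P = sets (PiM UNIV (\<lambda>_. borel :: real measure))"
    "\<And>J t. finite J \<Longrightarrow> (CLINT x|P. iexp (\<Sum>j\<in>J. t j * x j)) =
      of_real (exp (- (\<Sum>i\<in>J. \<Sum>j\<in>J. t i * t j * schoenberg_kernel \<psi> i j) / 2))"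
    using gaussian_process_exists[OF \<psi>(1)] by blast
  interpret proper_gaussian_increments P \<psi>
    by (intro proper_gaussian_increments.intro gaussian_increments.intro gaussian_increments_axioms.intro
        proper_gaussian_increments_axioms.intro P \<psi>)
  show ?thesis
  proof (intro exI[of _ path_measure] exI[of _ shift] exI[of _ \<xi>] conjI allI impI)
    show "C0_dynamical_system path_measure shift" by (rule C0_dynamical_system_shift)
    then show "\<forall>A\<in>sets path_measure. \<forall>B\<in>sets path_measure. emeasure path_measure A < \<infinity> \<longrightarrow>
        emeasure path_measure B < \<infinity> \<longrightarrow> ((\<lambda>g. measure path_measure (shift g ` A \<inter> B)) \<longlongrightarrow> 0) cocompact"
      by (simp add: C0_dynamical_system_def)
    show "sigma_finite_measure path_measure" by (rule M.sigma_finite_measure_axioms)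
    show "AE \<omega> in path_measure. \<xi> n \<omega> \<in> \<real>\<^sub>\<ge>\<^sub>0" for n by (simp add: \<xi>_nonneg)
    show "(\<lambda>n. INF g\<in>A. Re (L2_inner path_measure (rep g (\<xi> n)) (\<xi> n))) \<longlonglongrightarrow> 1"
      if "compact A" "A \<noteq> {}" for A
      by (rule almost_invariant_\<xi>[OF that])
  qed (simp_all only: distr_shift separable_path_measure C0_rep \<xi>_L2 L2_norm_\<xi> invariant_mean_exists)
qed

end
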